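(* Let $(\widetilde{M},\phi,\xi,\eta,\widetilde{g},\varepsilon)$ be an $(n+2)$-dimensional $(\varepsilon)$-para Sasakian manifold and let $M$ be a screen semi-invariant lightlike hypersurface of $\widetilde{M}$ (with screen distribution $S(TM)$ containing $\xi$). Then the distribution $D'\perp\langle\xi\rangle$ on $M$ is integrable if and only if $$A_N\xi+\varepsilon U=0.$$
   Context: An $(\varepsilon)$-almost paracontact metric manifold $(\widetilde{M},\phi,\xi,\eta,\widetilde{g},\varepsilon)$, $\varepsilon\in\{1,-1\}$, is a smooth manifold $\widetilde{M}$ with a $(1,1)$-tensor field $\phi$, a vector field $\xi$, a 1-form $\eta$ and a semi-Riemannian metric $\widetilde{g}$ such that $\phi^2=I-\eta\otimes\xi$, $\eta(\xi)=1$, $\phi\xi=0$, $\eta\circ\phi=0$, and $\widetilde{g}(\phi X,\phi Y)=\widetilde{g}(X,Y)-\varepsilon\eta(X)\eta(Y)$ for all $X,Y$. It is $(\varepsilon)$-para Sasakian if, with $\widetilde{\nabla}$ the Levi-Civita connection of $\widetilde{g}$, $(\widetilde{\nabla}_X\phi)Y=-\widetilde{g}(\phi X,\phi Y)\xi-\varepsilon\eta(Y)\phi^2X$ for all $X,Y\in\Gamma(T\widetilde{M})$; in such a manifold $\widetilde{\nabla}_X\xi=\varepsilon\phi X$. A lightlike hypersurface $M$ of $\widetilde{M}$ is a hypersurface on which the induced metric $g=\widetilde{g}|_M$ is degenerate at every point; then the radical distribution $Rad\,TM=TM\cap TM^{\perp}=TM^\perp$ has rank 1. A screen distribution $S(TM)$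 is a fixed (automatically non-degenerate) complement of $Rad\,TM$ in $TM$. For a local nowhere-zero section $E$ of $Rad\,TM$ there is a unique local section $N$ of $S(TM)^\perp\subset T\widetilde{M}$ with $\widetilde{g}(N,N)=0$, $\widetilde{g}(E,N)=1$; the line bundle $ltr\,TM$ spanned locally by $N$ is the lightlike transversal bundle, and $T\widetilde{M}|_M=TM\oplus ltr\,TM$. Standing assumption: $\xi$ is tangent to $M$ and belongs to $\Gamma(S(TM))$. For $X\in\Gamma(TM)$ write $\widetilde{\nabla}_XN=-A_NX+\tau(X)N$ with $A_NX\in\Gamma(TM)$ ($A_N$ is the shape operator with respect to $N$, $\tau$ a 1-form). $M$ is screen semi-invariant if $\phi(Rad\,TM)\subset S(TM)$ and $\phi(ltr\,TM)\subset S(TM)$. In that case put $V=\phi E$ and $U=\phi N$, and let $D'=\langle U\rangle$, where $\langle\cdot\rangle$ denotes the distribution spanned and $\perp$ an orthogonal direct sum. *)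

theory Defs
  imports "HOL-Analysis.Analysis" "HOL-Library.Function_Algebras"
begin

text \<open>Pointwise scaling; together with the pointwise addition of
  \<^theory>\<open>HOL-Library.Function_Algebras\<close> it makes tangent vectors (below) elements of a real
  vector space.\<close>

instantiation "fun" :: (type, real_vector) real_vector
begin

definition scaleR_fun :: "real \<Rightarrow> ('a \<Rightarrow> 'b) \<Rightarrow> 'a \<Rightarrow> 'b"
  where "scaleR_fun r f = (\<lambda>x. r *\<^sub>R f x)"

instance
  by standard (simp_all add: scaleR_fun_def plus_fun_def fun_eq_iff scaleR_add_right scaleR_add_left)

end

definition linear_on :: "'v::real_vector set \<Rightarrow> ('v \<Rightarrow> 'w::real_vector) \<Rightarrow> bool"
  where "linear_on T f \<longleftrightarrow>
    (\<forall>v\<in>T. \<forall>w\<in>T. f (v + w) = f v + f w) \<and> (\<forall>r. \<forall>v\<in>T. f (r *\<^sub>R v) = r *\<^sub>R f v)"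


section \<open>Smooth manifolds\<close>

text \<open>Used on open sets of Euclidean spaces only: \<open>f\<close> is \<open>C\<^sup>k\<close> if it is \<open>k\<close> times differentiable with
  continuous iterated directional derivatives.\<close>

fun Ck_on :: "nat \<Rightarrow> 'e::euclidean_space set \<Rightarrow> ('e \<Rightarrow> 'f::real_normed_vector) \<Rightarrow> bool"
  where
    "Ck_on 0 S f \<longleftrightarrow> continuous_on S f"
  | "Ck_on (Suc k) S f \<longleftrightarrow> (\<forall>x\<in>S. f differentiable (at x)) \<and>
       (\<forall>v. Ck_on k S (\<lambda>x. frechet_derivative f (at x) v))"

definition smooth_on :: "'e::euclidean_space set \<Rightarrow> ('e \<Rightarrow> 'f::real_normed_vector) \<Rightarrow> bool"
  where "smooth_on S f \<longleftrightarrow> (\<forall>k. Ck_on k S f)"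

type_synonym ('a, 'e) chart = "'a set \<times> ('a \<Rightarrow> 'e)"

abbreviation cdom :: "('a, 'e) chart \<Rightarrow> 'a set"
  where "cdom c \<equiv> fst c"

abbreviation cmap :: "('a, 'e) chart \<Rightarrow> 'a \<Rightarrow> 'e"
  where "cmap c \<equiv> snd c"

definition crange :: "('a, 'e) chart \<Rightarrow> 'e set"
  where "crange c = cmap c ` cdom c"

definition cinv :: "('a, 'e) chart \<Rightarrow> 'e \<Rightarrow> 'a"
  where "cinv c = inv_into (cdom c) (cmap c)"

text \<open>\<open>A\<close> is a smooth atlas on the whole type \<open>'a\<close>, so that \<open>'a\<close> is a Hausdorff, second countable
  smooth manifold of dimension \<open>DIM('e)\<close>.\<close>

definition smooth_manifold ::
    "('a::{t2_space,second_countable_topology}, 'e::euclidean_space) chart set \<Rightarrow> bool"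
  where "smooth_manifold A \<longleftrightarrow>
    (\<forall>c\<in>A. open (cdom c) \<and> open (crange c) \<and> homeomorphism (cdom c) (crange c) (cmap c) (cinv c)) \<and>
    (\<Union>c\<in>A. cdom c) = UNIV \<and>
    (\<forall>c\<in>A. \<forall>d\<in>A. smooth_on (cmap c ` (cdom c \<inter> cdom d)) (cmap d \<circ> cinv c))"

definition std_atlas :: "('k::euclidean_space, 'k) chart set"
  where "std_atlas = {(UNIV, id)}"

definition chart_at :: "('a, 'e) chart set \<Rightarrow> 'a \<Rightarrow> ('a, 'e) chart"
  where "chart_at A p = (SOME c. c \<in> A \<and> p \<in> cdom c)"

definition smooth_map_on ::
    "('b::topological_space, 'f::euclidean_space) chart set \<Rightarrow>
     ('a::topological_space, 'e::euclidean_space) chart set \<Rightarrow> 'b set \<Rightarrow> ('b \<Rightarrow> 'a) \<Rightarrow> bool"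
  where "smooth_map_on B A U f \<longleftrightarrow> continuous_on U f \<and>
    (\<forall>c\<in>B. \<forall>d\<in>A. smooth_on (cmap c ` {q \<in> cdom c \<inter> U. f q \<in> cdom d}) (cmap d \<circ> f \<circ> cinv c))"


section \<open>Tangent vectors and the differential\<close>

text \<open>A tangent vector at \<open>p\<close> assigns to each chart around \<open>p\<close> a component vector, the components in
  different charts being related by the Jacobians of the coordinate changes. The value is \<open>0\<close> at all
  other charts, so that equal vectors are equal functions.\<close>

type_synonym ('a, 'e) tvec = "('a, 'e) chart \<Rightarrow> 'e"

definition chart_change ::
    "('a, 'e) chart \<Rightarrow> ('a, 'e) chart \<Rightarrow> 'a \<Rightarrow> 'e \<Rightarrow> 'e::euclidean_space"
  where "chart_change c d p = frechet_derivative (cmap d \<circ> cinv c) (at (cmap c p))"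

definition tspace :: "('a, 'e::euclidean_space) chart set \<Rightarrow> 'a \<Rightarrow> ('a, 'e) tvec set"
  where "tspace A p = {v. (\<forall>c. \<not> (c \<in> A \<and> p \<in> cdom c) \<longrightarrow> v c = 0) \<and>
    (\<forall>c\<in>A. \<forall>d\<in>A. p \<in> cdom c \<longrightarrow> p \<in> cdom d \<longrightarrow> v d = chart_change c d p (v c))}"

text \<open>The tangent vector at \<open>p\<close> with components \<open>u\<close> in the chart \<open>c\<close>.\<close>

definition coord_vec ::
    "('a, 'e::euclidean_space) chart set \<Rightarrow> ('a, 'e) chart \<Rightarrow> 'a \<Rightarrow> 'e \<Rightarrow> ('a, 'e) tvec"
  where "coord_vec A c p u = (\<lambda>d. if d \<in> A \<and> p \<in> cdom d then chart_change c d p u else 0)"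

text \<open>The derivative of a vector valued function \<open>h\<close> at \<open>p\<close> along \<open>v \<in> tspace A p\<close>; by the chain rule
  it does not depend on the chart.\<close>

definition tderiv ::
    "('a, 'e::euclidean_space) chart set \<Rightarrow> 'a \<Rightarrow> ('a, 'e) tvec \<Rightarrow>
     ('a \<Rightarrow> 'w::real_normed_vector) \<Rightarrow> 'w"
  where "tderiv A p v h =
    frechet_derivative (h \<circ> cinv (chart_at A p)) (at (cmap (chart_at A p) p)) (v (chart_at A p))"

definition tmap ::
    "('b, 'f::euclidean_space) chart set \<Rightarrow> ('a, 'e::euclidean_space) chart set \<Rightarrow> ('b \<Rightarrow> 'a) \<Rightarrow>
     'b \<Rightarrow> ('b, 'f) tvec \<Rightarrow> ('a, 'e) tvec"
  where "tmap B A f p v = (\<lambda>d. if d \<in> A \<and> f p \<in> cdom d then tderiv B p v (cmap d \<circ> f) else 0)"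

definition immersion ::
    "('b::topological_space, 'f::euclidean_space) chart set \<Rightarrow>
     ('a::topological_space, 'e::euclidean_space) chart set \<Rightarrow> ('b \<Rightarrow> 'a) \<Rightarrow> bool"
  where "immersion B A f \<longleftrightarrow>
    smooth_map_on B A UNIV f \<and> (\<forall>p. inj_on (tmap B A f p) (tspace B p))"

text \<open>Smooth sections over \<open>U\<close> of the pullback \<open>f\<^sup>*TA\<close>, i.e. vector fields along \<open>f\<close>; for \<open>f = id\<close>
  these are the vector fields on \<open>U\<close>.\<close>

definition smooth_along ::
    "('b::topological_space, 'f::euclidean_space) chart set \<Rightarrow>
     ('a::topological_space, 'e::euclidean_space) chart set \<Rightarrow> ('b \<Rightarrow> 'a) \<Rightarrow> 'b set \<Rightarrow>
     ('b \<Rightarrow> ('a, 'e) tvec) \<Rightarrow> bool"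
  where "smooth_along B A f U W \<longleftrightarrow> (\<forall>q\<in>U. W q \<in> tspace A (f q)) \<and>
    (\<forall>c\<in>B. \<forall>d\<in>A. smooth_on (cmap c ` {q \<in> cdom c \<inter> U. f q \<in> cdom d}) (\<lambda>x. W (cinv c x) d))"

abbreviation smooth_vf ::
    "('a::topological_space, 'e::euclidean_space) chart set \<Rightarrow> 'a set \<Rightarrow> ('a \<Rightarrow> ('a, 'e) tvec) \<Rightarrow> bool"
  where "smooth_vf A \<equiv> smooth_along A A id"

definition lie_bracket ::
    "('a, 'e::euclidean_space) chart set \<Rightarrow> ('a \<Rightarrow> ('a, 'e) tvec) \<Rightarrow> ('a \<Rightarrow> ('a, 'e) tvec) \<Rightarrow>
     'a \<Rightarrow> ('a, 'e) tvec"
  where "lie_bracket A X Y p = (\<lambda>d. if d \<in> A \<and> p \<in> cdom d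
    then tderiv A p (X p) (\<lambda>q. Y q d) - tderiv A p (Y p) (\<lambda>q. X q d) else 0)"


section \<open>Distributions and integrability\<close>

text \<open>Subbundle of \<open>f\<^sup>*TA\<close>: each point has a neighbourhood with a smooth frame.\<close>

definition smooth_subbundle ::
    "('b::topological_space, 'f::euclidean_space) chart set \<Rightarrow>
     ('a::topological_space, 'e::euclidean_space) chart set \<Rightarrow> ('b \<Rightarrow> 'a) \<Rightarrow>
     ('b \<Rightarrow> ('a, 'e) tvec set) \<Rightarrow> bool"
  where "smooth_subbundle B A f S \<longleftrightarrow>
    (\<forall>p. \<exists>U k. \<exists>F :: nat \<Rightarrow> 'b \<Rightarrow> ('a, 'e) tvec. open U \<and> p \<in> U \<and>
       (\<forall>i<k. smooth_along B A f U (F i)) \<and>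
       (\<forall>q\<in>U. S q = span ((\<lambda>i. F i q) ` {..<k}) \<and> dim (S q) = k))"

text \<open>A distribution \<open>\<Delta>\<close> of rank \<open>DIM('k)\<close> is integrable if through each point there passes an integral
  manifold, i.e. a submanifold whose tangent space at each of its points \<open>y\<close> is \<open>\<Delta> y\<close>. It suffices
  to ask for a piece covered by one parametrization \<open>j\<close> (an injective immersion of an open set).\<close>

definition integrable_distribution ::
    "'k::euclidean_space itself \<Rightarrow> ('b::topological_space, 'f::euclidean_space) chart set \<Rightarrow>
     ('b \<Rightarrow> ('b, 'f) tvec set) \<Rightarrow> bool"
  where "integrable_distribution _ B \<Delta> \<longleftrightarrow>
    (\<forall>p. \<exists>W. \<exists>j :: 'k \<Rightarrow> 'b. open W \<and> p \<in> j ` W \<and> inj_on j W \<and> smooth_map_on std_atlas B W j \<and>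
       (\<forall>x\<in>W. inj_on (tmap std_atlas B j x) (tspace std_atlas x) \<and>
               tmap std_atlas B j x ` tspace std_atlas x = \<Delta> (j x)))"


section \<open>Semi-Riemannian metrics and the Levi-Civita connection\<close>

definition metric_index :: "'v::real_vector set \<Rightarrow> ('v \<Rightarrow> 'v \<Rightarrow> real) \<Rightarrow> nat"
  where "metric_index T h = Max (dim ` {W. subspace W \<and> W \<subseteq> T \<and> (\<forall>v\<in>W. v \<noteq> 0 \<longrightarrow> h v v < 0)})"

definition semi_riemannian_metric ::
    "('a, 'e::euclidean_space) chart set \<Rightarrow> ('a \<Rightarrow> ('a, 'e) tvec \<Rightarrow> ('a, 'e) tvec \<Rightarrow> real) \<Rightarrow> bool"
  where "semi_riemannian_metric A g \<longleftrightarrow>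
    (\<forall>p. \<forall>v\<in>tspace A p. linear_on (tspace A p) (g p v)) \<and>
    (\<forall>p. \<forall>v\<in>tspace A p. \<forall>w\<in>tspace A p. g p v w = g p w v) \<and>
    (\<forall>p. \<forall>v\<in>tspace A p. (\<forall>w\<in>tspace A p. g p v w = 0) \<longrightarrow> v = 0) \<and>
    (\<exists>\<nu>. \<forall>p. metric_index (tspace A p) (g p) = \<nu>) \<and>
    (\<forall>c\<in>A. \<forall>u w. smooth_on (crange c)
       (\<lambda>x. g (cinv c x) (coord_vec A c (cinv c x) u) (coord_vec A c (cinv c x) w)))"

text \<open>A linear connection is given by its connection coefficients: \<open>\<Gamma> c p\<close> is the bilinear Christoffel
  map in the chart \<open>c\<close> at \<open>p\<close>. For a vector field \<open>W\<close> along \<open>f\<close> and a tangent vector \<open>v\<close> of the source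
  of \<open>f\<close>, \<open>cov_along\<close> is the induced covariant derivative: in the chart \<open>d\<close>,
  \<open>(\<nabla>\<^sub>v W)\<^sub>d = v(W\<^sub>d) + \<Gamma>\<^sub>d((df v)\<^sub>d, W\<^sub>d)\<close>.\<close>

type_synonym ('a, 'e) christoffel = "('a, 'e) chart \<Rightarrow> 'a \<Rightarrow> 'e \<Rightarrow> 'e \<Rightarrow> 'e"

definition cov_along ::
    "('b, 'f::euclidean_space) chart set \<Rightarrow> ('a, 'e::euclidean_space) chart set \<Rightarrow>
     ('a, 'e) christoffel \<Rightarrow> ('b \<Rightarrow> 'a) \<Rightarrow> 'b \<Rightarrow> ('b, 'f) tvec \<Rightarrow> ('b \<Rightarrow> ('a, 'e) tvec) \<Rightarrow> ('a, 'e) tvec"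
  where "cov_along B A \<Gamma> f p v W = (\<lambda>d. if d \<in> A \<and> f p \<in> cdom d
    then tderiv B p v (\<lambda>q. W q d) + \<Gamma> d (f p) (tmap B A f p v d) (W p d) else 0)"

definition cov ::
    "('a, 'e::euclidean_space) chart set \<Rightarrow> ('a, 'e) christoffel \<Rightarrow>
     ('a \<Rightarrow> ('a, 'e) tvec) \<Rightarrow> ('a \<Rightarrow> ('a, 'e) tvec) \<Rightarrow> 'a \<Rightarrow> ('a, 'e) tvec"
  where "cov A \<Gamma> X Y p = cov_along A A \<Gamma> id p (X p) Y"

text \<open>The last condition says that the components of \<open>\<nabla>\<^sub>X Y\<close> in the various charts form a vector
  field, which is the transformation law of the Christoffel symbols.\<close>

definition linear_connection ::
    "('a::topological_space, 'e::euclidean_space) chart set \<Rightarrow> ('a, 'e) christoffel \<Rightarrow> bool"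
  where "linear_connection A \<Gamma> \<longleftrightarrow>
    (\<forall>c\<in>A. \<forall>p\<in>cdom c. (\<forall>u. linear (\<Gamma> c p u)) \<and> (\<forall>w. linear (\<lambda>u. \<Gamma> c p u w))) \<and>
    (\<forall>c\<in>A. \<forall>u w. smooth_on (crange c) (\<lambda>x. \<Gamma> c (cinv c x) u w)) \<and>
    (\<forall>U X Y. open U \<longrightarrow> smooth_vf A U X \<longrightarrow> smooth_vf A U Y \<longrightarrow>
       (\<forall>p\<in>U. cov A \<Gamma> X Y p \<in> tspace A p))"

definition levi_civita ::
    "('a::topological_space, 'e::euclidean_space) chart set \<Rightarrow>
     ('a \<Rightarrow> ('a, 'e) tvec \<Rightarrow> ('a, 'e) tvec \<Rightarrow> real) \<Rightarrow> ('a, 'e) christoffel \<Rightarrow> bool"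
  where "levi_civita A g \<Gamma> \<longleftrightarrow> linear_connection A \<Gamma> \<and>
    (\<forall>U X Y. open U \<longrightarrow> smooth_vf A U X \<longrightarrow> smooth_vf A U Y \<longrightarrow>
       (\<forall>p\<in>U. cov A \<Gamma> X Y p - cov A \<Gamma> Y X p = lie_bracket A X Y p)) \<and>
    (\<forall>U X Y Z. open U \<longrightarrow> smooth_vf A U X \<longrightarrow> smooth_vf A U Y \<longrightarrow> smooth_vf A U Z \<longrightarrow>
       (\<forall>p\<in>U. tderiv A p (X p) (\<lambda>q. g q (Y q) (Z q)) =
                 g p (cov A \<Gamma> X Y p) (Z p) + g p (Y p) (cov A \<Gamma> X Z p)))"


section \<open>\<open>(\<epsilon>)\<close>-para Sasakian manifolds\<close>

definition almost_paracontact_metric ::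
    "('a::topological_space, 'e::euclidean_space) chart set \<Rightarrow>
     ('a \<Rightarrow> ('a, 'e) tvec \<Rightarrow> ('a, 'e) tvec) \<Rightarrow> ('a \<Rightarrow> ('a, 'e) tvec) \<Rightarrow> ('a \<Rightarrow> ('a, 'e) tvec \<Rightarrow> real) \<Rightarrow>
     ('a \<Rightarrow> ('a, 'e) tvec \<Rightarrow> ('a, 'e) tvec \<Rightarrow> real) \<Rightarrow> real \<Rightarrow> bool"
  where "almost_paracontact_metric A \<phi> \<xi> \<eta> g \<epsilon> \<longleftrightarrow>
    (\<epsilon> = 1 \<or> \<epsilon> = -1) \<and>
    (\<forall>p. linear_on (tspace A p) (\<phi> p) \<and> \<phi> p ` tspace A p \<subseteq> tspace A p) \<and>
    (\<forall>c\<in>A. \<forall>u. smooth_on (crange c) (\<lambda>x. \<phi> (cinv c x) (coord_vec A c (cinv c x) u) c)) \<and>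
    smooth_vf A UNIV \<xi> \<and>
    (\<forall>p. linear_on (tspace A p) (\<eta> p)) \<and>
    (\<forall>c\<in>A. \<forall>u. smooth_on (crange c) (\<lambda>x. \<eta> (cinv c x) (coord_vec A c (cinv c x) u))) \<and>
    semi_riemannian_metric A g \<and>
    (\<forall>p. \<eta> p (\<xi> p) = 1 \<and> \<phi> p (\<xi> p) = 0 \<and>
      (\<forall>v\<in>tspace A p. \<phi> p (\<phi> p v) = v - \<eta> p v *\<^sub>R \<xi> p \<and> \<eta> p (\<phi> p v) = 0) \<and>
      (\<forall>v\<in>tspace A p. \<forall>w\<in>tspace A p. g p (\<phi> p v) (\<phi> p w) = g p v w - \<epsilon> * \<eta> p v * \<eta> p w))"

definition para_sasakian ::
    "('a::topological_space, 'e::euclidean_space) chart set \<Rightarrow>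
     ('a \<Rightarrow> ('a, 'e) tvec \<Rightarrow> ('a, 'e) tvec) \<Rightarrow> ('a \<Rightarrow> ('a, 'e) tvec) \<Rightarrow> ('a \<Rightarrow> ('a, 'e) tvec \<Rightarrow> real) \<Rightarrow>
     ('a \<Rightarrow> ('a, 'e) tvec \<Rightarrow> ('a, 'e) tvec \<Rightarrow> real) \<Rightarrow> real \<Rightarrow> ('a, 'e) christoffel \<Rightarrow> bool"
  where "para_sasakian A \<phi> \<xi> \<eta> g \<epsilon> \<Gamma> \<longleftrightarrow>
    almost_paracontact_metric A \<phi> \<xi> \<eta> g \<epsilon> \<and> levi_civita A g \<Gamma> \<and>
    (\<forall>U X Y. open U \<longrightarrow> smooth_vf A U X \<longrightarrow> smooth_vf A U Y \<longrightarrow>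
       (\<forall>p\<in>U. cov A \<Gamma> X (\<lambda>q. \<phi> q (Y q)) p - \<phi> p (cov A \<Gamma> X Y p) =
          - (g p (\<phi> p (X p)) (\<phi> p (Y p)) *\<^sub>R \<xi> p) - (\<epsilon> * \<eta> p (Y p)) *\<^sub>R \<phi> p (\<phi> p (X p))))"


section \<open>Lightlike hypersurfaces\<close>

text \<open>Below, \<open>\<iota>\<close> is the immersion of a hypersurface with atlas \<open>B\<close> into the ambient manifold with atlas
  \<open>A\<close>. Tangent vectors of the hypersurface at \<open>p\<close> are identified with their images under the
  differential of \<open>\<iota>\<close>, so the tangent, radical, screen and transversal spaces at \<open>p\<close> are all
  subspaces of \<open>tspace A (\<iota> p)\<close>.\<close>

definition hyp_tspace ::
    "('b, 'f::euclidean_space) chart set \<Rightarrow> ('a, 'e::euclidean_space) chart set \<Rightarrow> ('b \<Rightarrow> 'a) \<Rightarrow>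
     'b \<Rightarrow> ('a, 'e) tvec set"
  where "hyp_tspace B A \<iota> p = tmap B A \<iota> p ` tspace B p"

definition to_intrinsic ::
    "('b, 'f::euclidean_space) chart set \<Rightarrow> ('a, 'e::euclidean_space) chart set \<Rightarrow> ('b \<Rightarrow> 'a) \<Rightarrow>
     'b \<Rightarrow> ('a, 'e) tvec \<Rightarrow> ('b, 'f) tvec"
  where "to_intrinsic B A \<iota> p w = the_inv_into (tspace B p) (tmap B A \<iota> p) w"

definition radical ::
    "('b, 'f::euclidean_space) chart set \<Rightarrow> ('a, 'e::euclidean_space) chart set \<Rightarrow> ('b \<Rightarrow> 'a) \<Rightarrow>
     ('a \<Rightarrow> ('a, 'e) tvec \<Rightarrow> ('a, 'e) tvec \<Rightarrow> real) \<Rightarrow> 'b \<Rightarrow> ('a, 'e) tvec set"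
  where "radical B A \<iota> g p =
    {v \<in> hyp_tspace B A \<iota> p. \<forall>w\<in>hyp_tspace B A \<iota> p. g (\<iota> p) v w = 0}"

definition lightlike_hypersurface ::
    "('b::{t2_space,second_countable_topology}, 'f::euclidean_space) chart set \<Rightarrow>
     ('a::topological_space, 'e::euclidean_space) chart set \<Rightarrow> ('b \<Rightarrow> 'a) \<Rightarrow>
     ('a \<Rightarrow> ('a, 'e) tvec \<Rightarrow> ('a, 'e) tvec \<Rightarrow> real) \<Rightarrow> bool"
  where "lightlike_hypersurface B A \<iota> g \<longleftrightarrow>
    smooth_manifold B \<and> DIM('f) + 1 = DIM('e) \<and> immersion B A \<iota> \<and> (\<forall>p. radical B A \<iota> g p \<noteq> {0})"

definition screen_distribution ::
    "('b::topological_space, 'f::euclidean_space) chart set \<Rightarrow>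
     ('a::topological_space, 'e::euclidean_space) chart set \<Rightarrow> ('b \<Rightarrow> 'a) \<Rightarrow>
     ('a \<Rightarrow> ('a, 'e) tvec \<Rightarrow> ('a, 'e) tvec \<Rightarrow> real) \<Rightarrow> ('b \<Rightarrow> ('a, 'e) tvec set) \<Rightarrow> bool"
  where "screen_distribution B A \<iota> g S \<longleftrightarrow> smooth_subbundle B A \<iota> S \<and>
    (\<forall>p. S p \<inter> radical B A \<iota> g p = {0} \<and>
          {s + r | s r. s \<in> S p \<and> r \<in> radical B A \<iota> g p} = hyp_tspace B A \<iota> p)"

text \<open>\<open>w\<close> is the transversal vector at \<open>p\<close> normalized by \<open>e\<close>.\<close>

definition transversal_for ::
    "('a, 'e::euclidean_space) chart set \<Rightarrow> ('b \<Rightarrow> 'a) \<Rightarrow>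
     ('a \<Rightarrow> ('a, 'e) tvec \<Rightarrow> ('a, 'e) tvec \<Rightarrow> real) \<Rightarrow> ('b \<Rightarrow> ('a, 'e) tvec set) \<Rightarrow>
     'b \<Rightarrow> ('a, 'e) tvec \<Rightarrow> ('a, 'e) tvec \<Rightarrow> bool"
  where "transversal_for A \<iota> g S p e w \<longleftrightarrow> w \<in> tspace A (\<iota> p) \<and> (\<forall>s\<in>S p. g (\<iota> p) w s = 0) \<and>
    g (\<iota> p) w w = 0 \<and> g (\<iota> p) e w = 1"

text \<open>\<open>E\<close> and \<open>N\<close> are corresponding local sections, over \<open>U\<close>, of the radical and transversal bundles.\<close>

definition null_pair ::
    "('b::topological_space, 'f::euclidean_space) chart set \<Rightarrow>
     ('a::topological_space, 'e::euclidean_space) chart set \<Rightarrow> ('b \<Rightarrow> 'a) \<Rightarrow>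
     ('a \<Rightarrow> ('a, 'e) tvec \<Rightarrow> ('a, 'e) tvec \<Rightarrow> real) \<Rightarrow> ('b \<Rightarrow> ('a, 'e) tvec set) \<Rightarrow>
     'b set \<Rightarrow> ('b \<Rightarrow> ('a, 'e) tvec) \<Rightarrow> ('b \<Rightarrow> ('a, 'e) tvec) \<Rightarrow> bool"
  where "null_pair B A \<iota> g S U E N \<longleftrightarrow> open U \<and>
    smooth_along B A \<iota> U E \<and> smooth_along B A \<iota> U N \<and>
    (\<forall>p\<in>U. E p \<in> radical B A \<iota> g p \<and> E p \<noteq> 0 \<and> transversal_for A \<iota> g S p (E p) (N p))"

text \<open>The fibre of \<open>ltr TM\<close> at \<open>p\<close>, i.e. the span of the vectors \<open>N\<close> at \<open>p\<close> (for all choices of \<open>E\<close>).\<close>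

definition ltr ::
    "('b, 'f::euclidean_space) chart set \<Rightarrow> ('a, 'e::euclidean_space) chart set \<Rightarrow> ('b \<Rightarrow> 'a) \<Rightarrow>
     ('a \<Rightarrow> ('a, 'e) tvec \<Rightarrow> ('a, 'e) tvec \<Rightarrow> real) \<Rightarrow> ('b \<Rightarrow> ('a, 'e) tvec set) \<Rightarrow>
     'b \<Rightarrow> ('a, 'e) tvec set"
  where "ltr B A \<iota> g S p =
    span {w. \<exists>e\<in>radical B A \<iota> g p. e \<noteq> 0 \<and> transversal_for A \<iota> g S p e w}"

text \<open>The shape operator: \<open>A\<^sub>N v\<close> is determined by \<open>\<nabla>\<^sub>v N = - A\<^sub>N v + \<tau>(v) N\<close> with \<open>A\<^sub>N v\<close> tangent to the
  hypersurface; here \<open>v \<in> tspace B p\<close>, and \<open>A\<^sub>N v\<close> is given as an element of \<open>hyp_tspace B A \<iota> p\<close>.\<close>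

definition shape_operator ::
    "('b, 'f::euclidean_space) chart set \<Rightarrow> ('a, 'e::euclidean_space) chart set \<Rightarrow>
     ('a, 'e) christoffel \<Rightarrow> ('b \<Rightarrow> 'a) \<Rightarrow> ('b \<Rightarrow> ('a, 'e) tvec) \<Rightarrow>
     'b \<Rightarrow> ('b, 'f) tvec \<Rightarrow> ('a, 'e) tvec"
  where "shape_operator B A \<Gamma> \<iota> N p v = (THE a. a \<in> hyp_tspace B A \<iota> p \<and>
    (\<exists>\<tau>. cov_along B A \<Gamma> \<iota> p v N = - a + \<tau> *\<^sub>R N p))"

definition screen_semi_invariant ::
    "('b::topological_space, 'f::euclidean_space) chart set \<Rightarrow>
     ('a::topological_space, 'e::euclidean_space) chart set \<Rightarrow> ('b \<Rightarrow> 'a) \<Rightarrow>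
     ('a \<Rightarrow> ('a, 'e) tvec \<Rightarrow> ('a, 'e) tvec) \<Rightarrow> ('a \<Rightarrow> ('a, 'e) tvec \<Rightarrow> ('a, 'e) tvec \<Rightarrow> real) \<Rightarrow>
     ('b \<Rightarrow> ('a, 'e) tvec set) \<Rightarrow> bool"
  where "screen_semi_invariant B A \<iota> \<phi> g S \<longleftrightarrow>
    (\<forall>p. \<phi> (\<iota> p) ` radical B A \<iota> g p \<subseteq> S p \<and> \<phi> (\<iota> p) ` ltr B A \<iota> g S p \<subseteq> S p)"

text \<open>The distribution \<open>D' \<bottom> \<langle>\<xi>\<rangle>\<close> on the hypersurface, with \<open>D' = \<langle>U\<rangle> = \<phi>(ltr TM)\<close>, as a family of
  subspaces of the intrinsic tangent spaces.\<close>

definition Dprime_xi ::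
    "('b, 'f::euclidean_space) chart set \<Rightarrow> ('a, 'e::euclidean_space) chart set \<Rightarrow> ('b \<Rightarrow> 'a) \<Rightarrow>
     ('a \<Rightarrow> ('a, 'e) tvec \<Rightarrow> ('a, 'e) tvec) \<Rightarrow> ('a \<Rightarrow> ('a, 'e) tvec) \<Rightarrow>
     ('a \<Rightarrow> ('a, 'e) tvec \<Rightarrow> ('a, 'e) tvec \<Rightarrow> real) \<Rightarrow> ('b \<Rightarrow> ('a, 'e) tvec set) \<Rightarrow>
     'b \<Rightarrow> ('b, 'f) tvec set"
  where "Dprime_xi B A \<iota> \<phi> \<xi> g S p =
    {v \<in> tspace B p. tmap B A \<iota> p v \<in> span (\<phi> (\<iota> p) ` ltr B A \<iota> g S p \<union> {\<xi> (\<iota> p)})}"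

end

theory Submission
  imports Defs
begin

text \<open>
  Let \<open>E\<close> and \<open>N\<close> be corresponding sections of the radical and of the transversal bundle, and write
  \<open>n = \<nabla>\<^sub>\<xi> N = - A\<^sub>N \<xi> + \<tau> N\<close>. Since \<open>N\<close> is orthogonal to \<open>\<xi>\<close>, the field \<open>\<phi> N\<close> satisfies \<open>\<phi> (\<phi> N) = N\<close>. The
  structure equation gives \<open>\<nabla>\<^sub>\<xi> (\<phi> N) = \<phi> n\<close>, because \<open>\<phi> \<xi> = 0\<close>, and \<open>\<nabla>\<^sub>X \<xi> = \<epsilon> \<phi> X\<close>, whence
  \<open>[\<xi>, \<phi> N] = \<phi> n - \<epsilon> N\<close>. If this lies in the span of \<open>\<xi>\<close> and \<open>\<phi> N\<close>, it is a multiple of \<open>\<phi> N\<close>, as \<open>\<eta>\<close>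
  annihilates it; applying \<open>\<phi>\<close>, and using that \<open>\<eta> (A\<^sub>N \<xi>) = 0\<close> by differentiating \<open>g N \<xi> = 0\<close>, the tangent
  vector \<open>A\<^sub>N \<xi> + \<epsilon> \<phi> N\<close> is a multiple of the transversal \<open>N\<close> and therefore \<open>0\<close>. Conversely,
  \<open>A\<^sub>N \<xi> = - \<epsilon> \<phi> N\<close> makes the bracket equal to \<open>\<tau> \<phi> N\<close>. This is
  \<open>bracket_in_distribution_iff\<close>, with the differential geometry in \<open>cov_along_phi\<close>, \<open>cov_along_xi\<close> and
  \<open>distribution_frame\<close>.

  So the theorem follows once integrability, which is defined by the existence of integral surfaces, is
  the same as closedness under brackets. One direction is \<open>bracket_tangent_to_integral_map\<close>. The other is
  the theorem of Frobenius for planes, \<open>frobenius_rank_two\<close>: a plane field that is closed under brackets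
  has a frame of commuting fields, namely the one that a fixed linear projection to \<open>\<real>\<^sup>2\<close> maps to the
  standard basis, and flowing along the two fields in turn sweeps out a surface. For commuting fields the
  derivative of a flow in the initial value is known in advance, and a Gronwall estimate confirms it
  (\<open>commuting_flows\<close>). Smoothness follows, as the surface solves a total differential equation.

  The fields involved are given as vector fields along the immersion. That their components on the
  hypersurface are smooth, and that null pairs \<open>E\<close>, \<open>N\<close> exist around every point, both come down to the
  smoothness of the solutions of a linear equation with smooth coefficients
  (\<open>smooth_on_linear_solution\<close>, \<open>null_pair_exists\<close>).
\<close>

section \<open>Calculus of smooth maps\<close>

abbreviation fderiv :: "('x::real_normed_vector \<Rightarrow> 'y::real_normed_vector) \<Rightarrow> 'x \<Rightarrow> 'x \<Rightarrow> 'y"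
  where "fderiv f x \<equiv> frechet_derivative f (at x)"

lemma fderiv_works: "f differentiable (at x) \<Longrightarrow> (f has_derivative fderiv f x) (at x)"
  by (simp add: frechet_derivative_works)

lemma fderiv_eq: "(f has_derivative f') (at x) \<Longrightarrow> fderiv f x = f'"
  using frechet_derivative_at by metis

lemma differentiable_cong_open:
  assumes "open S" "x \<in> S" "\<And>y. y \<in> S \<Longrightarrow> f y = g y"
  shows "f differentiable (at x) \<longleftrightarrow> g differentiable (at x)"
  using assms unfolding differentiable_def by (metis has_derivative_transform_within_open)

lemma fderiv_cong_open:
  assumes "open S" "x \<in> S" "\<And>y. y \<in> S \<Longrightarrow> f y = g y"
  shows "fderiv f x = fderiv g x"
proof -
  have "(f has_derivative f') (at x) \<longleftrightarrow> (g has_derivative f') (at x)" for f'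
    using assms by (metis has_derivative_transform_within_open)
  then show ?thesis by (simp add: frechet_derivative_def)
qed

lemma Ck_on_cong:
  assumes "open S" "\<And>x. x \<in> S \<Longrightarrow> f x = g x"
  shows "Ck_on k S f \<longleftrightarrow> Ck_on k S g"
  using assms(2)
proof (induction k arbitrary: f g)
  case 0
  then show ?case by (auto intro: continuous_on_cong[THEN iffD1])
next
  case (Suc k)
  have "Ck_on k S (\<lambda>x. fderiv f x v) \<longleftrightarrow> Ck_on k S (\<lambda>x. fderiv g x v)" for v
    by (intro Suc.IH) (simp add: fderiv_cong_open[OF assms(1) _ Suc.prems])
  then show ?case
    using differentiable_cong_open[OF assms(1) _ Suc.prems] by auto
qed

lemma Ck_on_subset: "Ck_on k S f \<Longrightarrow> T \<subseteq> S \<Longrightarrow> Ck_on k T f"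
  by (induction k arbitrary: f) (auto intro: continuous_on_subset)

lemma Ck_on_imp_continuous: "Ck_on k S f \<Longrightarrow> continuous_on S f"
proof (cases k)
  case (Suc m)
  assume "Ck_on k S f"
  with Suc show ?thesis
    by (metis Ck_on.simps(2) continuous_at_imp_continuous_on differentiable_imp_continuous_within)
qed simp

lemma Ck_on_Suc_imp: "Ck_on (Suc k) S f \<Longrightarrow> Ck_on k S f"
proof (induction k arbitrary: f)
  case 0
  then show ?case using Ck_on_imp_continuous by (metis Ck_on.simps(1))
qed (metis Ck_on.simps(2))

lemma Ck_on_SucI:
  assumes "open S" "\<And>x. x \<in> S \<Longrightarrow> (f has_derivative f' x) (at x)"
    and "\<And>v. Ck_on k S (\<lambda>x. f' x v)"
  shows "Ck_on (Suc k) S f"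
proof -
  have "Ck_on k S (\<lambda>x. fderiv f x v)" for v
    using Ck_on_cong[OF assms(1), of "\<lambda>x. fderiv f x v" "\<lambda>x. f' x v"] assms(2,3) fderiv_eq by metis
  then show ?thesis using assms(2) by (auto simp: differentiable_def)
qed

lemma Ck_on_SucD:
  assumes "Ck_on (Suc k) S f" "x \<in> S"
  shows "(f has_derivative fderiv f x) (at x)"
  using assms by (simp add: fderiv_works)

lemma Ck_on_const: "Ck_on k S (\<lambda>x. c)"
  by (induction k arbitrary: c) (auto)

lemma Ck_on_bounded_linear_comp:
  assumes "bounded_linear L" "open S" "Ck_on k S f"
  shows "Ck_on k S (\<lambda>x. L (f x))"
  using assms(3)
proof (induction k arbitrary: f)
  case 0
  then show ?case using bounded_linear.continuous_on[OF assms(1)] by simp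
next
  case (Suc k)
  show ?case
  proof (rule Ck_on_SucI[OF assms(2)])
    show "((\<lambda>x. L (f x)) has_derivative (\<lambda>v. L (fderiv f x v))) (at x)" if "x \<in> S" for x
      using bounded_linear.has_derivative[OF assms(1) Ck_on_SucD[OF Suc.prems that]] .
    show "Ck_on k S (\<lambda>x. L (fderiv f x v))" for v
      using Suc by simp
  qed
qed

lemma Ck_on_ident: "open S \<Longrightarrow> Ck_on k S (\<lambda>x. x)"
  by (cases k) (auto intro: Ck_on_const)

lemma Ck_on_add:
  assumes "open S" "Ck_on k S f" "Ck_on k S g"
  shows "Ck_on k S (\<lambda>x. f x + g x)"
  using assms(2,3)
proof (induction k arbitrary: f g)
  case 0
  then show ?case by (simp add: continuous_on_add)
next
  case (Suc k)
  show ?case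
  proof (rule Ck_on_SucI[OF assms(1)])
    show "((\<lambda>x. f x + g x) has_derivative (\<lambda>v. fderiv f x v + fderiv g x v)) (at x)" if "x \<in> S" for x
      by (rule has_derivative_add[OF Ck_on_SucD[OF Suc.prems(1) that] Ck_on_SucD[OF Suc.prems(2) that]])
    show "Ck_on k S (\<lambda>x. fderiv f x v + fderiv g x v)" for v
      using Suc by simp
  qed
qed

lemma Ck_on_sum:
  assumes "open S" "\<And>i. i \<in> I \<Longrightarrow> Ck_on k S (f i)"
  shows "Ck_on k S (\<lambda>x. \<Sum>i\<in>I. f i x)"
  using assms(2)
  by (induction I rule: infinite_finite_induct) (auto intro: Ck_on_const Ck_on_add[OF assms(1)])

lemma Ck_on_bounded_bilinear:
  assumes "bounded_bilinear B" "open S" "Ck_on k S f" "Ck_on k S g"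
  shows "Ck_on k S (\<lambda>x. B (f x) (g x))"
  using assms(3,4)
proof (induction k arbitrary: f g)
  case 0
  then show ?case by (simp add: bounded_bilinear.continuous_on[OF assms(1)])
next
  case (Suc k)
  show ?case
  proof (rule Ck_on_SucI[OF assms(2)])
    show "((\<lambda>x. B (f x) (g x)) has_derivative (\<lambda>v. B (f x) (fderiv g x v) + B (fderiv f x v) (g x))) (at x)"
      if "x \<in> S" for x
      by (rule bounded_bilinear.FDERIV[OF assms(1) Ck_on_SucD[OF Suc.prems(1) that] Ck_on_SucD[OF Suc.prems(2) that]])
    show "Ck_on k S (\<lambda>x. B (f x) (fderiv g x v) + B (fderiv f x v) (g x))" for v
      using Suc.prems by (intro Ck_on_add assms(2) Suc.IH) (auto intro: Ck_on_Suc_imp)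
  qed
qed

lemma linear_basis_expand:
  fixes L :: "'x::euclidean_space \<Rightarrow> 'y::real_vector"
  assumes "linear L"
  shows "L v = (\<Sum>b\<in>Basis. (v \<bullet> b) *\<^sub>R L b)"
  by (metis (no_types, lifting) assms euclidean_representation linear_cmul linear_sum sum.cong)

text \<open>The chain rule is written in components, so that the derivative of a composition is again built from
  compositions, products and sums, to which the induction hypothesis applies.\<close>

lemma Ck_on_compose:
  fixes f :: "'x::euclidean_space \<Rightarrow> 'y::euclidean_space" and g :: "'y \<Rightarrow> 'z::real_normed_vector"
  assumes "open S" "open T" "f ` S \<subseteq> T" "Ck_on k S f" "Ck_on k T g"
  shows "Ck_on k S (\<lambda>x. g (f x))"
  using assms(4,5)
proof (induction k arbitrary: g)
  case 0
  then show ?case using assms(3) by (auto intro: continuous_on_compose2)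
next
  case (Suc k)
  have dg: "(g has_derivative fderiv g (f x)) (at (f x))" if "x \<in> S" for x
    using Ck_on_SucD[OF Suc.prems(2)] assms(3) that by auto
  show ?case
  proof (rule Ck_on_SucI[OF assms(1)])
    show "((\<lambda>x. g (f x)) has_derivative
        (\<lambda>v. \<Sum>b\<in>Basis. (fderiv f x v \<bullet> b) *\<^sub>R fderiv g (f x) b)) (at x)" if "x \<in> S" for x
    proof (rule has_derivative_eq_rhs)
      show "((\<lambda>x. g (f x)) has_derivative (\<lambda>v. fderiv g (f x) (fderiv f x v))) (at x)"
        by (rule has_derivative_compose[OF Ck_on_SucD[OF Suc.prems(1) that] dg[OF that]])
      show "(\<lambda>v. fderiv g (f x) (fderiv f x v)) = (\<lambda>v. \<Sum>b\<in>Basis. (fderiv f x v \<bullet> b) *\<^sub>R fderiv g (f x) b)"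
        by (rule ext) (rule linear_basis_expand[OF has_derivative_linear[OF dg[OF that]]])
    qed
    show "Ck_on k S (\<lambda>x. \<Sum>b\<in>Basis. (fderiv f x v \<bullet> b) *\<^sub>R fderiv g (f x) b)" for v
    proof (intro Ck_on_sum[OF assms(1)] Ck_on_bounded_bilinear[OF bounded_bilinear_scaleR assms(1)])
      show "Ck_on k S (\<lambda>x. fderiv f x v \<bullet> b)" for b
        using Suc.prems by (intro Ck_on_bounded_linear_comp[OF bounded_linear_inner_left assms(1)]) simp
      show "Ck_on k S (\<lambda>x. fderiv g (f x) b)" for b
        using Suc.prems by (intro Suc.IH) (auto intro: Ck_on_Suc_imp)
    qed
  qed
qed

lemma Ck_on_inverse:
  fixes f :: "'x::euclidean_space \<Rightarrow> real"
  assumes "open S" "Ck_on k S f" "\<And>x. x \<in> S \<Longrightarrow> f x \<noteq> 0"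
  shows "Ck_on k S (\<lambda>x. inverse (f x))"
  using assms(2)
proof (induction k)
  case 0
  then show ?case using assms(3) by (auto intro: continuous_on_inverse)
next
  case (Suc k)
  have *: "Ck_on k S (\<lambda>x. inverse (f x))" using Suc Ck_on_Suc_imp by blast
  show ?case
  proof (rule Ck_on_SucI[OF assms(1)])
    show "((\<lambda>x. inverse (f x)) has_derivative (\<lambda>v. - (inverse (f x) * fderiv f x v * inverse (f x)))) (at x)"
      if "x \<in> S" for x
      using Deriv.has_derivative_inverse[OF assms(3)[OF that] Ck_on_SucD[OF Suc.prems that]] .
    have "Ck_on k S (\<lambda>x. -1 * (inverse (f x) * fderiv f x v * inverse (f x)))" for v
      using Suc.prems
      by (intro Ck_on_bounded_bilinear[OF bounded_bilinear_mult assms(1)] * Ck_on_const) auto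
    then show "Ck_on k S (\<lambda>x. - (inverse (f x) * fderiv f x v * inverse (f x)))" for v
      by simp
  qed
qed

lemma smooth_on_imp_Ck: "smooth_on S f \<Longrightarrow> Ck_on k S f"
  by (simp add: smooth_on_def)

lemma smooth_onD: "smooth_on S f \<Longrightarrow> x \<in> S \<Longrightarrow> (f has_derivative fderiv f x) (at x)"
  unfolding smooth_on_def using Ck_on_SucD by blast

lemma smooth_on_differentiable: "smooth_on S f \<Longrightarrow> x \<in> S \<Longrightarrow> f differentiable (at x)"
  using smooth_onD differentiable_def by blast

lemma smooth_on_linear_fderiv: "smooth_on S f \<Longrightarrow> x \<in> S \<Longrightarrow> linear (fderiv f x)"
  using smooth_onD has_derivative_linear by blast

lemma smooth_on_continuous: "smooth_on S f \<Longrightarrow> continuous_on S f"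
  using smooth_on_imp_Ck Ck_on_imp_continuous by blast

lemma smooth_on_fderiv: "smooth_on S f \<Longrightarrow> smooth_on S (\<lambda>x. fderiv f x v)"
  unfolding smooth_on_def using Ck_on.simps(2) by blast

lemma smooth_on_cong:
  "open S \<Longrightarrow> (\<And>x. x \<in> S \<Longrightarrow> f x = g x) \<Longrightarrow> smooth_on S f \<longleftrightarrow> smooth_on S g"
  unfolding smooth_on_def using Ck_on_cong by blast

lemma smooth_on_subset: "smooth_on S f \<Longrightarrow> T \<subseteq> S \<Longrightarrow> smooth_on T f"
  unfolding smooth_on_def using Ck_on_subset by blast

lemma smooth_on_const: "smooth_on S (\<lambda>x. c)"
  by (simp add: smooth_on_def Ck_on_const)

lemma smooth_on_ident: "open S \<Longrightarrow> smooth_on S (\<lambda>x. x)"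
  by (simp add: smooth_on_def Ck_on_ident)

lemma smooth_on_bounded_linear_comp:
  "bounded_linear L \<Longrightarrow> open S \<Longrightarrow> smooth_on S f \<Longrightarrow> smooth_on S (\<lambda>x. L (f x))"
  by (simp add: smooth_on_def Ck_on_bounded_linear_comp)

lemma smooth_on_add:
  "open S \<Longrightarrow> smooth_on S f \<Longrightarrow> smooth_on S g \<Longrightarrow> smooth_on S (\<lambda>x. f x + g x)"
  by (simp add: smooth_on_def Ck_on_add)

lemma smooth_on_sum:
  "open S \<Longrightarrow> (\<And>i. i \<in> I \<Longrightarrow> smooth_on S (f i)) \<Longrightarrow> smooth_on S (\<lambda>x. \<Sum>i\<in>I. f i x)"
  by (simp add: smooth_on_def Ck_on_sum)

lemma smooth_on_bounded_bilinear:
  "bounded_bilinear B \<Longrightarrow> open S \<Longrightarrow> smooth_on S f \<Longrightarrow> smooth_on S g \<Longrightarrow> smooth_on S (\<lambda>x. B (f x) (g x))"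
  by (simp add: smooth_on_def Ck_on_bounded_bilinear)

lemmas smooth_on_scaleR = smooth_on_bounded_bilinear[OF bounded_bilinear_scaleR]
lemmas smooth_on_mult = smooth_on_bounded_bilinear[OF bounded_bilinear_mult]
lemmas smooth_on_inner_const = smooth_on_bounded_linear_comp[OF bounded_linear_inner_left]

lemma smooth_on_minus: "open S \<Longrightarrow> smooth_on S f \<Longrightarrow> smooth_on S (\<lambda>x. - f x)"
  by (rule smooth_on_bounded_linear_comp[OF bounded_linear_minus[OF bounded_linear_ident]])

lemma smooth_on_diff:
  "open S \<Longrightarrow> smooth_on S f \<Longrightarrow> smooth_on S g \<Longrightarrow> smooth_on S (\<lambda>x. f x - g x)"
  using smooth_on_add[OF _ _ smooth_on_minus, of S f g] by simp

lemma smooth_on_inverse: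
  fixes f :: "'x::euclidean_space \<Rightarrow> real"
  shows "open S \<Longrightarrow> smooth_on S f \<Longrightarrow> (\<And>x. x \<in> S \<Longrightarrow> f x \<noteq> 0) \<Longrightarrow> smooth_on S (\<lambda>x. inverse (f x))"
  by (simp add: smooth_on_def Ck_on_inverse)

lemma smooth_on_compose:
  fixes f :: "'x::euclidean_space \<Rightarrow> 'y::euclidean_space" and g :: "'y \<Rightarrow> 'z::real_normed_vector"
  assumes "open S" "open T" "f ` S \<subseteq> T" "smooth_on S f" "smooth_on T g"
  shows "smooth_on S (\<lambda>x. g (f x))"
  using assms unfolding smooth_on_def by (blast intro: Ck_on_compose)

text \<open>Tensors in a chart are families of linear maps \<open>F x\<close> for which only \<open>x \<mapsto> F x u\<close> with a
  fixed argument \<open>u\<close> is given to be smooth. The next lemmas let the argument vary.\<close>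

lemma has_derivative_linear_family:
  fixes F :: "'x::real_normed_vector \<Rightarrow> 'y::euclidean_space \<Rightarrow> 'z::real_normed_vector"
  assumes "open S" "x \<in> S" "\<And>y. y \<in> S \<Longrightarrow> linear (F y)"
    and "\<And>u. (\<lambda>y. F y u) differentiable (at x)" "(w has_derivative w') (at x)"
  shows "((\<lambda>y. F y (w y)) has_derivative (\<lambda>v. fderiv (\<lambda>y. F y (w x)) x v + F x (w' v))) (at x)"
proof -
  have F: "((\<lambda>y. F y u) has_derivative fderiv (\<lambda>y. F y u) x) (at x)" for u
    using assms(4) fderiv_works by blast
  have "((\<lambda>y. \<Sum>b\<in>Basis. (w y \<bullet> b) *\<^sub>R F y b) has_derivative
     (\<lambda>v. \<Sum>b\<in>Basis. (w x \<bullet> b) *\<^sub>R fderiv (\<lambda>y. F y b) x v + (w' v \<bullet> b) *\<^sub>R F x b)) (at x)"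
    by (intro has_derivative_sum has_derivative_scaleR has_derivative_inner_left assms(5) F)
  then have 1: "((\<lambda>y. F y (w y)) has_derivative
     (\<lambda>v. \<Sum>b\<in>Basis. (w x \<bullet> b) *\<^sub>R fderiv (\<lambda>y. F y b) x v + (w' v \<bullet> b) *\<^sub>R F x b)) (at x)"
    by (rule has_derivative_transform_within_open[OF _ assms(1,2)])
      (rule linear_basis_expand[OF assms(3), symmetric])
  have "((\<lambda>y. \<Sum>b\<in>Basis. (w x \<bullet> b) *\<^sub>R F y b) has_derivative
     (\<lambda>v. \<Sum>b\<in>Basis. (w x \<bullet> b) *\<^sub>R fderiv (\<lambda>y. F y b) x v)) (at x)"
    by (intro has_derivative_sum has_derivative_scaleR_right F)
  then have "((\<lambda>y. F y (w x)) has_derivative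
     (\<lambda>v. \<Sum>b\<in>Basis. (w x \<bullet> b) *\<^sub>R fderiv (\<lambda>y. F y b) x v)) (at x)"
    by (rule has_derivative_transform_within_open[OF _ assms(1,2)])
      (rule linear_basis_expand[OF assms(3), symmetric])
  then have 2: "fderiv (\<lambda>y. F y (w x)) x = (\<lambda>v. \<Sum>b\<in>Basis. (w x \<bullet> b) *\<^sub>R fderiv (\<lambda>y. F y b) x v)"
    by (rule fderiv_eq)
  have "F x (w' v) = (\<Sum>b\<in>Basis. (w' v \<bullet> b) *\<^sub>R F x b)" for v
    by (rule linear_basis_expand[OF assms(3)[OF assms(2)]])
  with 1 show ?thesis unfolding 2 by (simp only: sum.distrib)
qed

lemma smooth_on_linear_family:
  fixes F :: "'x::euclidean_space \<Rightarrow> 'y::euclidean_space \<Rightarrow> 'z::real_normed_vector"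
  assumes "open S" "\<And>y. y \<in> S \<Longrightarrow> linear (F y)" "\<And>u. smooth_on S (\<lambda>y. F y u)" "smooth_on S w"
  shows "smooth_on S (\<lambda>y. F y (w y))"
proof -
  have "smooth_on S (\<lambda>y. \<Sum>b\<in>Basis. (w y \<bullet> b) *\<^sub>R F y b)"
    by (intro smooth_on_sum smooth_on_scaleR smooth_on_inner_const assms)
  then show ?thesis
    by (subst smooth_on_cong[OF assms(1) linear_basis_expand[OF assms(2)]])
qed

text \<open>Symmetry of second derivatives. Both mixed derivatives are compared with the second difference
  quotient over the parallelogram with sides \<open>t u\<close> and \<open>t v\<close>: the mean value theorem, applied
  in the two orders, represents it by either mixed derivative at points that tend to \<open>x\<close>.\<close>

lemma second_difference_mean_value:
  fixes f :: "'x::euclidean_space \<Rightarrow> real"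
  assumes "smooth_on S f" "t > 0"
    and S: "\<And>a b. 0 \<le> a \<Longrightarrow> a \<le> t \<Longrightarrow> 0 \<le> b \<Longrightarrow> b \<le> t \<Longrightarrow> x + a *\<^sub>R u + b *\<^sub>R v \<in> S"
  shows "\<exists>a b. 0 \<le> a \<and> a \<le> t \<and> 0 \<le> b \<and> b \<le> t \<and>
    f (x + t *\<^sub>R u + t *\<^sub>R v) - f (x + t *\<^sub>R u) - f (x + t *\<^sub>R v) + f x =
    t * t * fderiv (\<lambda>y. fderiv f y u) (x + a *\<^sub>R u + b *\<^sub>R v) v"
proof -
  have S': "x + a *\<^sub>R u \<in> S" if "0 \<le> a" "a \<le> t" for a
    using S[of a 0] that assms(2) by simp
  have lin: "fderiv f y (r *\<^sub>R z) = r * fderiv f y z" if "y \<in> S" for y r z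
    using linear_cmul[OF smooth_on_linear_fderiv[OF assms(1) that]] by simp
  have lin2: "fderiv (\<lambda>y. fderiv f y u) y (r *\<^sub>R z) = r * fderiv (\<lambda>y. fderiv f y u) y z" if "y \<in> S" for y r z
    using linear_cmul[OF smooth_on_linear_fderiv[OF smooth_on_fderiv[OF assms(1)] that]] by simp
  have "\<exists>a. 0 < a \<and> a < t \<and>
      (f (x + t *\<^sub>R u + t *\<^sub>R v) - f (x + t *\<^sub>R u)) - (f (x + 0 *\<^sub>R u + t *\<^sub>R v) - f (x + 0 *\<^sub>R u)) =
      (t - 0) * (fderiv f (x + a *\<^sub>R u + t *\<^sub>R v) u - fderiv f (x + a *\<^sub>R u) u)"
  proof (rule MVT2[OF assms(2)])
    fix a assume a: "0 \<le> a" "a \<le> t"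
    have 1: "((\<lambda>a. x + a *\<^sub>R u + t *\<^sub>R v) has_derivative (\<lambda>r. r *\<^sub>R u)) (at a)"
      "((\<lambda>a. x + a *\<^sub>R u) has_derivative (\<lambda>r. r *\<^sub>R u)) (at a)"
      by (auto intro!: derivative_eq_intros)
    have "((\<lambda>a. f (x + a *\<^sub>R u + t *\<^sub>R v)) has_derivative (\<lambda>r. fderiv f (x + a *\<^sub>R u + t *\<^sub>R v) (r *\<^sub>R u))) (at a)"
      by (rule has_derivative_compose[OF 1(1) smooth_onD[OF assms(1) S]]) (use a assms(2) in auto)
    moreover have "((\<lambda>a. f (x + a *\<^sub>R u)) has_derivative (\<lambda>r. fderiv f (x + a *\<^sub>R u) (r *\<^sub>R u))) (at a)"
      by (rule has_derivative_compose[OF 1(2) smooth_onD[OF assms(1) S']]) (use a assms(2) in auto)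
    ultimately have "((\<lambda>a. f (x + a *\<^sub>R u + t *\<^sub>R v) - f (x + a *\<^sub>R u)) has_derivative
       (\<lambda>r. fderiv f (x + a *\<^sub>R u + t *\<^sub>R v) (r *\<^sub>R u) - fderiv f (x + a *\<^sub>R u) (r *\<^sub>R u))) (at a)"
      by (rule has_derivative_diff)
    then show "((\<lambda>a. f (x + a *\<^sub>R u + t *\<^sub>R v) - f (x + a *\<^sub>R u)) has_real_derivative
        fderiv f (x + a *\<^sub>R u + t *\<^sub>R v) u - fderiv f (x + a *\<^sub>R u) u) (at a)"
      unfolding has_field_derivative_def
      by (rule has_derivative_eq_rhs) (use a assms(2) in \<open>auto simp: lin S S' fun_eq_iff right_diff_distrib mult.commute\<close>)
  qed
  then obtain a where "0 < a" "a < t" and eq0: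
    "(f (x + t *\<^sub>R u + t *\<^sub>R v) - f (x + t *\<^sub>R u)) - (f (x + 0 *\<^sub>R u + t *\<^sub>R v) - f (x + 0 *\<^sub>R u)) =
      (t - 0) * (fderiv f (x + a *\<^sub>R u + t *\<^sub>R v) u - fderiv f (x + a *\<^sub>R u) u)"
    by blast
  then have a: "0 \<le> a" "a \<le> t" by simp_all
  have eq1: "f (x + t *\<^sub>R u + t *\<^sub>R v) - f (x + t *\<^sub>R u) - f (x + t *\<^sub>R v) + f x =
      t * (fderiv f (x + a *\<^sub>R u + t *\<^sub>R v) u - fderiv f (x + a *\<^sub>R u) u)"
    using eq0 by simp
  have "\<exists>b. 0 < b \<and> b < t \<and>
      fderiv f (x + a *\<^sub>R u + t *\<^sub>R v) u - fderiv f (x + a *\<^sub>R u + 0 *\<^sub>R v) u =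
      (t - 0) * fderiv (\<lambda>y. fderiv f y u) (x + a *\<^sub>R u + b *\<^sub>R v) v"
  proof (rule MVT2[OF assms(2)])
    fix b assume b: "0 \<le> b" "b \<le> t"
    have 1: "((\<lambda>b. x + a *\<^sub>R u + b *\<^sub>R v) has_derivative (\<lambda>r. r *\<^sub>R v)) (at b)"
      by (auto intro!: derivative_eq_intros)
    have "((\<lambda>b. fderiv f (x + a *\<^sub>R u + b *\<^sub>R v) u) has_derivative
       (\<lambda>r. fderiv (\<lambda>y. fderiv f y u) (x + a *\<^sub>R u + b *\<^sub>R v) (r *\<^sub>R v))) (at b)"
      by (rule has_derivative_compose[OF 1 smooth_onD[OF smooth_on_fderiv[OF assms(1)] S[OF a b]]])
    then show "((\<lambda>b. fderiv f (x + a *\<^sub>R u + b *\<^sub>R v) u) has_real_derivative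
       fderiv (\<lambda>y. fderiv f y u) (x + a *\<^sub>R u + b *\<^sub>R v) v) (at b)"
      unfolding has_field_derivative_def
      by (rule has_derivative_eq_rhs) (simp add: lin2 S a b fun_eq_iff mult.commute)
  qed
  then obtain b where "0 < b" "b < t" and eq2:
    "fderiv f (x + a *\<^sub>R u + t *\<^sub>R v) u - fderiv f (x + a *\<^sub>R u + 0 *\<^sub>R v) u =
      (t - 0) * fderiv (\<lambda>y. fderiv f y u) (x + a *\<^sub>R u + b *\<^sub>R v) v"
    by blast
  then have "0 \<le> b" "b \<le> t" by simp_all
  with eq1 eq2 a show ?thesis by (intro exI[of _ a] exI[of _ b]) simp
qed

lemma mixed_derivatives_commute_real:
  fixes f :: "'x::euclidean_space \<Rightarrow> real"
  assumes "open S" "smooth_on S f" "x \<in> S"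
  shows "fderiv (\<lambda>y. fderiv f y u) x v = fderiv (\<lambda>y. fderiv f y v) x u"
proof -
  define G where "G = (\<lambda>u v y. fderiv (\<lambda>y. fderiv f y u) y v)"
  have cont: "isCont (G u v) x" for u v
    unfolding G_def
    using smooth_on_continuous[OF smooth_on_fderiv[OF smooth_on_fderiv[OF assms(2)]]] assms(1,3)
    by (metis continuous_on_eq_continuous_at)
  have "\<bar>G u v x - G v u x\<bar> \<le> e" if "e > 0" for e
  proof -
    obtain d1 where d1: "d1 > 0" "\<And>y. dist y x < d1 \<Longrightarrow> dist (G u v y) (G u v x) < e/2"
      using cont[of u v] \<open>e > 0\<close> unfolding continuous_at_eps_delta by (metis half_gt_zero)
    obtain d2 where d2: "d2 > 0" "\<And>y. dist y x < d2 \<Longrightarrow> dist (G v u y) (G v u x) < e/2"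
      using cont[of v u] \<open>e > 0\<close> unfolding continuous_at_eps_delta by (metis half_gt_zero)
    obtain r where r: "r > 0" "ball x r \<subseteq> S" using assms(1,3) open_contains_ball by blast
    define m where "m = min r (min d1 d2)"
    have m: "m > 0" using r d1 d2 by (simp add: m_def)
    define t where "t = m / (2 * (norm u + norm v + 1))"
    have t: "t > 0" using m by (simp add: t_def add_nonneg_pos)
    have near: "dist (x + a *\<^sub>R w + b *\<^sub>R z) x < m"
      if "0 \<le> a" "a \<le> t" "0 \<le> b" "b \<le> t" "norm w + norm z = norm u + norm v" for a b w z
    proof -
      have "dist (x + a *\<^sub>R w + b *\<^sub>R z) x \<le> a * norm w + b * norm z"
        using that norm_triangle_ineq[of "a *\<^sub>R w" "b *\<^sub>R z"] by (simp add: dist_norm)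
      also have "\<dots> \<le> t * norm w + t * norm z"
        using that by (intro add_mono mult_right_mono) auto
      also have "\<dots> = t * (norm u + norm v)" using that(5) by (simp flip: distrib_left)
      also have "\<dots> < t * (2 * (norm u + norm v + 1))"
      proof (rule mult_strict_left_mono[OF _ t])
        show "norm u + norm v < 2 * (norm u + norm v + 1)"
          using norm_ge_zero[of u] norm_ge_zero[of v] by (simp add: add_nonneg_pos)
      qed
      also have "\<dots> = m"
      proof -
        have "2 * (norm u + norm v + 1) > 0" by (simp add: add_nonneg_pos)
        then show ?thesis unfolding t_def by (metis less_irrefl nonzero_eq_divide_eq)
      qed
      finally show ?thesis .
    qed
    have inS: "x + a *\<^sub>R w + b *\<^sub>R z \<in> S"
      if "0 \<le> a" "a \<le> t" "0 \<le> b" "b \<le> t" "norm w + norm z = norm u + norm v" for a b w z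
      using near[OF that] r(2) by (auto simp: m_def dist_commute subset_eq)
    obtain a b where ab: "0 \<le> a" "a \<le> t" "0 \<le> b" "b \<le> t" and 1:
      "f (x + t *\<^sub>R u + t *\<^sub>R v) - f (x + t *\<^sub>R u) - f (x + t *\<^sub>R v) + f x =
        t * t * G u v (x + a *\<^sub>R u + b *\<^sub>R v)"
      using second_difference_mean_value[OF assms(2) t, of x u v] inS unfolding G_def by blast
    obtain a' b' where ab': "0 \<le> a'" "a' \<le> t" "0 \<le> b'" "b' \<le> t" and 2:
      "f (x + t *\<^sub>R v + t *\<^sub>R u) - f (x + t *\<^sub>R v) - f (x + t *\<^sub>R u) + f x =
        t * t * G v u (x + a' *\<^sub>R v + b' *\<^sub>R u)"
      using second_difference_mean_value[OF assms(2) t, of x v u] inS unfolding G_def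
      by (metis add.commute)
    have "t * t * G u v (x + a *\<^sub>R u + b *\<^sub>R v) = t * t * G v u (x + a' *\<^sub>R v + b' *\<^sub>R u)"
      using 1 2 by (simp add: algebra_simps)
    then have "G u v (x + a *\<^sub>R u + b *\<^sub>R v) = G v u (x + a' *\<^sub>R v + b' *\<^sub>R u)"
      using t by simp
    moreover have "dist (G u v (x + a *\<^sub>R u + b *\<^sub>R v)) (G u v x) < e/2"
      using near[OF ab] by (intro d1(2)) (simp add: m_def)
    moreover have "dist (G v u (x + a' *\<^sub>R v + b' *\<^sub>R u)) (G v u x) < e/2"
      using near[OF ab', of v u] by (intro d2(2)) (simp add: m_def)
    ultimately show ?thesis unfolding dist_real_def by linarith
  qed
  then have "\<bar>G u v x - G v u x\<bar> \<le> 0" using field_le_epsilon by (metis add_0)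
  then show ?thesis by (simp add: G_def)
qed

lemma mixed_derivatives_commute:
  fixes f :: "'x::euclidean_space \<Rightarrow> 'y::euclidean_space"
  assumes "open S" "smooth_on S f" "x \<in> S"
  shows "fderiv (\<lambda>y. fderiv f y u) x v = fderiv (\<lambda>y. fderiv f y v) x u"
proof (rule euclidean_eqI)
  fix b :: 'y
  have 1: "fderiv (\<lambda>y. f y \<bullet> b) y w = fderiv f y w \<bullet> b" if "y \<in> S" for y w
    using fderiv_eq[OF has_derivative_inner_left[OF smooth_onD[OF assms(2) that]]] by simp
  have 2: "fderiv (\<lambda>y. fderiv f y w \<bullet> b) x z = fderiv (\<lambda>y. fderiv f y w) x z \<bullet> b" for w z
    using fderiv_eq[OF has_derivative_inner_left[OF smooth_onD[OF smooth_on_fderiv[OF assms(2)] assms(3)]]]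
    by simp
  have "fderiv (\<lambda>y. fderiv f y w) x z \<bullet> b = fderiv (\<lambda>y. fderiv (\<lambda>y. f y \<bullet> b) y w) x z" for w z
    unfolding 2[symmetric] by (subst fderiv_cong_open[OF assms(1,3) 1]) auto
  then show "fderiv (\<lambda>y. fderiv f y u) x v \<bullet> b = fderiv (\<lambda>y. fderiv f y v) x u \<bullet> b"
    using mixed_derivatives_commute_real[OF assms(1) smooth_on_inner_const[OF assms(1,2)] assms(3)]
    by metis
qed


section \<open>Linear equations with smooth coefficients\<close>

text \<open>Implicit differentiation. The lower bound on \<open>A y\<close>, uniform near \<open>x\<close>, plays the part of a continuous
  inverse.\<close>

lemma linear_solution_has_derivative:
  fixes A :: "'x::euclidean_space \<Rightarrow> 'y::euclidean_space \<Rightarrow> 'y"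
  assumes "open S" "x \<in> S" and lin: "\<And>y. y \<in> S \<Longrightarrow> linear (A y)"
    and dA: "\<And>u. (\<lambda>y. A y u) differentiable (at x)" and dw: "(w has_derivative w') (at x)"
    and c: "c > 0" "\<And>y u. y \<in> S \<Longrightarrow> c * norm u \<le> norm (A y u)"
    and sol: "\<And>y. y \<in> S \<Longrightarrow> A y (v y) = w y"
  shows "\<exists>v'. (v has_derivative v') (at x) \<and>
    (\<forall>h. A x (v' h) = w' h - fderiv (\<lambda>y. A y (v x)) x h)"
proof -
  define q' where "q' h = w' h - fderiv (\<lambda>y. A y (v x)) x h" for h
  have "inj (A x)"
    unfolding linear_injective_0[OF lin[OF assms(2)]] using c(1) c(2)[OF assms(2)]
    by (metis norm_zero norm_le_zero_iff mult_le_0_iff not_less)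
  then obtain R where R: "linear R" "\<And>z. A x (R z) = z"
    using linear_injective_isomorphism[OF lin[OF assms(2)]] by blast
  have dq: "((\<lambda>y. w y - A y (v x)) has_derivative q') (at x)"
    unfolding q'_def by (intro has_derivative_diff dw fderiv_works dA)
  have lq': "linear q'" using has_derivative_linear[OF dq] .
  have bl: "bounded_linear (\<lambda>h. R (q' h))"
    using linear_compose[OF lq' R(1)] by (simp add: o_def linear_conv_bounded_linear)
  define r where "r y = w y - A y (v x) - A y (R (q' (y - x)))" for y
  \<comment> \<open>The error of the linear approximation, seen through \<open>A y\<close>; the product rule makes its
    derivative at \<open>x\<close> vanish, and the lower bound on \<open>A y\<close> carries this back to \<open>v\<close>.\<close>
  have "(r has_derivative (\<lambda>h. q' h - (fderiv (\<lambda>y. A y (R (q' (x - x)))) x h + A x (R (q' h))))) (at x)"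
    unfolding r_def
  proof (intro has_derivative_diff dq has_derivative_linear_family[OF assms(1,2) lin dA])
    have "((\<lambda>y. R (q' (y - x))) has_derivative (\<lambda>h. R (q' (h - 0)))) (at x)"
      by (intro bounded_linear.has_derivative[OF bl] has_derivative_diff has_derivative_ident has_derivative_const)
    then show "((\<lambda>y. R (q' (y - x))) has_derivative (\<lambda>h. R (q' h))) (at x)" by simp
  qed
  moreover have "q' h - (fderiv (\<lambda>y. A y (R (q' (x - x)))) x h + A x (R (q' h))) = 0" for h
  proof -
    have "R (q' (x - x)) = 0" using linear_0[OF R(1)] linear_0[OF lq'] by simp
    moreover have "fderiv (\<lambda>y. A y 0) x h = 0"
    proof -
      have "fderiv (\<lambda>y. A y 0) x = fderiv (\<lambda>y. 0) x"
        by (rule fderiv_cong_open[OF assms(1,2)]) (simp add: linear_0 lin)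
      then show ?thesis by simp
    qed
    ultimately show ?thesis by (simp add: R(2))
  qed
  ultimately have r': "(r has_derivative (\<lambda>h. 0)) (at x)" by simp
  have r0: "r x = 0" using sol[OF assms(2)] linear_0[OF R(1)] linear_0[OF lq'] linear_0[OF lin[OF assms(2)]]
    by (simp add: r_def)
  have "(v has_derivative (\<lambda>h. R (q' h))) (at x)"
    unfolding has_derivative_at_alt
  proof (intro conjI bl allI impI)
    fix e :: real assume "e > 0"
    then obtain d where d: "d > 0" "\<And>y. norm (y - x) < d \<Longrightarrow> norm (r y - r x - 0) \<le> c * e * norm (y - x)"
      using r' c(1) unfolding has_derivative_at_alt by (metis mult_pos_pos)
    obtain d2 where d2: "d2 > 0" "ball x d2 \<subseteq> S" using assms(1,2) open_contains_ball by blast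
    show "\<exists>d>0. \<forall>y. norm (y - x) < d \<longrightarrow> norm (v y - v x - R (q' (y - x))) \<le> e * norm (y - x)"
    proof (intro exI[of _ "min d d2"] conjI allI impI)
      fix y assume y: "norm (y - x) < min d d2"
      then have yS: "y \<in> S" using d2(2) by (auto simp: dist_norm norm_minus_commute subset_eq)
      have "A y (v y - v x - R (q' (y - x))) = r y"
        using sol[OF yS] by (simp add: r_def linear_diff[OF lin[OF yS]])
      then have "c * norm (v y - v x - R (q' (y - x))) \<le> c * (e * norm (y - x))"
        using c(2)[OF yS, of "v y - v x - R (q' (y - x))"] d(2)[of y] y r0 by simp
      then show "norm (v y - v x - R (q' (y - x))) \<le> e * norm (y - x)" using c(1) by simp
    qed (use d d2 in simp)
  qed
  then show ?thesis using R(2) by (auto simp: q'_def)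
qed

text \<open>Differentiating \<open>A v = w\<close> shows that the derivatives of \<open>v\<close> solve linear equations with the same
  coefficients \<open>A\<close>, which is what drives the induction.\<close>

lemma Ck_on_linear_solution:
  fixes A :: "'x::euclidean_space \<Rightarrow> 'y::euclidean_space \<Rightarrow> 'y"
  assumes "open S" and lin: "\<And>y. y \<in> S \<Longrightarrow> linear (A y)" and smooth: "\<And>u. smooth_on S (\<lambda>y. A y u)"
    and c: "c > 0" "\<And>y u. y \<in> S \<Longrightarrow> c * norm u \<le> norm (A y u)"
    and "Ck_on k S w" "\<And>y. y \<in> S \<Longrightarrow> A y (v y) = w y"
  shows "Ck_on k S v"
  using assms(6,7)
proof (induction k arbitrary: v w)
  case 0
  have "isCont v x" if x: "x \<in> S" for x
  proof -
    have "((\<lambda>y. (1/c) * norm (w y - A y (v x))) \<longlongrightarrow> (1/c) * norm (w x - A x (v x))) (at x)"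
      using 0(1) assms(1) x smooth_on_continuous[OF smooth, of "v x"]
      by (intro tendsto_intros) (auto simp: continuous_on_eq_continuous_at isCont_def)
    then have "((\<lambda>y. (1/c) * norm (w y - A y (v x))) \<longlongrightarrow> 0) (at x)" using 0(2)[OF x] by simp
    moreover have "\<forall>\<^sub>F y in at x. norm (v y - v x) \<le> (1/c) * norm (w y - A y (v x))"
    proof (rule eventually_at_topological[THEN iffD2], intro exI[of _ S] conjI assms(1) x ballI impI)
      fix y assume y: "y \<in> S"
      have eq: "A y (v y - v x) = w y - A y (v x)" using 0(2)[OF y] by (simp add: linear_diff[OF lin[OF y]])
      then show "norm (v y - v x) \<le> (1/c) * norm (w y - A y (v x))"
        using c(2)[OF y, of "v y - v x"] c(1) unfolding eq by (simp add: field_simps)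
    qed
    ultimately have "((\<lambda>y. norm (v y - v x)) \<longlongrightarrow> 0) (at x)"
      by (intro Lim_null_comparison[of "\<lambda>y. norm (v y - v x)"]) simp_all
    then show ?thesis by (simp add: isCont_def LIM_zero_iff tendsto_norm_zero_iff)
  qed
  then show ?case by (simp add: continuous_at_imp_continuous_on)
next
  case (Suc k)
  have v: "Ck_on k S v" using Suc.IH[OF Ck_on_Suc_imp[OF Suc.prems(1)] Suc.prems(2)] .
  have "\<exists>v'. (v has_derivative v') (at x) \<and>
    (\<forall>h. A x (v' h) = fderiv w x h - fderiv (\<lambda>y. A y (v x)) x h)" if x: "x \<in> S" for x
    using linear_solution_has_derivative[OF assms(1) x lin smooth_on_differentiable[OF smooth x]
        Ck_on_SucD[OF Suc.prems(1) x] c Suc.prems(2)] .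
  then obtain v' where v': "\<And>x. x \<in> S \<Longrightarrow> (v has_derivative v' x) (at x)"
    "\<And>x h. x \<in> S \<Longrightarrow> A x (v' x h) = fderiv w x h - fderiv (\<lambda>y. A y (v x)) x h"
    by metis
  show ?case
  proof (rule Ck_on_SucI[OF assms(1) v'(1)])
    fix h
    have lin': "linear (\<lambda>u. fderiv (\<lambda>y. A y u) x h)" if x: "x \<in> S" for x
    proof (rule linearI)
      note d = smooth_onD[OF smooth x]
      show "fderiv (\<lambda>y. A y (a + b)) x h = fderiv (\<lambda>y. A y a) x h + fderiv (\<lambda>y. A y b) x h" for a b
        using fderiv_cong_open[OF assms(1) x, of "\<lambda>y. A y (a + b)" "\<lambda>y. A y a + A y b"]
          fderiv_eq[OF has_derivative_add[OF d d, of a b]] by (simp add: linear_add lin)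
      show "fderiv (\<lambda>y. A y (r *\<^sub>R a)) x h = r *\<^sub>R fderiv (\<lambda>y. A y a) x h" for r a
        using fderiv_cong_open[OF assms(1) x, of "\<lambda>y. A y (r *\<^sub>R a)" "\<lambda>y. r *\<^sub>R A y a"]
          fderiv_eq[OF has_derivative_scaleR_right[OF d, of r a]] by (simp add: linear_cmul lin)
    qed
    have "Ck_on k S (\<lambda>x. \<Sum>b\<in>Basis. (v x \<bullet> b) *\<^sub>R fderiv (\<lambda>y. A y b) x h)"
      by (intro Ck_on_sum Ck_on_bounded_bilinear[OF bounded_bilinear_scaleR] assms(1)
          Ck_on_bounded_linear_comp[OF bounded_linear_inner_left] v smooth_on_imp_Ck smooth_on_fderiv smooth)
    then have "Ck_on k S (\<lambda>x. fderiv (\<lambda>y. A y (v x)) x h)"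
      by (subst Ck_on_cong[OF assms(1) linear_basis_expand[OF lin']])
    then have "Ck_on k S (\<lambda>x. fderiv w x h + - fderiv (\<lambda>y. A y (v x)) x h)"
      using Suc.prems(1)
      by (intro Ck_on_add assms(1) Ck_on_bounded_linear_comp[OF bounded_linear_minus[OF bounded_linear_ident]]) auto
    then have "Ck_on k S (\<lambda>x. fderiv w x h - fderiv (\<lambda>y. A y (v x)) x h)" by simp
    then show "Ck_on k S (\<lambda>x. v' x h)"
      by (rule Suc.IH) (rule v'(2))
  qed
qed

text \<open>A left inverse of \<open>A x0\<close> reduces injective coefficients to the square case. They stay injective near
  \<open>x0\<close>, because after composition with the left inverse they differ from the identity by less than \<open>1/2\<close>.\<close>

lemma smooth_on_linear_solution:
  fixes A :: "'x::euclidean_space \<Rightarrow> 'y::euclidean_space \<Rightarrow> 'w::euclidean_space"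
  assumes "open S" "x0 \<in> S" and "\<forall>y\<in>S. linear (A y)"
    and "\<forall>u. smooth_on S (\<lambda>y. A y u)" and inj: "inj (A x0)"
  shows "\<exists>T. open T \<and> x0 \<in> T \<and> T \<subseteq> S \<and> (\<forall>y\<in>T. inj (A y)) \<and>
    (\<forall>U v w. open U \<longrightarrow> U \<subseteq> T \<longrightarrow> smooth_on U w \<longrightarrow> (\<forall>y\<in>U. A y (v y) = w y) \<longrightarrow> smooth_on U v)"
proof -
  have lin: "linear (A y)" if "y \<in> S" for y using assms(3) that by blast
  have smooth: "smooth_on S (\<lambda>y. A y u)" for u using assms(4) by blast
  obtain L where L: "linear L" "L \<circ> A x0 = id"
    using linear_injective_left_inverse[OF lin[OF assms(2)] inj] by blast
  have blL: "bounded_linear L" using L(1) by (simp add: linear_conv_bounded_linear)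
  define B where "B y u = L (A y u)" for y u
  have linB: "linear (B y)" if "y \<in> S" for y
  proof -
    have "B y = L \<circ> A y" by (auto simp: B_def)
    then show ?thesis using linear_compose[OF lin[OF that] L(1)] by simp
  qed
  have smB: "smooth_on S (\<lambda>y. B y u)" for u
    unfolding B_def by (rule smooth_on_bounded_linear_comp[OF blL assms(1) smooth])
  have B0: "B x0 u = u" for u using fun_cong[OF L(2), of u] by (simp add: B_def)
  define e where "e y = (\<Sum>b\<in>Basis. norm (B y b - B x0 b))" for y
  have "continuous_on S e"
    unfolding e_def[abs_def] by (intro continuous_intros smooth_on_continuous smB)
  then have op: "open (S \<inter> e -` {..<1/2})"
    by (rule continuous_open_preimage[OF _ assms(1) open_lessThan])
  define T where "T = S \<inter> e -` {..<1/2}"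
  have low: "(1/2) * norm u \<le> norm (B y u)" if "y \<in> T" for y u
  proof -
    have y: "y \<in> S" "e y < 1/2" using that by (auto simp: T_def)
    have "B y u - B x0 u = (\<Sum>b\<in>Basis. (u \<bullet> b) *\<^sub>R B y b) - (\<Sum>b\<in>Basis. (u \<bullet> b) *\<^sub>R B x0 b)"
      by (rule arg_cong2[where f="(-)", OF linear_basis_expand[OF linB[OF y(1)]] linear_basis_expand[OF linB[OF assms(2)]]])
    then have eq: "B y u - B x0 u = (\<Sum>b\<in>Basis. (u \<bullet> b) *\<^sub>R (B y b - B x0 b))"
      by (simp add: scaleR_diff_right sum_subtractf)
    have "norm (B y u - B x0 u) \<le> (\<Sum>b\<in>Basis. norm ((u \<bullet> b) *\<^sub>R (B y b - B x0 b)))"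
      unfolding eq by (rule norm_sum)
    also have "\<dots> \<le> (\<Sum>b\<in>Basis. norm u * norm (B y b - B x0 b))"
      by (intro sum_mono) (simp add: Basis_le_norm mult_right_mono)
    also have "\<dots> = norm u * e y" by (simp add: e_def sum_distrib_left)
    also have "\<dots> \<le> norm u * (1/2)" using y(2) by (intro mult_left_mono) auto
    finally show ?thesis using norm_triangle_sub[of u "B y u"] B0[of u] norm_minus_commute[of u "B y u"] by simp
  qed
  show ?thesis
  proof (intro exI[of _ T] conjI ballI allI impI)
    show "open T" "x0 \<in> T" "T \<subseteq> S" using op assms(2) by (auto simp: T_def e_def[abs_def])
    show "inj (A y)" if y: "y \<in> T" for y
    proof -
      have yS: "y \<in> S" using y by (simp add: T_def)
      show ?thesis unfolding linear_injective_0[OF lin[OF yS]]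
      proof (intro allI impI)
        fix u assume "A y u = 0"
        then have "norm (B y u) = 0" by (simp add: B_def linear_0[OF L(1)])
        then show "u = 0" using low[OF y, of u] by simp
      qed
    qed
    show "smooth_on U v" if U: "open U" "U \<subseteq> T" "smooth_on U w" "\<forall>y\<in>U. A y (v y) = w y" for U v w
      unfolding smooth_on_def
    proof
      fix k
      have US: "U \<subseteq> S" using U(2) by (auto simp: T_def)
      have "smooth_on U (\<lambda>y. L (w y))"
        by (rule smooth_on_bounded_linear_comp[OF blL U(1,3)])
      then have Lw: "Ck_on k U (\<lambda>y. L (w y))" by (rule smooth_on_imp_Ck)
      show "Ck_on k U v"
      proof (rule Ck_on_linear_solution[OF U(1) _ _ _ _ Lw])
        show "linear (B y)" if "y \<in> U" for y using linB US that by blast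
        show "smooth_on U (\<lambda>y. B y u)" for u using smooth_on_subset[OF smB US] .
        show "(0::real) < 1/2" by simp
        show "1/2 * norm u \<le> norm (B y u)" if "y \<in> U" for y u using low U(2) that by blast
        show "B y (v y) = L (w y)" if "y \<in> U" for y using U(4) that by (simp add: B_def)
      qed
    qed
  qed
qed

section \<open>Commuting flows\<close>

text \<open>Composing \<open>X\<close> with the projection onto the ball makes it globally Lipschitz, so that the Picard operator
  is a contraction on all bounded continuous functions. The time \<open>\<delta>\<close> serves all initial values \<open>y\<close>.\<close>

lemma picard_local_flow:
  fixes X :: "'x::euclidean_space \<Rightarrow> 'x"
  assumes lip: "\<And>x y. x \<in> cball x0 R \<Longrightarrow> y \<in> cball x0 R \<Longrightarrow> norm (X x - X y) \<le> L * norm (x - y)"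
    and bound: "\<And>x. x \<in> cball x0 R \<Longrightarrow> norm (X x) \<le> M"
    and R: "R > 0" and L: "L \<ge> 0" and \<delta>: "\<delta> > 0" "\<delta> * L \<le> 1/8" "\<delta> * M \<le> R/8"
    and y: "y \<in> cball x0 (R/2)"
  shows "\<exists>u. u 0 = y \<and> (\<forall>s\<in>{-\<delta>..\<delta>}. u s \<in> cball x0 R \<and>
    (u has_vector_derivative X (u s)) (at s within {-\<delta>..\<delta>}))"
proof -
  let ?B = "cball x0 R"
  have B: "convex ?B" "closed ?B" "?B \<noteq> {}" using R by auto
  define Z where "Z x = X (closest_point ?B x)" for x
  have inB: "closest_point ?B x \<in> ?B" for x using closest_point_in_set[OF B(2,3)] .
  have Zlip: "norm (Z x - Z y) \<le> L * norm (x - y)" for x y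
  proof -
    have "norm (Z x - Z y) \<le> L * norm (closest_point ?B x - closest_point ?B y)"
      unfolding Z_def by (intro lip inB)
    also have "\<dots> \<le> L * norm (x - y)"
      using closest_point_lipschitz[OF B, of x y] L by (intro mult_left_mono) (simp_all add: dist_norm)
    finally show ?thesis .
  qed
  have Zbound: "norm (Z x) \<le> M" for x unfolding Z_def by (rule bound[OF inB])
  have M: "M \<ge> 0" using Zbound[of x0] norm_ge_zero order_trans by blast
  have "continuous_on ?B X"
  proof (rule continuous_onI)
    fix x e assume x: "x \<in> ?B" and "(0::real) < e"
    show "\<exists>d>0. \<forall>x'\<in>?B. dist x' x < d \<longrightarrow> dist (X x') (X x) \<le> e"
    proof (intro exI[of _ "e / (L + 1)"] conjI ballI impI)
      show "e / (L + 1) > 0" using \<open>e > 0\<close> L by simp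
      fix x' assume x': "x' \<in> ?B" "dist x' x < e / (L + 1)"
      have "dist (X x') (X x) \<le> L * dist x' x" using lip[OF x'(1) x] by (simp add: dist_norm)
      also have "\<dots> \<le> (L + 1) * dist x' x" by (intro mult_right_mono) auto
      also have "\<dots> \<le> e" using x'(2) L by (simp add: field_simps)
      finally show "dist (X x') (X x) \<le> e" .
    qed
  qed
  then have Zcont: "continuous_on UNIV Z"
    unfolding Z_def[abs_def]
    by (rule continuous_on_compose2[OF _ continuous_on_closest_point[OF B]]) (use inB in auto)
  \<comment> \<open>Integrating from the left end \<open>-\<delta>\<close> and subtracting the value at \<open>0\<close> treats both signs of \<open>s\<close> alike; the
    clamp \<open>c\<close> extends solutions to all times by constants.\<close>
  define I where "I f s = integral {-\<delta>..s} f" for f :: "real \<Rightarrow> 'x" and s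
  define c where "c s = max (-\<delta>) (min \<delta> s)" for s
  have c: "c s \<in> {-\<delta>..\<delta>}" for s using \<delta>(1) by (auto simp: c_def)
  have cI: "c s = s" if "s \<in> {-\<delta>..\<delta>}" for s using that by (auto simp: c_def)
  have Ic: "norm (I f s) \<le> K * (2 * \<delta>)"
    if "continuous_on UNIV f" "\<And>s. norm (f s) \<le> K" "s \<in> {-\<delta>..\<delta>}" for f K s
  proof -
    have "norm (I f s) \<le> K * (s - (-\<delta>))" unfolding I_def
      using that by (intro integral_bound) (auto intro: continuous_on_subset)
    also have "\<dots> \<le> K * (2 * \<delta>)" using that(3) order_trans[OF norm_ge_zero that(2)]
      by (intro mult_left_mono) auto
    finally show ?thesis .
  qed
  have Zu: "continuous_on UNIV (\<lambda>r. Z (apply_bcontfun u r))" for u :: "real \<Rightarrow>\<^sub>C 'x"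
    by (rule continuous_on_compose2[OF Zcont]) auto
  have "(\<lambda>s. y + (I (\<lambda>r. Z (apply_bcontfun u r)) (c s) - I (\<lambda>r. Z (apply_bcontfun u r)) 0)) \<in> bcontfun"
    (is "?f \<in> _") for u :: "real \<Rightarrow>\<^sub>C 'x"
  proof (rule bcontfun_normI)
    have "continuous_on {-\<delta>..\<delta>} (I (\<lambda>r. Z (apply_bcontfun u r)))"
      unfolding I_def[abs_def]
      by (intro indefinite_integral_continuous_1 integrable_continuous_real continuous_on_subset[OF Zu]) auto
    moreover have "continuous_on UNIV c" unfolding c_def[abs_def] by (intro continuous_intros)
    ultimately show "continuous_on UNIV ?f"
      by (intro continuous_intros) (auto intro: continuous_on_compose2 c)
    show "norm (?f s) \<le> norm y + (M * (2 * \<delta>) + M * (2 * \<delta>))" for s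
    proof (rule norm_triangle_mono[OF order_refl])
      have "norm (I (\<lambda>r. Z (apply_bcontfun u r)) t) \<le> M * (2 * \<delta>)" if "t \<in> {-\<delta>..\<delta>}" for t
        by (rule Ic[OF Zu Zbound that])
      from this[OF c] this[of 0]
      show "norm (I (\<lambda>r. Z (apply_bcontfun u r)) (c s) - I (\<lambda>r. Z (apply_bcontfun u r)) 0) \<le> M * (2 * \<delta>) + M * (2 * \<delta>)"
        using \<delta>(1) by (intro order_trans[OF norm_triangle_ineq4] add_mono) auto
    qed
  qed
  note mem = this
  define T where "T u = Bcontfun (\<lambda>s. y + (I (\<lambda>r. Z (apply_bcontfun u r)) (c s) - I (\<lambda>r. Z (apply_bcontfun u r)) 0))"
    for u :: "real \<Rightarrow>\<^sub>C 'x"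
  have T: "apply_bcontfun (T u) s =
      y + (I (\<lambda>r. Z (apply_bcontfun u r)) (c s) - I (\<lambda>r. Z (apply_bcontfun u r)) 0)" for u s
    unfolding T_def by (subst Bcontfun_inverse[OF mem]) (rule refl)
  have "\<exists>!u. T u = u"
  proof (rule banach_fix_type[of "1/2"], simp, simp, intro allI)
    fix u v :: "real \<Rightarrow>\<^sub>C 'x"
    have diff: "norm (I (\<lambda>r. Z (apply_bcontfun u r)) s - I (\<lambda>r. Z (apply_bcontfun v r)) s) \<le> (L * dist u v) * (2 * \<delta>)"
      if s: "s \<in> {-\<delta>..\<delta>}" for s
    proof -
      have int: "(\<lambda>r. Z (apply_bcontfun w r)) integrable_on {-\<delta>..s}" for w :: "real \<Rightarrow>\<^sub>C 'x"
        by (intro integrable_continuous_real continuous_on_subset[OF Zu]) auto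
      have eq: "I (\<lambda>r. Z (apply_bcontfun u r)) s - I (\<lambda>r. Z (apply_bcontfun v r)) s =
          I (\<lambda>r. Z (apply_bcontfun u r) - Z (apply_bcontfun v r)) s"
        unfolding I_def by (rule integral_diff[OF int int, symmetric])
      have "norm (Z (apply_bcontfun u r) - Z (apply_bcontfun v r)) \<le> L * dist u v" for r
      proof -
        have "norm (Z (apply_bcontfun u r) - Z (apply_bcontfun v r)) \<le> L * dist (apply_bcontfun u r) (apply_bcontfun v r)"
          using Zlip by (simp add: dist_norm)
        also have "\<dots> \<le> L * dist u v" by (intro mult_left_mono dist_bounded L)
        finally show ?thesis .
      qed
      then show ?thesis unfolding eq by (intro Ic s continuous_on_diff Zu)
    qed
    show "dist (T u) (T v) \<le> 1/2 * dist u v"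
    proof (rule dist_bound)
      fix s
      have "dist (apply_bcontfun (T u) s) (apply_bcontfun (T v) s) =
         norm ((I (\<lambda>r. Z (apply_bcontfun u r)) (c s) - I (\<lambda>r. Z (apply_bcontfun v r)) (c s)) -
               (I (\<lambda>r. Z (apply_bcontfun u r)) 0 - I (\<lambda>r. Z (apply_bcontfun v r)) 0))"
        by (simp add: T dist_norm algebra_simps)
      also have "\<dots> \<le> (L * dist u v) * (2 * \<delta>) + (L * dist u v) * (2 * \<delta>)"
        by (intro order_trans[OF norm_triangle_ineq4] add_mono diff[OF c] diff) (use \<delta>(1) in auto)
      also have "\<dots> = (\<delta> * L) * (4 * dist u v)" by (simp add: algebra_simps)
      also have "\<dots> \<le> (1/8) * (4 * dist u v)" using \<delta>(2) by (intro mult_right_mono) auto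
      finally show "dist (apply_bcontfun (T u) s) (apply_bcontfun (T v) s) \<le> 1/2 * dist u v" by simp
    qed
  qed
  then obtain u where u: "T u = u" by blast
  have eq: "apply_bcontfun u s = y + (I (\<lambda>r. Z (apply_bcontfun u r)) s - I (\<lambda>r. Z (apply_bcontfun u r)) 0)"
    if "s \<in> {-\<delta>..\<delta>}" for s
    using T[of u s] cI[OF that] by (simp add: u)
  have in_ball: "apply_bcontfun u s \<in> ?B" if s: "s \<in> {-\<delta>..\<delta>}" for s
  proof -
    have "norm (apply_bcontfun u s - y) \<le> M * (2 * \<delta>) + M * (2 * \<delta>)"
    proof -
      have "norm (I (\<lambda>r. Z (apply_bcontfun u r)) t) \<le> M * (2 * \<delta>)" if "t \<in> {-\<delta>..\<delta>}" for t
        by (rule Ic[OF Zu Zbound that])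
      from this[OF s] this[of 0] show ?thesis
        unfolding eq[OF s] add_diff_cancel_left'
        using \<delta>(1) by (intro order_trans[OF norm_triangle_ineq4] add_mono) auto
    qed
    also have "\<dots> = 4 * (\<delta> * M)" by simp
    also have "\<dots> \<le> R/2" using \<delta>(3) by simp
    finally show ?thesis using y dist_triangle[of x0 "apply_bcontfun u s" y]
      by (simp add: dist_norm norm_minus_commute)
  qed
  show ?thesis
  proof (intro exI[of _ "apply_bcontfun u"] conjI ballI)
    show "apply_bcontfun u 0 = y" using eq[of 0] \<delta>(1) by simp
    fix s assume s: "s \<in> {-\<delta>..\<delta>}"
    show "apply_bcontfun u s \<in> ?B" by (rule in_ball[OF s])
    have "((\<lambda>s. y + (I (\<lambda>r. Z (apply_bcontfun u r)) s - I (\<lambda>r. Z (apply_bcontfun u r)) 0))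
        has_vector_derivative 0 + (Z (apply_bcontfun u s) - 0)) (at s within {-\<delta>..\<delta>})"
      unfolding I_def
      by (intro derivative_intros integral_has_vector_derivative continuous_on_subset[OF Zu] s) auto
    then have "(apply_bcontfun u has_vector_derivative 0 + (Z (apply_bcontfun u s) - 0)) (at s within {-\<delta>..\<delta>})"
      by (rule has_vector_derivative_transform[OF s, rotated]) (simp add: eq)
    then show "(apply_bcontfun u has_vector_derivative X (apply_bcontfun u s)) (at s within {-\<delta>..\<delta>})"
      using in_ball[OF s] by (simp add: Z_def closest_point_self)
  qed
qed

text \<open>On an interval that is short in comparison with \<open>1/L\<close>, Gronwall's inequality needs no exponential:
  the maximum of \<open>norm D\<close> reappears in the mean value estimate with the factor \<open>1/2\<close>.\<close>

lemma short_interval_gronwall: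
  fixes D :: "real \<Rightarrow> 'x::real_normed_vector"
  assumes D: "\<And>s. s \<in> {-\<delta>..\<delta>} \<Longrightarrow> (D has_vector_derivative D' s) (at s within {-\<delta>..\<delta>})"
    and D': "\<And>s. s \<in> {-\<delta>..\<delta>} \<Longrightarrow> norm (D' s) \<le> L * norm (D s) + \<rho>"
    and \<delta>: "\<delta> > 0" "\<delta> * L \<le> 1/2" and "L \<ge> 0" "\<rho> \<ge> 0" "s \<in> {-\<delta>..\<delta>}"
  shows "norm (D s) \<le> 2 * norm (D 0) + 2 * \<delta> * \<rho>"
proof -
  have "continuous_on {-\<delta>..\<delta>} (\<lambda>s. norm (D s))"
    unfolding continuous_on_eq_continuous_within
    using has_vector_derivative_continuous[OF D] by (intro ballI continuous_norm)
  then obtain m where m: "m \<in> {-\<delta>..\<delta>}" "\<And>s. s \<in> {-\<delta>..\<delta>} \<Longrightarrow> norm (D s) \<le> norm (D m)"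
    using continuous_attains_sup[of "{-\<delta>..\<delta>}" "\<lambda>s. norm (D s)"] \<delta>(1) by fastforce
  have "norm (D m - D 0) \<le> (L * norm (D m) + \<rho>) * norm (m - 0)"
  proof (rule differentiable_bound[where S="{-\<delta>..\<delta>}" and f'="\<lambda>s h. h *\<^sub>R D' s"])
    fix s assume s: "s \<in> {-\<delta>..\<delta>}"
    show "(D has_derivative (\<lambda>h. h *\<^sub>R D' s)) (at s within {-\<delta>..\<delta>})"
      using D[OF s] by (simp add: has_vector_derivative_def)
    have "norm (D' s) \<le> L * norm (D m) + \<rho>"
      using D'[OF s] mult_left_mono[OF m(2)[OF s] \<open>L \<ge> 0\<close>] by simp
    then show "onorm (\<lambda>h. h *\<^sub>R D' s) \<le> L * norm (D m) + \<rho>"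
      by (intro onorm_bound) (use \<open>L \<ge> 0\<close> \<open>\<rho> \<ge> 0\<close> in \<open>auto simp: mult.commute intro: mult_left_mono\<close>)
  qed (use m \<delta>(1) in auto)
  also have "\<dots> \<le> (L * norm (D m) + \<rho>) * \<delta>"
    using m(1) \<open>L \<ge> 0\<close> \<open>\<rho> \<ge> 0\<close> by (intro mult_left_mono) auto
  also have "\<dots> = (\<delta> * L) * norm (D m) + \<delta> * \<rho>" by (simp add: algebra_simps)
  also have "\<dots> \<le> (1/2) * norm (D m) + \<delta> * \<rho>" using \<delta>(2) by (intro add_right_mono mult_right_mono) auto
  finally have "norm (D m) \<le> 2 * norm (D 0) + 2 * \<delta> * \<rho>"
    using norm_triangle_sub[of "D m" "D 0"] by simp
  then show ?thesis using m(2)[OF assms(7)] by simp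
qed

lemma norm_linear_le_basis:
  fixes f :: "'x::euclidean_space \<Rightarrow> 'y::real_normed_vector" and K :: real
  assumes "linear f" "\<And>b. b \<in> Basis \<Longrightarrow> norm (f b) \<le> K"
  shows "norm (f v) \<le> DIM('x) * K * norm v"
proof -
  have "norm (f v) \<le> (\<Sum>b\<in>Basis. norm ((v \<bullet> b) *\<^sub>R f b))"
    using norm_sum linear_basis_expand[OF assms(1), of v] by metis
  also have "\<dots> \<le> (\<Sum>b\<in>(Basis::'x set). norm v * K)"
    unfolding norm_scaleR by (intro sum_mono mult_mono assms(2)) (auto simp: Basis_le_norm)
  finally show ?thesis by (simp add: algebra_simps)
qed

lemma smooth_on_bounds_on_cball:
  fixes X :: "'x::euclidean_space \<Rightarrow> 'x"
  assumes "open S" "smooth_on S X" "cball x0 R \<subseteq> S" "R > 0"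
  obtains L M where "L > 0" "M > 0" "\<And>x. x \<in> cball x0 R \<Longrightarrow> norm (X x) \<le> M"
    "\<And>x v. x \<in> cball x0 R \<Longrightarrow> norm (fderiv X x v) \<le> L * norm v"
    "\<And>x y. x \<in> cball x0 R \<Longrightarrow> y \<in> cball x0 R \<Longrightarrow> norm (X x - X y) \<le> L * norm (x - y)"
proof -
  have bnd: "\<exists>K>0. \<forall>x\<in>cball x0 R. norm (f x) \<le> K" if "smooth_on S f" for f :: "'x \<Rightarrow> 'x"
  proof -
    have "bounded (f ` cball x0 R)"
      using continuous_on_subset[OF smooth_on_continuous[OF that] assms(3)]
      by (intro compact_imp_bounded compact_continuous_image) auto
    then show ?thesis unfolding bounded_pos by auto
  qed
  obtain M where M: "M > 0" "\<And>x. x \<in> cball x0 R \<Longrightarrow> norm (X x) \<le> M" using bnd[OF assms(2)] by blast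
  have "\<forall>b. \<exists>K>0. \<forall>x\<in>cball x0 R. norm (fderiv X x b) \<le> K"
    using bnd[OF smooth_on_fderiv[OF assms(2)]] by blast
  then obtain K where K: "\<And>b. K b > 0" "\<And>b x. x \<in> cball x0 R \<Longrightarrow> norm (fderiv X x b) \<le> K b" by metis
  define L where "L = DIM('x) * (\<Sum>b\<in>Basis. K b)"
  have L: "norm (fderiv X x v) \<le> L * norm v" if x: "x \<in> cball x0 R" for x v
  proof -
    have "norm (fderiv X x v) \<le> DIM('x) * (\<Sum>b\<in>Basis. K b) * norm v"
    proof (rule norm_linear_le_basis)
      show "linear (fderiv X x)" using smooth_on_linear_fderiv[OF assms(2)] assms(3) x by blast
      fix b :: 'x assume b: "b \<in> Basis"
      have "K b \<le> (\<Sum>b\<in>Basis. K b)" using b K(1) by (intro member_le_sum) (auto simp: less_imp_le)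
      then show "norm (fderiv X x b) \<le> (\<Sum>b\<in>Basis. K b)" using K(2)[OF x, of b] by simp
    qed
    then show ?thesis by (simp add: L_def)
  qed
  show ?thesis
  proof (rule that[of L M, OF _ M L])
    show "L > 0" unfolding L_def using K(1) by (intro mult_pos_pos sum_pos) auto
    show "norm (X x - X y) \<le> L * norm (x - y)" if "x \<in> cball x0 R" "y \<in> cball x0 R" for x y
    proof (rule differentiable_bound[OF convex_cball _ _ that])
      show "(X has_derivative fderiv X z) (at z within cball x0 R)" if "z \<in> cball x0 R" for z
        using smooth_onD[OF assms(2)] assms(3) that has_derivative_at_withinI by blast
      show "onorm (fderiv X z) \<le> L" if "z \<in> cball x0 R" for z
        using L[OF that] by (rule onorm_le)
    qed
  qed
qed

lemma smooth_on_uniform_linearization: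
  fixes X :: "'x::euclidean_space \<Rightarrow> 'x"
  assumes "open S" "smooth_on S X" "cball x0 R \<subseteq> S" "e > 0"
  shows "\<exists>d>0. \<forall>x\<in>cball x0 R. \<forall>y\<in>cball x0 R. norm (y - x) < d \<longrightarrow>
    norm (X y - X x - fderiv X x (y - x)) \<le> e * norm (y - x)"
proof -
  define e' where "e' = e / DIM('x)"
  have e': "e' > 0" using assms(4) by (simp add: e'_def)
  have "\<exists>d>0. \<forall>x\<in>cball x0 R. \<forall>z\<in>cball x0 R. dist z x < d \<longrightarrow> dist (fderiv X z b) (fderiv X x b) < e'" for b
    using compact_uniformly_continuous[OF continuous_on_subset[OF smooth_on_continuous[OF smooth_on_fderiv[OF assms(2), of b]] assms(3)] compact_cball] e'
    unfolding uniformly_continuous_on_def by blast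
  then obtain d where d: "\<And>b. d b > 0" "\<And>b x z. x \<in> cball x0 R \<Longrightarrow> z \<in> cball x0 R \<Longrightarrow> dist z x < d b \<Longrightarrow>
      dist (fderiv X z b) (fderiv X x b) < e'" by metis
  define m where "m = Min (d ` (Basis :: 'x set))"
  have m: "m > 0" "\<And>b. b \<in> Basis \<Longrightarrow> m \<le> d b" using d(1) by (auto simp: m_def)
  show ?thesis
  proof (intro exI[of _ m] conjI m(1) ballI impI)
    fix x y assume x: "x \<in> cball x0 R" and y: "y \<in> cball x0 R" and xy: "norm (y - x) < m"
    let ?S = "cball x0 R \<inter> ball x m"
    have "norm (X y - X x - fderiv X x (y - x)) \<le> norm (y - x) * e"
    proof (rule differentiable_bound_linearization[where f'="fderiv X" and S="?S"])
      have "convex ?S" by (intro convex_Int) auto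
      then have "x + t *\<^sub>R (y - x) \<in> ?S" if "t \<in> {0..1}" for t
        using convexD_alt[of ?S x y t] that x y xy m(1)
        by (auto simp: dist_norm norm_minus_commute algebra_simps)
      then show "x + t *\<^sub>R (y - x) \<in> ?S" if "t \<in> {0..1}" for t using that by blast
      show "(X has_derivative fderiv X z) (at z within ?S)" if "z \<in> ?S" for z
        using smooth_onD[OF assms(2)] assms(3) that has_derivative_at_withinI by blast
      show "x \<in> ?S" using x m(1) by simp
      fix z assume z: "z \<in> ?S"
      have lin: "linear (fderiv X z)" "linear (fderiv X x)"
        using smooth_on_linear_fderiv[OF assms(2)] assms(3) z x by blast+
      show "onorm (fderiv X z - fderiv X x) \<le> e"
      proof (rule onorm_le)
        fix v
        have "norm ((\<lambda>v. fderiv X z v - fderiv X x v) v) \<le> DIM('x) * e' * norm v"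
        proof (rule norm_linear_le_basis[OF linear_compose_sub[OF lin]])
          fix b :: 'x assume "b \<in> Basis"
          then show "norm (fderiv X z b - fderiv X x b) \<le> e'"
            using d(2)[of x z b] x z m(2)[of b] by (auto simp: dist_norm norm_minus_commute)
        qed
        then show "norm ((fderiv X z - fderiv X x) v) \<le> e * norm v" by (simp add: e'_def)
      qed
    qed
    then show "norm (X y - X x - fderiv X x (y - x)) \<le> e * norm (y - x)" by (simp add: mult.commute)
  qed
qed

text \<open>\<open>J (s, t)\<close> follows \<open>X\<close> for the time \<open>s\<close>, starting from the point that the integral curve of \<open>Y\<close> through
  \<open>x0\<close> reaches at the time \<open>t\<close>. By construction \<open>\<partial>J/\<partial>s = X \<circ> J\<close>, and \<open>\<partial>J/\<partial>t = Y \<circ> J\<close> holds at \<open>s = 0\<close>; it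
  propagates in \<open>s\<close> because both sides solve the same linear equation when the fields commute.\<close>

lemma commuting_flows:
  fixes X Y :: "'x::euclidean_space \<Rightarrow> 'x"
  assumes "open S" "x0 \<in> S" and X: "smooth_on S X" and Y: "smooth_on S Y"
    and comm: "\<And>x. x \<in> S \<Longrightarrow> fderiv X x (Y x) = fderiv Y x (X x)"
  obtains \<delta> J where "\<delta> > 0" "J (0, 0) = x0"
    "\<And>z. z \<in> {-\<delta><..<\<delta>} \<times> {-\<delta><..<\<delta>} \<Longrightarrow> J z \<in> S"
    "\<And>z. z \<in> {-\<delta><..<\<delta>} \<times> {-\<delta><..<\<delta>} \<Longrightarrow>
      (J has_derivative (\<lambda>h. fst h *\<^sub>R X (J z) + snd h *\<^sub>R Y (J z))) (at z)"
proof -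
  obtain R where R: "R > 0" "cball x0 R \<subseteq> S" using assms(1,2) open_contains_cball by blast
  let ?B = "cball x0 R"
  obtain L1 M1 where X1: "L1 > 0" "M1 > 0" "\<And>x. x \<in> ?B \<Longrightarrow> norm (X x) \<le> M1"
    "\<And>x v. x \<in> ?B \<Longrightarrow> norm (fderiv X x v) \<le> L1 * norm v"
    "\<And>x y. x \<in> ?B \<Longrightarrow> y \<in> ?B \<Longrightarrow> norm (X x - X y) \<le> L1 * norm (x - y)"
    using smooth_on_bounds_on_cball[OF assms(1) X R(2,1)] by metis
  obtain L2 M2 where Y1: "L2 > 0" "M2 > 0" "\<And>x. x \<in> ?B \<Longrightarrow> norm (Y x) \<le> M2"
    "\<And>x v. x \<in> ?B \<Longrightarrow> norm (fderiv Y x v) \<le> L2 * norm v"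
    "\<And>x y. x \<in> ?B \<Longrightarrow> y \<in> ?B \<Longrightarrow> norm (Y x - Y y) \<le> L2 * norm (x - y)"
    using smooth_on_bounds_on_cball[OF assms(1) Y R(2,1)] by metis
  \<comment> \<open>The integral curve of \<open>Y\<close> has to stay in the ball of half the radius, where the flow of \<open>X\<close> can start;
    hence the smaller bound for \<open>M2\<close>.\<close>
  define \<delta> where "\<delta> = min (min (1 / (8 * L1)) (R / (8 * M1))) (min (1 / (8 * L2)) (R / (16 * M2)))"
  have \<delta>: "\<delta> > 0" using X1(1,2) Y1(1,2) R(1) by (simp add: \<delta>_def)
  have "\<delta> \<le> 1 / (8 * L1)" "\<delta> \<le> R / (8 * M1)" "\<delta> \<le> 1 / (8 * L2)" "\<delta> \<le> R / (16 * M2)"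
    by (simp_all add: \<delta>_def)
  then have \<delta>': "\<delta> * L1 \<le> 1/8" "\<delta> * M1 \<le> R/8" "\<delta> * L2 \<le> 1/8" "\<delta> * M2 \<le> R/16"
    using X1(1,2) Y1(1,2) by (simp_all add: field_simps)
  let ?I = "{-\<delta>..\<delta>}"
  have sub: "cball x0 (R/2) \<subseteq> ?B" using R(1) by auto
  have "\<exists>u. u 0 = x0 \<and> (\<forall>s\<in>?I. u s \<in> cball x0 (R/2) \<and> (u has_vector_derivative Y (u s)) (at s within ?I))"
  proof (rule picard_local_flow[where L=L2 and M=M2])
    show "norm (Y x - Y y) \<le> L2 * norm (x - y)" if "x \<in> cball x0 (R/2)" "y \<in> cball x0 (R/2)" for x y
      using Y1(5) sub that by blast
    show "norm (Y x) \<le> M2" if "x \<in> cball x0 (R/2)" for x using Y1(3) sub that by blast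
  qed (use R(1) \<delta> \<delta>' Y1 in auto)
  then obtain \<gamma> where \<gamma>: "\<gamma> 0 = x0" "\<And>t. t \<in> ?I \<Longrightarrow> \<gamma> t \<in> cball x0 (R/2)"
    "\<And>t. t \<in> ?I \<Longrightarrow> (\<gamma> has_vector_derivative Y (\<gamma> t)) (at t within ?I)" by blast
  have "\<forall>t\<in>?I. \<exists>u. u 0 = \<gamma> t \<and> (\<forall>s\<in>?I. u s \<in> ?B \<and> (u has_vector_derivative X (u s)) (at s within ?I))"
  proof
    fix t assume t: "t \<in> ?I"
    show "\<exists>u. u 0 = \<gamma> t \<and> (\<forall>s\<in>?I. u s \<in> ?B \<and> (u has_vector_derivative X (u s)) (at s within ?I))"
      by (rule picard_local_flow[where L=L1 and M=M1])
        (use X1 R(1) \<delta> \<delta>' \<gamma>(2)[OF t] in auto)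
  qed
  then obtain K where K: "\<And>t. t \<in> ?I \<Longrightarrow> K t 0 = \<gamma> t" "\<And>t s. t \<in> ?I \<Longrightarrow> s \<in> ?I \<Longrightarrow> K t s \<in> ?B"
    "\<And>t s. t \<in> ?I \<Longrightarrow> s \<in> ?I \<Longrightarrow> (K t has_vector_derivative X (K t s)) (at s within ?I)"
    by metis
  have KS: "K t s \<in> S" if "t \<in> ?I" "s \<in> ?I" for t s using K(2)[OF that] R(2) by blast
  have gron: "\<delta> * L1 \<le> 1/2" using \<delta>'(1) by simp
  have \<gamma>lip: "norm (\<gamma> t' - \<gamma> t) \<le> M2 * norm (t' - t)" if t: "t \<in> ?I" "t' \<in> ?I" for t t'
  proof (rule differentiable_bound[where S="?I" and f'="\<lambda>s h. h *\<^sub>R Y (\<gamma> s)"])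
    show "(\<gamma> has_derivative (\<lambda>h. h *\<^sub>R Y (\<gamma> s))) (at s within ?I)" if "s \<in> ?I" for s
      using \<gamma>(3)[OF that] by (simp add: has_vector_derivative_def)
    show "onorm (\<lambda>h. h *\<^sub>R Y (\<gamma> s)) \<le> M2" if "s \<in> ?I" for s
    proof (rule onorm_bound)
      show "norm (h *\<^sub>R Y (\<gamma> s)) \<le> M2 * norm h" for h
      proof -
        have "norm (Y (\<gamma> s)) \<le> M2" using Y1(3) \<gamma>(2)[OF that] sub by blast
        then show ?thesis by (simp add: mult.commute[of M2] mult_left_mono)
      qed
    qed (use Y1(2) in simp)
  qed (use t in auto)
  have Klip_t: "norm (K t' s - K t s) \<le> 2 * M2 * norm (t' - t)" if t: "t \<in> ?I" "t' \<in> ?I" and s: "s \<in> ?I" for t t' s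
  proof -
    have "norm (K t' s - K t s) \<le> 2 * norm (K t' 0 - K t 0) + 2 * \<delta> * 0"
    proof (rule short_interval_gronwall[where L=L1 and D="\<lambda>s. K t' s - K t s" and D'="\<lambda>s. X (K t' s) - X (K t s)"])
      show "((\<lambda>s. K t' s - K t s) has_vector_derivative X (K t' s) - X (K t s)) (at s within ?I)" if "s \<in> ?I" for s
        by (intro has_vector_derivative_diff K(3) t that)
      show "norm (X (K t' s) - X (K t s)) \<le> L1 * norm (K t' s - K t s) + 0" if "s \<in> ?I" for s
        using X1(5)[OF K(2)[OF t(2) that] K(2)[OF t(1) that]] by simp
    qed (use \<delta> gron X1(1) s in auto)
    also have "\<dots> \<le> 2 * (M2 * norm (t' - t))" using \<gamma>lip[OF t] K(1) t by simp
    finally show ?thesis by simp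
  qed
  \<comment> \<open>Differentiability in the initial value. The candidate \<open>Y (K t s)\<close> for the derivative solves the
    linearized equation because the fields commute, so the remainder satisfies a Gronwall inequality.\<close>
  have deriv_t: "\<exists>d>0. \<forall>t'\<in>?I. norm (t' - t) < d \<longrightarrow>
      (\<forall>s\<in>?I. norm (K t' s - K t s - (t' - t) *\<^sub>R Y (K t s)) \<le> e * norm (t' - t))"
    if t: "t \<in> ?I" and e: "e > 0" for t e
  proof -
    \<comment> \<open>The factor collects the initial error \<open>2 e1\<close> and the error \<open>2 \<delta> e1\<close> of linearizing \<open>X\<close> over increments
      of length at most \<open>2 M2\<close> times that of \<open>t\<close>.\<close>
    define e1 where "e1 = e / (2 + 4 * \<delta> * M2)"
    have pos: "2 + 4 * \<delta> * M2 > 0" using \<delta> Y1(2) by (simp add: add_pos_pos)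
    have e1: "e1 > 0" using e pos by (simp add: e1_def)
    obtain d1 where d1: "d1 > 0" "\<And>x y. x \<in> ?B \<Longrightarrow> y \<in> ?B \<Longrightarrow> norm (y - x) < d1 \<Longrightarrow>
        norm (X y - X x - fderiv X x (y - x)) \<le> e1 * norm (y - x)"
      using smooth_on_uniform_linearization[OF assms(1) X R(2) e1] by blast
    obtain d2 where d2: "d2 > 0" "\<And>t'. t' \<in> ?I \<Longrightarrow> norm (t' - t) < d2 \<Longrightarrow>
        norm (\<gamma> t' - \<gamma> t - (t' - t) *\<^sub>R Y (\<gamma> t)) \<le> e1 * norm (t' - t)"
      using \<gamma>(3)[OF t] e1 unfolding has_vector_derivative_def has_derivative_within_alt by blast
    show ?thesis
    proof (intro exI[of _ "min (d1 / (2 * M2)) d2"] conjI ballI impI)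
      show "min (d1 / (2 * M2)) d2 > 0" using d1 d2 Y1(2) by simp
      fix t' s assume t': "t' \<in> ?I" and near: "norm (t' - t) < min (d1 / (2 * M2)) d2" and s: "s \<in> ?I"
      define h where "h = norm (t' - t)"
      have h: "h \<ge> 0" "2 * M2 * h < d1" "h < d2" using near Y1(2) by (auto simp: h_def field_simps)
      define D where "D s = K t' s - K t s - (t' - t) *\<^sub>R Y (K t s)" for s
      define D' where "D' s = X (K t' s) - X (K t s) - (t' - t) *\<^sub>R fderiv Y (K t s) (X (K t s))" for s
      have "norm (D s) \<le> 2 * norm (D 0) + 2 * \<delta> * (e1 * (2 * M2 * h))"
      proof (rule short_interval_gronwall[where L=L1 and D'=D'])
        fix s assume s: "s \<in> ?I"
        have "((\<lambda>s. Y (K t s)) has_derivative (\<lambda>r. fderiv Y (K t s) (r *\<^sub>R X (K t s)))) (at s within ?I)"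
          using K(3)[OF t s] smooth_onD[OF Y KS[OF t s]]
          unfolding has_vector_derivative_def by (rule has_derivative_compose)
        then have YK: "((\<lambda>s. Y (K t s)) has_vector_derivative fderiv Y (K t s) (X (K t s))) (at s within ?I)"
          unfolding has_vector_derivative_def
          by (simp add: linear_cmul[OF smooth_on_linear_fderiv[OF Y KS[OF t s]]])
        have "((\<lambda>s. (t' - t) *\<^sub>R Y (K t s)) has_vector_derivative (t' - t) *\<^sub>R fderiv Y (K t s) (X (K t s))) (at s within ?I)"
          using bounded_linear.has_vector_derivative[OF bounded_linear_scaleR_right YK] .
        then show "(D has_vector_derivative D' s) (at s within ?I)"
          unfolding D_def[abs_def] D'_def by (intro has_vector_derivative_diff K(3) t t' s)
        have Klip: "norm (K t' s - K t s) \<le> 2 * M2 * h" using Klip_t[OF t t' s] by (simp add: h_def)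
        have linX: "linear (fderiv X (K t s))" by (rule smooth_on_linear_fderiv[OF X KS[OF t s]])
        have "D' s = (X (K t' s) - X (K t s) - fderiv X (K t s) (K t' s - K t s)) + fderiv X (K t s) (D s)"
          unfolding D'_def D_def linear_diff[OF linX] linear_cmul[OF linX] comm[OF KS[OF t s]] by simp
        then have "norm (D' s) \<le> norm (X (K t' s) - X (K t s) - fderiv X (K t s) (K t' s - K t s)) + norm (fderiv X (K t s) (D s))"
          using norm_triangle_ineq by metis
        also have "\<dots> \<le> e1 * norm (K t' s - K t s) + L1 * norm (D s)"
          using Klip h(2) by (intro add_mono d1(2) X1(4) K(2) t t' s) simp
        also have "\<dots> \<le> e1 * (2 * M2 * h) + L1 * norm (D s)"
          using Klip e1 by (intro add_right_mono mult_left_mono) auto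
        finally show "norm (D' s) \<le> L1 * norm (D s) + e1 * (2 * M2 * h)" by simp
      qed (use \<delta> gron X1(1) Y1(2) e1 h(1) s in auto)
      also have "\<dots> \<le> 2 * (e1 * h) + 2 * \<delta> * (e1 * (2 * M2 * h))"
        using d2(2)[OF t'] h(3) K(1) t t' by (simp add: D_def h_def)
      also have "\<dots> = e1 * (2 + 4 * \<delta> * M2) * h" by (simp add: algebra_simps)
      also have "\<dots> = e * h" using pos by (simp add: e1_def)
      finally show "norm (K t' s - K t s - (t' - t) *\<^sub>R Y (K t s)) \<le> e * norm (t' - t)"
        by (simp add: D_def h_def)
    qed
  qed
  have Klip_s: "norm (K t s' - K t s) \<le> M1 * norm (s' - s)" if t: "t \<in> ?I" and s: "s \<in> ?I" "s' \<in> ?I" for t s s'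
  proof (rule differentiable_bound[where S="?I" and f'="\<lambda>s h. h *\<^sub>R X (K t s)"])
    show "(K t has_derivative (\<lambda>h. h *\<^sub>R X (K t s))) (at s within ?I)" if "s \<in> ?I" for s
      using K(3)[OF t that] by (simp add: has_vector_derivative_def)
    show "onorm (\<lambda>h. h *\<^sub>R X (K t s)) \<le> M1" if "s \<in> ?I" for s
    proof (rule onorm_bound)
      show "norm (h *\<^sub>R X (K t s)) \<le> M1 * norm h" for h
        using X1(3)[OF K(2)[OF t that]] by (simp add: mult.commute[of M1] mult_left_mono)
    qed (use X1(2) in simp)
  qed (use s in auto)
  have der: "((\<lambda>(s, t). K t s) has_derivative (\<lambda>(a, b). a *\<^sub>R X (K t s) + blinfun_apply (blinfun_scaleR_left (Y (K t s))) b))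
      (at (s, t) within ?I \<times> ?I)" if s: "s \<in> ?I" and t: "t \<in> ?I" for s t
  proof (rule has_derivative_partialsI)
    show "((\<lambda>s. K t s) has_derivative (\<lambda>a. a *\<^sub>R X (K t s))) (at s within ?I)"
      using K(3)[OF t s] by (simp add: has_vector_derivative_def)
    show "((\<lambda>t. K t s) has_derivative blinfun_apply (blinfun_scaleR_left (Y (K t s)))) (at t within ?I)"
      if st: "s \<in> ?I" "t \<in> ?I" for s t
      unfolding has_derivative_within_alt
    proof (intro conjI allI impI)
      show "bounded_linear (blinfun_apply (blinfun_scaleR_left (Y (K t s))))"
        by (rule blinfun.bounded_linear_right)
      fix e :: real assume "e > 0"
      then obtain d where d: "d > 0" "\<And>t' s. t' \<in> ?I \<Longrightarrow> norm (t' - t) < d \<Longrightarrow> s \<in> ?I \<Longrightarrow>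
          norm (K t' s - K t s - (t' - t) *\<^sub>R Y (K t s)) \<le> e * norm (t' - t)"
        using deriv_t[OF st(2)] by blast
      show "\<exists>d>0. \<forall>t'\<in>?I. norm (t' - t) < d \<longrightarrow>
          norm (K t' s - K t s - blinfun_apply (blinfun_scaleR_left (Y (K t s))) (t' - t)) \<le> e * norm (t' - t)"
        unfolding blinfun_scaleR_left.rep_eq
        by (intro exI[of _ d] conjI ballI impI d(1) d(2)[OF _ _ st(1)])
    qed
    have Kc: "continuous (at (s, t) within ?I \<times> ?I) (\<lambda>(s, t). K t s)"
      unfolding continuous_within
    proof (rule Lim_null_comparison[THEN LIM_zero_cancel])
      show "\<forall>\<^sub>F z in at (s, t) within ?I \<times> ?I. norm ((case z of (s, t) \<Rightarrow> K t s) - (case (s, t) of (s, t) \<Rightarrow> K t s))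
          \<le> M1 * norm (fst z - s) + 2 * M2 * norm (snd z - t)"
      proof (rule eventually_at_topological[THEN iffD2], intro exI[of _ UNIV] conjI ballI impI)
        fix z assume "z \<in> ?I \<times> ?I"
        then have z: "fst z \<in> ?I" "snd z \<in> ?I" by auto
        have "norm (K (snd z) (fst z) - K t s) \<le> norm (K (snd z) (fst z) - K (snd z) s) + norm (K (snd z) s - K t s)"
          using norm_triangle_ineq[of "K (snd z) (fst z) - K (snd z) s" "K (snd z) s - K t s"] by simp
        also have "\<dots> \<le> M1 * norm (fst z - s) + 2 * M2 * norm (snd z - t)"
          by (intro add_mono Klip_s Klip_t s t z)
        finally show "norm ((case z of (s, t) \<Rightarrow> K t s) - (case (s, t) of (s, t) \<Rightarrow> K t s))
          \<le> M1 * norm (fst z - s) + 2 * M2 * norm (snd z - t)" by (simp add: case_prod_unfold)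
      qed auto
      have "((\<lambda>z. M1 * norm (fst z - s) + 2 * M2 * norm (snd z - t)) \<longlongrightarrow>
          M1 * norm (fst (s, t) - s) + 2 * M2 * norm (snd (s, t) - t)) (at (s, t) within ?I \<times> ?I)"
        by (intro tendsto_intros)
      then show "((\<lambda>z. M1 * norm (fst z - s) + 2 * M2 * norm (snd z - t)) \<longlongrightarrow> 0) (at (s, t) within ?I \<times> ?I)"
        by simp
    qed
    have "isCont Y (K t s)"
      using smooth_onD[OF Y KS[OF t s]] has_derivative_continuous by blast
    then have "continuous (at (s, t) within ?I \<times> ?I) (\<lambda>z. Y (case z of (s, t) \<Rightarrow> K t s))"
      using continuous_within_compose3[OF _ Kc, of Y] by simp
    then have "continuous (at (s, t) within ?I \<times> ?I) (\<lambda>z. blinfun_scaleR_left (Y (case z of (s, t) \<Rightarrow> K t s)))"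
      by (rule bounded_linear.continuous[OF bounded_linear_blinfun_scaleR_left])
    then show "continuous (at (s, t) within ?I \<times> ?I) (\<lambda>(s, t). blinfun_scaleR_left (Y (K t s)))"
      by (simp add: case_prod_unfold)
  qed (use t in auto)
  show ?thesis
  proof (rule that[of \<delta> "\<lambda>(s, t). K t s"])
    show "(case (0, 0) of (s, t) \<Rightarrow> K t s) = x0" using K(1)[of 0] \<gamma>(1) \<delta> by simp
    fix z :: "real \<times> real" assume z: "z \<in> {-\<delta><..<\<delta>} \<times> {-\<delta><..<\<delta>}"
    obtain s t where st: "z = (s, t)" by (cases z)
    have I: "s \<in> ?I" "t \<in> ?I" using z st by auto
    show "(case z of (s, t) \<Rightarrow> K t s) \<in> S" using KS I st by simp
    have at: "(at z within {-\<delta><..<\<delta>} \<times> {-\<delta><..<\<delta>}) = at z"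
      by (intro at_within_open z open_Times) auto
    have "((\<lambda>(s, t). K t s) has_derivative (\<lambda>(a, b). a *\<^sub>R X (K t s) + blinfun_apply (blinfun_scaleR_left (Y (K t s))) b))
      (at z within {-\<delta><..<\<delta>} \<times> {-\<delta><..<\<delta>})"
      using der[OF I] st by (auto intro: has_derivative_subset)
    then show "((\<lambda>(s, t). K t s) has_derivative
        (\<lambda>h. fst h *\<^sub>R X (case z of (s, t) \<Rightarrow> K t s) + snd h *\<^sub>R Y (case z of (s, t) \<Rightarrow> K t s))) (at z)"
      unfolding at by (simp add: st case_prod_unfold)
  qed (rule \<delta>)
qed

text \<open>Each derivative gained for \<open>J\<close> is passed on to its partial derivatives \<open>X \<circ> J\<close> and \<open>Y \<circ> J\<close>, and so yields
  one more for \<open>J\<close>.\<close>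

lemma total_differential_solution_smooth:
  fixes J :: "real \<times> real \<Rightarrow> 'x::euclidean_space"
  assumes "open W" "open S" "J ` W \<subseteq> S" "smooth_on S X" "smooth_on S Y"
    and J: "\<And>z. z \<in> W \<Longrightarrow> (J has_derivative (\<lambda>h. fst h *\<^sub>R X (J z) + snd h *\<^sub>R Y (J z))) (at z)"
  shows "smooth_on W J"
proof -
  have "Ck_on k W J" for k
  proof (induction k)
    case 0
    show ?case using has_derivative_continuous[OF J] by (simp add: continuous_at_imp_continuous_on)
  next
    case (Suc k)
    show ?case
    proof (rule Ck_on_SucI[OF assms(1) J])
      show "Ck_on k W (\<lambda>z. fst v *\<^sub>R X (J z) + snd v *\<^sub>R Y (J z))" for v
        by (intro Ck_on_add Ck_on_bounded_linear_comp[OF bounded_linear_scaleR_right] assms(1)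
            Ck_on_compose[OF assms(1,2,3) Suc.IH] smooth_on_imp_Ck assms(4,5))
    qed
  qed
  then show ?thesis by (simp add: smooth_on_def)
qed

section \<open>The theorem of Frobenius for distributions of rank two\<close>

lemma fderiv_combination:
  fixes X Y :: "'x::euclidean_space \<Rightarrow> 'y::euclidean_space"
  assumes "smooth_on S X" "smooth_on S Y" "smooth_on S a" "smooth_on S b" "x \<in> S"
  shows "fderiv (\<lambda>x. a x *\<^sub>R X x + b x *\<^sub>R Y x) x v =
    a x *\<^sub>R fderiv X x v + fderiv a x v *\<^sub>R X x + (b x *\<^sub>R fderiv Y x v + fderiv b x v *\<^sub>R Y x)"
  by (subst fderiv_eq[OF has_derivative_add[OF
      has_derivative_scaleR[OF smooth_onD[OF assms(3,5)] smooth_onD[OF assms(1,5)]]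
      has_derivative_scaleR[OF smooth_onD[OF assms(4,5)] smooth_onD[OF assms(2,5)]]]]) simp

text \<open>In the bracket of two combinations of \<open>X\<close> and \<open>Y\<close>, the terms in which a coefficient is differentiated are
  multiples of \<open>X\<close> and \<open>Y\<close>, and the others add up to a multiple of the bracket of \<open>X\<close> and \<open>Y\<close>.\<close>

lemma bracket_of_combinations_in_span:
  fixes X Y :: "'x::euclidean_space \<Rightarrow> 'x"
  assumes "smooth_on S X" "smooth_on S Y" "smooth_on S a" "smooth_on S b" "smooth_on S c" "smooth_on S d"
    and "x \<in> S" and inv: "fderiv Y x (X x) - fderiv X x (Y x) \<in> span {X x, Y x}"
  defines "P \<equiv> \<lambda>x. a x *\<^sub>R X x + b x *\<^sub>R Y x" and "Q \<equiv> \<lambda>x. c x *\<^sub>R X x + d x *\<^sub>R Y x"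
  shows "fderiv Q x (P x) - fderiv P x (Q x) \<in> span {X x, Y x}"
proof -
  note lin = smooth_on_linear_fderiv[OF assms(1,7)] smooth_on_linear_fderiv[OF assms(2,7)]
  have "fderiv Q x (P x) - fderiv P x (Q x) =
      (a x * d x - b x * c x) *\<^sub>R (fderiv Y x (X x) - fderiv X x (Y x)) +
      ((fderiv c x (P x) - fderiv a x (Q x)) *\<^sub>R X x + (fderiv d x (P x) - fderiv b x (Q x)) *\<^sub>R Y x)"
    unfolding P_def Q_def
      fderiv_combination[OF assms(1,2,3,4,7)] fderiv_combination[OF assms(1,2,5,6,7)]
    by (simp add: linear_add[OF lin(1)] linear_add[OF lin(2)] linear_cmul[OF lin(1)] linear_cmul[OF lin(2)] algebra_simps)
  also have "\<dots> \<in> span {X x, Y x}"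
    by (intro span_add span_scale inv) (auto intro: span_base)
  finally show ?thesis .
qed

text \<open>The surface is obtained as a graph over \<open>\<real>\<^sup>2\<close>, which makes it injective and immersed at once.\<close>

theorem frobenius_rank_two:
  fixes X Y :: "'x::euclidean_space \<Rightarrow> 'x"
  assumes "open S" "x0 \<in> S" and X: "smooth_on S X" and Y: "smooth_on S Y"
    and indep: "\<And>a b. a *\<^sub>R X x0 + b *\<^sub>R Y x0 = 0 \<Longrightarrow> a = 0 \<and> b = 0"
    and inv: "\<And>x. x \<in> S \<Longrightarrow> fderiv Y x (X x) - fderiv X x (Y x) \<in> span {X x, Y x}"
  obtains W :: "(real \<times> real) set" and J where "open W" "(0, 0) \<in> W" "J (0, 0) = x0" "smooth_on W J"
    "J ` W \<subseteq> S" "inj_on J W" "\<And>z. z \<in> W \<Longrightarrow> inj (fderiv J z)"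
    "\<And>z. z \<in> W \<Longrightarrow> range (fderiv J z) = span {X (J z), Y (J z)}"
proof -
  \<comment> \<open>A linear map \<open>p\<close> that maps the plane at \<open>x0\<close> onto \<open>\<real>\<^sup>2\<close>.\<close>
  have ne: "X x0 \<noteq> Y x0" using indep[of 1 "-1"] by auto
  have ind: "independent {X x0, Y x0}"
  proof (rule independent_insertI)
    show "X x0 \<notin> span {Y x0}"
    proof
      assume "X x0 \<in> span {Y x0}"
      then obtain k where "X x0 = k *\<^sub>R Y x0" by (auto simp: span_singleton)
      then show False using indep[of 1 "-k"] by simp
    qed
    show "independent {Y x0}" using indep[of 0 1] by auto
  qed
  obtain p :: "'x \<Rightarrow> real \<times> real" where p: "linear p" "\<forall>x\<in>{X x0, Y x0}. p x = (if x = X x0 then (1, 0) else (0, 1))"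
    using linear_independent_extend[OF ind, of "\<lambda>x. if x = X x0 then (1, 0) else (0, 1)"] by auto
  have p0: "p (X x0) = (1, 0)" "p (Y x0) = (0, 1)" using p(2) ne by auto
  have blp: "bounded_linear p" using p(1) by (simp add: linear_conv_bounded_linear)
  define A B C D where "A x = fst (p (X x))" and "B x = snd (p (X x))"
    and "C x = fst (p (Y x))" and "D x = snd (p (Y x))" for x
  have sm: "smooth_on S A" "smooth_on S B" "smooth_on S C" "smooth_on S D"
    unfolding A_def[abs_def] B_def[abs_def] C_def[abs_def] D_def[abs_def]
    by (intro smooth_on_bounded_linear_comp[OF bounded_linear_fst] smooth_on_bounded_linear_comp[OF bounded_linear_snd]
        smooth_on_bounded_linear_comp[OF blp] assms(1) X Y)+
  define \<Delta> where "\<Delta> x = A x * D x - B x * C x" for x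
  have sm\<Delta>: "smooth_on S \<Delta>" unfolding \<Delta>_def[abs_def] by (intro smooth_on_diff smooth_on_mult assms(1) sm)
  define T where "T = S \<inter> \<Delta> -` (-{0})"
  have T: "open T" "T \<subseteq> S" "x0 \<in> T"
    using continuous_open_preimage[OF smooth_on_continuous[OF sm\<Delta>] assms(1), of "-{0}"] assms(2)
    by (auto simp: T_def \<Delta>_def A_def B_def C_def D_def p0)
  note smT = smooth_on_subset[OF _ T(2)]
  define i where "i x = inverse (\<Delta> x)" for x
  have smi: "smooth_on T i"
    unfolding i_def[abs_def] using T(1) smT[OF sm\<Delta>] by (intro smooth_on_inverse) (auto simp: T_def)
  have i: "\<Delta> x * i x = 1" if "x \<in> T" for x using that by (simp add: T_def i_def)
  \<comment> \<open>The frame of the plane field that \<open>p\<close> maps to the standard basis of \<open>\<real>\<^sup>2\<close>. Its bracket lies in the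
    plane field and is annihilated by \<open>p\<close>, hence vanishes.\<close>
  define P where "P x = (D x * i x) *\<^sub>R X x + (- B x * i x) *\<^sub>R Y x" for x
  define Q where "Q x = (- C x * i x) *\<^sub>R X x + (A x * i x) *\<^sub>R Y x" for x
  have coef: "smooth_on T (\<lambda>x. D x * i x)" "smooth_on T (\<lambda>x. - B x * i x)"
    "smooth_on T (\<lambda>x. - C x * i x)" "smooth_on T (\<lambda>x. A x * i x)"
    by (intro smooth_on_mult smooth_on_minus smT sm smi T(1))+
  have smPQ: "smooth_on T P" "smooth_on T Q"
    unfolding P_def[abs_def] Q_def[abs_def]
    by (intro smooth_on_add smooth_on_scaleR coef smT X Y T(1))+
  have pP: "p (P x) = (1, 0)" and pQ: "p (Q x) = (0, 1)" if "x \<in> T" for x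
    using i[OF that] unfolding P_def Q_def linear_add[OF p(1)] linear_cmul[OF p(1)]
    by (auto simp: prod_eq_iff A_def[symmetric] B_def[symmetric] C_def[symmetric] D_def[symmetric] \<Delta>_def algebra_simps)
  have XPQ: "X x = A x *\<^sub>R P x + B x *\<^sub>R Q x" and YPQ: "Y x = C x *\<^sub>R P x + D x *\<^sub>R Q x" if "x \<in> T" for x
  proof -
    have "A x *\<^sub>R P x + B x *\<^sub>R Q x = (\<Delta> x * i x) *\<^sub>R X x" "C x *\<^sub>R P x + D x *\<^sub>R Q x = (\<Delta> x * i x) *\<^sub>R Y x"
      by (simp_all add: P_def Q_def \<Delta>_def algebra_simps)
    then show "X x = A x *\<^sub>R P x + B x *\<^sub>R Q x" "Y x = C x *\<^sub>R P x + D x *\<^sub>R Q x" using i[OF that] by simp_all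
  qed
  have spanPQ: "span {X x, Y x} = span {P x, Q x}" if "x \<in> T" for x
  proof (rule span_eq[THEN iffD2], intro conjI)
    show "{X x, Y x} \<subseteq> span {P x, Q x}"
      unfolding XPQ[OF that] YPQ[OF that]
      by (auto intro!: span_add span_scale intro: span_base)
    show "{P x, Q x} \<subseteq> span {X x, Y x}"
      unfolding P_def Q_def by (auto intro!: span_add span_scale span_neg intro: span_base simp del: scaleR_minus_left)
  qed
  have comm: "fderiv P x (Q x) = fderiv Q x (P x)" if x: "x \<in> T" for x
  proof -
    have "fderiv Q x (P x) - fderiv P x (Q x) \<in> span {X x, Y x}"
      unfolding P_def[abs_def] Q_def[abs_def]
      by (rule bracket_of_combinations_in_span[OF smT[OF X] smT[OF Y] coef x]) (use inv T(2) x in blast)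
    then obtain \<alpha> \<beta> where ab: "fderiv Q x (P x) - fderiv P x (Q x) = \<alpha> *\<^sub>R P x + \<beta> *\<^sub>R Q x"
      unfolding spanPQ[OF x] by (auto simp: span_insert span_singleton algebra_simps)
    have "p (fderiv V x v) = 0" if "smooth_on T V" "\<And>x. x \<in> T \<Longrightarrow> p (V x) = c" for V v c
      using fderiv_eq[OF bounded_linear.has_derivative[OF blp smooth_onD[OF that(1) x]]]
        fderiv_cong_open[OF T(1) x, of "\<lambda>x. p (V x)" "\<lambda>x. c"] that(2)
      by (metis frechet_derivative_const)
    from this[OF smPQ(1) pP] this[OF smPQ(2) pQ] have "p (\<alpha> *\<^sub>R P x + \<beta> *\<^sub>R Q x) = 0"
      unfolding ab[symmetric] linear_diff[OF p(1)] by simp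
    then have "\<alpha> = 0 \<and> \<beta> = 0"
      unfolding linear_add[OF p(1)] linear_cmul[OF p(1)] pP[OF x] pQ[OF x] by (simp add: zero_prod_def)
    with ab show ?thesis by simp
  qed
  obtain \<delta> J where J: "\<delta> > 0" "J (0, 0) = x0"
    "\<And>z. z \<in> {-\<delta><..<\<delta>} \<times> {-\<delta><..<\<delta>} \<Longrightarrow> J z \<in> T"
    "\<And>z. z \<in> {-\<delta><..<\<delta>} \<times> {-\<delta><..<\<delta>} \<Longrightarrow>
      (J has_derivative (\<lambda>h. fst h *\<^sub>R P (J z) + snd h *\<^sub>R Q (J z))) (at z)"
    by (rule commuting_flows[OF T(1,3) smPQ]) (rule comm, assumption, (rule that; assumption))
  define W where "W = {-\<delta><..<\<delta>} \<times> {-\<delta><..<\<delta>}"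
  have W: "open W" "(0, 0) \<in> W" "convex W"
    using J(1) by (auto simp: W_def intro!: open_Times convex_Times)
  have dJ: "fderiv J z = (\<lambda>h. fst h *\<^sub>R P (J z) + snd h *\<^sub>R Q (J z))" if "z \<in> W" for z
    using fderiv_eq[OF J(4)] that unfolding W_def by blast
  have pd: "p (fst h *\<^sub>R P x + snd h *\<^sub>R Q x) = h" if "x \<in> T" for h x
    unfolding linear_add[OF p(1)] linear_cmul[OF p(1)] pP[OF that] pQ[OF that] by (simp add: prod_eq_iff)
  \<comment> \<open>The surface is a graph over \<open>\<real>\<^sup>2\<close>: \<open>p \<circ> J\<close> is a translation.\<close>
  have pJ: "p (J z) = p x0 + z" if z: "z \<in> W" for z
  proof -
    have "((\<lambda>z. p (J z) - z) has_derivative (\<lambda>h. 0)) (at w within W)" if w: "w \<in> W" for w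
    proof (rule has_derivative_at_withinI, rule has_derivative_eq_rhs)
      show "((\<lambda>z. p (J z) - z) has_derivative (\<lambda>h. p (fst h *\<^sub>R P (J w) + snd h *\<^sub>R Q (J w)) - h)) (at w)"
        using w unfolding W_def
        by (intro has_derivative_diff bounded_linear.has_derivative[OF blp] J(4) has_derivative_ident)
      show "(\<lambda>h. p (fst h *\<^sub>R P (J w) + snd h *\<^sub>R Q (J w)) - h) = (\<lambda>h. 0)"
        using pd[OF J(3)] w unfolding W_def by auto
    qed
    then have "\<exists>c. \<forall>w\<in>W. p (J w) - w = c"
      by (rule has_derivative_zero_constant[OF W(3)])
    then obtain c where c: "\<And>w. w \<in> W \<Longrightarrow> p (J w) - w = c" by metis
    from c[OF z] c[OF W(2)] J(2) show ?thesis by (simp add: zero_prod_def[symmetric] algebra_simps)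
  qed
  show ?thesis
  proof (rule that[of W J])
    show "smooth_on W J"
      by (rule total_differential_solution_smooth[OF W(1) T(1) _ smPQ]) (use J(3,4) in \<open>auto simp: W_def\<close>)
    show "J ` W \<subseteq> S" using J(3) T(2) by (auto simp: W_def)
    show "inj_on J W" by (intro inj_onI) (metis pJ add_left_cancel)
    fix z assume z: "z \<in> W"
    then have JT: "J z \<in> T" using J(3) by (simp add: W_def)
    show "inj (fderiv J z)" unfolding dJ[OF z] by (rule inj_on_inverseI[where g=p]) (rule pd[OF JT])
    show "range (fderiv J z) = span {X (J z), Y (J z)}"
    proof
      show "range (fderiv J z) \<subseteq> span {X (J z), Y (J z)}"
        unfolding dJ[OF z] spanPQ[OF JT] by (auto intro!: span_add span_scale intro: span_base)
      have "span {P (J z), Q (J z)} \<subseteq> range (fderiv J z)"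
      proof (rule span_minimal)
        have "P (J z) = fderiv J z (1, 0)" "Q (J z) = fderiv J z (0, 1)" by (simp_all add: dJ[OF z])
        then show "{P (J z), Q (J z)} \<subseteq> range (fderiv J z)" by blast
        show "subspace (range (fderiv J z))"
          using linear_subspace_image[OF has_derivative_linear[OF J(4)]] z subspace_UNIV
          unfolding dJ[OF z] W_def by blast
      qed
      then show "span {X (J z), Y (J z)} \<subseteq> range (fderiv J z)" by (simp add: spanPQ[OF JT])
    qed
  qed (use W J(2) in auto)
qed

text \<open>The second derivatives of \<open>i\<close> enter symmetrically and cancel. The images \<open>V\<close> and \<open>W\<close> are only fields
  along \<open>i\<close>, so that \<open>i\<close> may be the immersion of a hypersurface.\<close>

lemma related_fields_bracket:
  fixes i :: "'x::euclidean_space \<Rightarrow> 'y::euclidean_space"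
  assumes "open S" "smooth_on S i" "smooth_on S X" "smooth_on S Y" "x \<in> S"
    and V: "\<And>x. x \<in> S \<Longrightarrow> fderiv i x (X x) = V x" and W: "\<And>x. x \<in> S \<Longrightarrow> fderiv i x (Y x) = W x"
  shows "fderiv i x (fderiv Y x (X x) - fderiv X x (Y x)) = fderiv W x (X x) - fderiv V x (Y x)"
proof -
  have D: "fderiv V' x v = fderiv (\<lambda>y. fderiv i y (Z x)) x v + fderiv i x (fderiv Z x v)"
    if Z: "smooth_on S Z" "\<And>x. x \<in> S \<Longrightarrow> fderiv i x (Z x) = V' x" for Z V' v
  proof -
    have "fderiv V' x = fderiv (\<lambda>y. fderiv i y (Z y)) x"
      by (rule fderiv_cong_open[OF assms(1,5)]) (simp add: Z(2))
    also have "\<dots> = (\<lambda>v. fderiv (\<lambda>y. fderiv i y (Z x)) x v + fderiv i x (fderiv Z x v))"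
      by (rule fderiv_eq[OF has_derivative_linear_family[OF assms(1,5)]])
        (intro smooth_on_linear_fderiv[OF assms(2)] smooth_on_differentiable[OF smooth_on_fderiv[OF assms(2)]]
          smooth_onD[OF Z(1)] assms(5) | assumption)+
    finally show ?thesis by simp
  qed
  have "fderiv V x v = fderiv (\<lambda>y. fderiv i y (X x)) x v + fderiv i x (fderiv X x v)" for v
    by (rule D[OF assms(3)]) (rule V)
  moreover have "fderiv W x v = fderiv (\<lambda>y. fderiv i y (Y x)) x v + fderiv i x (fderiv Y x v)" for v
    by (rule D[OF assms(4)]) (rule W)
  ultimately show ?thesis
    using mixed_derivatives_commute[OF assms(1,2,5), of "Y x" "X x"]
    unfolding linear_diff[OF smooth_on_linear_fderiv[OF assms(2,5)]]
    by simp
qed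

text \<open>The integrability condition is necessary: along an immersion that is tangent to \<open>X\<close> and \<open>Y\<close> the two
  fields come from fields on the source, and so does their bracket.\<close>

lemma bracket_tangent_to_integral_map:
  fixes J :: "'w::euclidean_space \<Rightarrow> 'x::euclidean_space"
  assumes "open W" "smooth_on W J" "z \<in> W" "inj (fderiv J z)" "open S" "J ` W \<subseteq> S"
    and X: "smooth_on S X" "\<And>w. w \<in> W \<Longrightarrow> X (J w) \<in> range (fderiv J w)"
    and Y: "smooth_on S Y" "\<And>w. w \<in> W \<Longrightarrow> Y (J w) \<in> range (fderiv J w)"
  shows "fderiv Y (J z) (X (J z)) - fderiv X (J z) (Y (J z)) \<in> range (fderiv J z)"
proof -
  define a where "a w = inv (fderiv J w) (X (J w))" for w
  have a: "fderiv J w (a w) = X (J w)" if "w \<in> W" for w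
    unfolding a_def by (rule f_inv_into_f[OF X(2)[OF that]])
  define b where "b w = inv (fderiv J w) (Y (J w))" for w
  have b: "fderiv J w (b w) = Y (J w)" if "w \<in> W" for w
    unfolding b_def by (rule f_inv_into_f[OF Y(2)[OF that]])
  have "\<forall>y\<in>W. linear (fderiv J y)" "\<forall>u. smooth_on W (\<lambda>y. fderiv J y u)"
    using smooth_on_linear_fderiv[OF assms(2)] smooth_on_fderiv[OF assms(2)] by blast+
  from smooth_on_linear_solution[OF assms(1,3) this assms(4)]
  obtain T where T: "open T" "z \<in> T" "T \<subseteq> W"
    and sol: "\<forall>U v w. open U \<longrightarrow> U \<subseteq> T \<longrightarrow> smooth_on U w \<longrightarrow> (\<forall>y\<in>U. fderiv J y (v y) = w y) \<longrightarrow> smooth_on U v"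
    by blast
  have JT: "smooth_on T J" "J ` T \<subseteq> S" using smooth_on_subset[OF assms(2) T(3)] assms(6) T(3) by auto
  have comp: "smooth_on T (\<lambda>w. Z (J w))" if "smooth_on S Z" for Z :: "'x \<Rightarrow> 'x"
    by (rule smooth_on_compose[OF T(1) assms(5) JT(2,1) that])
  have sa: "smooth_on T a" by (rule sol[rule_format, OF T(1) order_refl comp[OF X(1)]]) (use a T(3) in blast)
  have sb: "smooth_on T b" by (rule sol[rule_format, OF T(1) order_refl comp[OF Y(1)]]) (use b T(3) in blast)
  have chain: "fderiv (\<lambda>w. Z (J w)) z v = fderiv Z (J z) (fderiv J z v)" if Z: "smooth_on S Z" for Z :: "'x \<Rightarrow> 'x" and v
  proof -
    have "J z \<in> S" using assms(3,6) by blast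
    then show ?thesis
      by (subst fderiv_eq[OF has_derivative_compose[OF smooth_onD[OF assms(2,3)] smooth_onD[OF Z]]]) auto
  qed
  have "fderiv J z (fderiv b z (a z) - fderiv a z (b z)) =
      fderiv (\<lambda>w. Y (J w)) z (a z) - fderiv (\<lambda>w. X (J w)) z (b z)"
    by (rule related_fields_bracket[OF T(1) JT(1) sa sb T(2)]) (use a b T(3) in blast)+
  also have "\<dots> = fderiv Y (J z) (X (J z)) - fderiv X (J z) (Y (J z))"
    unfolding chain[OF X(1)] chain[OF Y(1)] a[OF assms(3)] b[OF assms(3)] ..
  finally show ?thesis by (metis rangeI)
qed

section \<open>Charts and tangent vectors\<close>

lemma tvec_scaleR_apply: "(r *\<^sub>R v) c = r *\<^sub>R v c" for v :: "('a, 'e::euclidean_space) tvec"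
  by (rule fun_cong[OF scaleR_fun_def])

context
  fixes A :: "('a::{t2_space,second_countable_topology}, 'e::euclidean_space) chart set"
  assumes A: "smooth_manifold A"
begin

lemma chart_open: "c \<in> A \<Longrightarrow> open (cdom c)" and crange_open: "c \<in> A \<Longrightarrow> open (crange c)"
  and chart_homeomorphism: "c \<in> A \<Longrightarrow> homeomorphism (cdom c) (crange c) (cmap c) (cinv c)"
  using A by (auto simp: smooth_manifold_def)

lemma cinv_cmap: "c \<in> A \<Longrightarrow> p \<in> cdom c \<Longrightarrow> cinv c (cmap c p) = p"
  using chart_homeomorphism[of c] by (auto simp: homeomorphism_def)

lemma cmap_cinv: "c \<in> A \<Longrightarrow> x \<in> crange c \<Longrightarrow> cmap c (cinv c x) = x"
  and cinv_in_cdom: "c \<in> A \<Longrightarrow> x \<in> crange c \<Longrightarrow> cinv c x \<in> cdom c"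
  using chart_homeomorphism[of c] by (auto simp: homeomorphism_def)

lemma cmap_in_crange: "p \<in> cdom c \<Longrightarrow> cmap c p \<in> crange c"
  by (simp add: crange_def)

lemma ex_chart: "\<exists>c\<in>A. p \<in> cdom c"
  using A by (auto simp: smooth_manifold_def)

lemma chart_at_chart: "chart_at A p \<in> A" "p \<in> cdom (chart_at A p)"
proof -
  have "\<exists>c. c \<in> A \<and> p \<in> cdom c" using ex_chart by blast
  from someI_ex[OF this] show "chart_at A p \<in> A" "p \<in> cdom (chart_at A p)" by (simp_all add: chart_at_def)
qed

lemma open_cmap_image:
  assumes "c \<in> A" "open U" "U \<subseteq> cdom c"
  shows "open (cmap c ` U)"
proof -
  have "cmap c ` U = crange c \<inter> cinv c -` U"
    using assms cinv_cmap[OF assms(1)] cmap_cinv[OF assms(1)] by (force simp: crange_def)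
  moreover have "open (crange c \<inter> cinv c -` U)"
    using chart_homeomorphism[OF assms(1)] crange_open[OF assms(1)] assms(2)
    by (intro continuous_open_preimage) (auto simp: homeomorphism_def)
  ultimately show ?thesis by simp
qed

lemma transition_smooth:
  "c \<in> A \<Longrightarrow> d \<in> A \<Longrightarrow> smooth_on (cmap c ` (cdom c \<inter> cdom d)) (cmap d \<circ> cinv c)"
  using A by (auto simp: smooth_manifold_def)

lemma transition_open: "c \<in> A \<Longrightarrow> d \<in> A \<Longrightarrow> open (cmap c ` (cdom c \<inter> cdom d))"
  by (intro open_cmap_image open_Int chart_open) auto

lemma transition_has_derivative:
  assumes "c \<in> A" "d \<in> A" "p \<in> cdom c" "p \<in> cdom d"
  shows "((cmap d \<circ> cinv c) has_derivative chart_change c d p) (at (cmap c p))"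
  unfolding chart_change_def by (rule smooth_onD[OF transition_smooth[OF assms(1,2)]]) (use assms in auto)

lemma linear_chart_change:
  "c \<in> A \<Longrightarrow> d \<in> A \<Longrightarrow> p \<in> cdom c \<Longrightarrow> p \<in> cdom d \<Longrightarrow> linear (chart_change c d p)"
  by (rule has_derivative_linear[OF transition_has_derivative])

lemma chart_change_smooth:
  "c \<in> A \<Longrightarrow> d \<in> A \<Longrightarrow> smooth_on (cmap c ` (cdom c \<inter> cdom d)) (\<lambda>x. fderiv (cmap d \<circ> cinv c) x u)"
  by (rule smooth_on_fderiv[OF transition_smooth])

lemma has_derivative_change_chart:
  assumes "c \<in> A" "d \<in> A" "p \<in> cdom c" "p \<in> cdom d" "((h \<circ> cinv d) has_derivative h') (at (cmap d p))"
  shows "((h \<circ> cinv c) has_derivative (\<lambda>v. h' (chart_change c d p v))) (at (cmap c p))"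
proof -
  have "((\<lambda>x. (h \<circ> cinv d) ((cmap d \<circ> cinv c) x)) has_derivative (\<lambda>v. h' (chart_change c d p v))) (at (cmap c p))"
    by (rule has_derivative_compose[OF transition_has_derivative[OF assms(1-4)]])
      (use assms(5) cinv_cmap[OF assms(1,3)] in \<open>simp add: comp_def\<close>)
  then show ?thesis
  proof (rule has_derivative_transform_within_open[OF _ transition_open[OF assms(1,2)]])
    show "cmap c p \<in> cmap c ` (cdom c \<inter> cdom d)" using assms by auto
    show "(h \<circ> cinv d) ((cmap d \<circ> cinv c) x) = (h \<circ> cinv c) x" if "x \<in> cmap c ` (cdom c \<inter> cdom d)" for x
      using that cinv_cmap[OF assms(1)] cinv_cmap[OF assms(2)] by auto
  qed
qed

lemma chart_change_refl:
  assumes "c \<in> A" "p \<in> cdom c" shows "chart_change c c p u = u"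
proof -
  have "((cmap c \<circ> cinv c) has_derivative (\<lambda>u. u)) (at (cmap c p))"
    by (rule has_derivative_transform_within_open[OF has_derivative_ident crange_open[OF assms(1)] cmap_in_crange[OF assms(2)]])
      (simp add: cmap_cinv assms)
  then show ?thesis unfolding chart_change_def by (simp add: fderiv_eq)
qed

lemma chart_change_trans:
  assumes "c \<in> A" "d \<in> A" "e \<in> A" "p \<in> cdom c" "p \<in> cdom d" "p \<in> cdom e"
  shows "chart_change d e p (chart_change c d p u) = chart_change c e p u"
proof -
  have "((cmap e \<circ> cinv c) has_derivative (\<lambda>v. chart_change d e p (chart_change c d p v))) (at (cmap c p))"
    by (rule has_derivative_change_chart[OF assms(1,2,4,5) transition_has_derivative[OF assms(2,3,5,6)]])
  from fun_cong[OF has_derivative_unique[OF this transition_has_derivative[OF assms(1,3,4,6)]], of u]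
  show ?thesis .
qed

lemma coord_vec_in_tspace:
  "c \<in> A \<Longrightarrow> p \<in> cdom c \<Longrightarrow> coord_vec A c p u \<in> tspace A p"
  unfolding tspace_def mem_Collect_eq
  by (intro conjI allI ballI impI) (auto simp: coord_vec_def chart_change_trans)

lemma coord_vec_at: "c \<in> A \<Longrightarrow> p \<in> cdom c \<Longrightarrow> coord_vec A c p u c = u"
  by (simp add: coord_vec_def chart_change_refl)

lemma coord_vec_of_components:
  "v \<in> tspace A p \<Longrightarrow> c \<in> A \<Longrightarrow> p \<in> cdom c \<Longrightarrow> coord_vec A c p (v c) = v"
  unfolding tspace_def mem_Collect_eq by (intro ext) (metis coord_vec_def)

lemma tspace_eqI:
  assumes "v \<in> tspace A p" "w \<in> tspace A p" "c \<in> A" "p \<in> cdom c" "v c = w c"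
  shows "v = w"
proof -
  have "v = coord_vec A c p (v c)" by (rule coord_vec_of_components[OF assms(1,3,4), symmetric])
  also have "\<dots> = coord_vec A c p (w c)" by (rule arg_cong[OF assms(5)])
  also have "\<dots> = w" by (rule coord_vec_of_components[OF assms(2,3,4)])
  finally show ?thesis .
qed

lemma tspace_change:
  assumes "v \<in> tspace A p" "c \<in> A" "d \<in> A" "p \<in> cdom c" "p \<in> cdom d"
  shows "chart_change c d p (v c) = v d"
proof -
  have "\<forall>c\<in>A. \<forall>d\<in>A. p \<in> cdom c \<longrightarrow> p \<in> cdom d \<longrightarrow> v d = chart_change c d p (v c)"
    using assms(1) unfolding tspace_def by (elim CollectE conjE)
  with assms(2-5) show ?thesis by (blast intro: sym)
qed

lemma tspace_outside: "v \<in> tspace A p \<Longrightarrow> \<not> (c \<in> A \<and> p \<in> cdom c) \<Longrightarrow> v c = 0"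
  unfolding tspace_def by blast

lemma tspaceI:
  assumes "\<And>c. \<not> (c \<in> A \<and> p \<in> cdom c) \<Longrightarrow> v c = 0"
    "\<And>c d. c \<in> A \<Longrightarrow> d \<in> A \<Longrightarrow> p \<in> cdom c \<Longrightarrow> p \<in> cdom d \<Longrightarrow> chart_change c d p (v c) = v d"
  shows "v \<in> tspace A p"
  unfolding tspace_def mem_Collect_eq
  by (intro conjI allI ballI impI assms(1) assms(2)[symmetric])

lemma subspace_tspace: "subspace (tspace A p)"
proof -
  note lin = linear_0[OF linear_chart_change] linear_add[OF linear_chart_change] linear_cmul[OF linear_chart_change]
  show ?thesis
    unfolding subspace_def
  proof (intro conjI ballI allI)
    show "0 \<in> tspace A p" by (rule tspaceI) (simp_all add: zero_fun_def lin)
    show "v + w \<in> tspace A p" if "v \<in> tspace A p" "w \<in> tspace A p" for v w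
      by (rule tspaceI) (simp_all add: lin tspace_change[OF that(1)] tspace_change[OF that(2)]
          tspace_outside[OF that(1)] tspace_outside[OF that(2)])
    show "r *\<^sub>R v \<in> tspace A p" if "v \<in> tspace A p" for v r
      by (rule tspaceI) (simp_all add: scaleR_fun_def lin tspace_change[OF that] tspace_outside[OF that])
  qed
qed

lemma linear_coord_vec:
  assumes "c \<in> A" "p \<in> cdom c" shows "linear (coord_vec A c p)"
proof (rule linearI)
  note lin = linear_chart_change[OF assms(1) _ assms(2)]
  show "coord_vec A c p (u + w) = coord_vec A c p u + coord_vec A c p w" for u w
    by (rule ext) (simp add: coord_vec_def linear_add[OF lin])
  show "coord_vec A c p (r *\<^sub>R u) = r *\<^sub>R coord_vec A c p u" for r u
    by (rule ext) (simp add: coord_vec_def scaleR_fun_def linear_cmul[OF lin])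
qed

lemma tderiv_chart:
  assumes "c \<in> A" "p \<in> cdom c" "v \<in> tspace A p" "((h \<circ> cinv c) has_derivative h') (at (cmap c p))"
  shows "tderiv A p v h = h' (v c)"
  unfolding tderiv_def
    fderiv_eq[OF has_derivative_change_chart[OF chart_at_chart(1) assms(1) chart_at_chart(2) assms(2,4)]]
  by (simp add: tspace_change[OF assms(3)] chart_at_chart assms)

end

lemma open_chart_preimage:
  assumes A: "smooth_manifold A" and B: "smooth_manifold B" and c: "c \<in> B" and d: "d \<in> A"
    and U: "open U" and f: "continuous_on U f"
  shows "open {q \<in> cdom c \<inter> U. f q \<in> cdom d}" "open (cmap c ` {q \<in> cdom c \<inter> U. f q \<in> cdom d})"
proof -
  have "open (U \<inter> f -` cdom d)" by (rule continuous_open_preimage[OF f U chart_open[OF A d]])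
  moreover have "{q \<in> cdom c \<inter> U. f q \<in> cdom d} = cdom c \<inter> (U \<inter> f -` cdom d)" by auto
  ultimately show 1: "open {q \<in> cdom c \<inter> U. f q \<in> cdom d}" using chart_open[OF B c] by auto
  show "open (cmap c ` {q \<in> cdom c \<inter> U. f q \<in> cdom d})" by (rule open_cmap_image[OF B c 1]) auto
qed

context
  fixes A :: "('a::{t2_space,second_countable_topology}, 'e::euclidean_space) chart set"
    and B :: "('b::{t2_space,second_countable_topology}, 'f::euclidean_space) chart set"
    and f :: "'b \<Rightarrow> 'a" and U :: "'b set"
  assumes A: "smooth_manifold A" and B: "smooth_manifold B"
    and U: "open U" and f: "smooth_map_on B A U f"
begin

lemma smooth_map_continuous: "continuous_on U f"
  using f by (simp add: smooth_map_on_def)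

lemma smooth_map_chart:
  "c \<in> B \<Longrightarrow> d \<in> A \<Longrightarrow> smooth_on (cmap c ` {q \<in> cdom c \<inter> U. f q \<in> cdom d}) (cmap d \<circ> f \<circ> cinv c)"
  using f by (simp add: smooth_map_on_def)

lemma smooth_map_has_derivative:
  assumes "c \<in> B" "d \<in> A" "p \<in> U" "p \<in> cdom c" "f p \<in> cdom d"
  shows "((cmap d \<circ> f \<circ> cinv c) has_derivative fderiv (cmap d \<circ> f \<circ> cinv c) (cmap c p)) (at (cmap c p))"
  by (rule smooth_onD[OF smooth_map_chart[OF assms(1,2)]]) (use assms in auto)

lemma tmap_chart:
  assumes "c \<in> B" "d \<in> A" "p \<in> U" "p \<in> cdom c" "f p \<in> cdom d" "v \<in> tspace B p"
  shows "tmap B A f p v d = fderiv (cmap d \<circ> f \<circ> cinv c) (cmap c p) (v c)"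
  using tderiv_chart[OF B assms(1,4,6) smooth_map_has_derivative[OF assms(1-5)]] assms
  by (simp add: tmap_def)

lemma tmap_in_tspace:
  assumes "p \<in> U" "v \<in> tspace B p"
  shows "tmap B A f p v \<in> tspace A (f p)"
proof -
  obtain c where c: "c \<in> B" "p \<in> cdom c" using ex_chart[OF B] by blast
  have change: "chart_change d e (f p) (tmap B A f p v d) = tmap B A f p v e"
    if d: "d \<in> A" "f p \<in> cdom d" and e: "e \<in> A" "f p \<in> cdom e" for d e
  proof -
    let ?O = "cmap c ` {q \<in> cdom c \<inter> U. f q \<in> cdom d}"
    have 1: "((\<lambda>x. (cmap e \<circ> cinv d) ((cmap d \<circ> f \<circ> cinv c) x)) has_derivative
       (\<lambda>v. chart_change d e (f p) (fderiv (cmap d \<circ> f \<circ> cinv c) (cmap c p) v))) (at (cmap c p))"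
      by (rule has_derivative_compose[OF smooth_map_has_derivative[OF c(1) d(1) assms(1) c(2) d(2)]])
        (use transition_has_derivative[OF A d(1) e(1) d(2) e(2)] cinv_cmap[OF B c] in \<open>simp add: comp_def\<close>)
    have "((cmap e \<circ> f \<circ> cinv c) has_derivative
       (\<lambda>v. chart_change d e (f p) (fderiv (cmap d \<circ> f \<circ> cinv c) (cmap c p) v))) (at (cmap c p))"
    proof (rule has_derivative_transform_within_open[OF 1 open_chart_preimage(2)[OF A B c(1) d(1) U smooth_map_continuous]])
      show "cmap c p \<in> ?O" using c d assms(1) by auto
      show "(cmap e \<circ> cinv d) ((cmap d \<circ> f \<circ> cinv c) x) = (cmap e \<circ> f \<circ> cinv c) x" if "x \<in> ?O" for x
        using that cinv_cmap[OF B c(1)] cinv_cmap[OF A d(1)] by auto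
    qed
    from fderiv_eq[OF this] show ?thesis
      by (simp add: tmap_chart[OF c(1) _ assms(1) c(2) _ assms(2)] d e)
  qed
  show ?thesis
  proof (rule tspaceI[OF A])
    show "tmap B A f p v d = 0" if "\<not> (d \<in> A \<and> f p \<in> cdom d)" for d
      unfolding tmap_def by (rule if_not_P[OF that])
  qed (rule change)
qed

lemma linear_on_tmap:
  assumes "p \<in> U"
  shows "linear_on (tspace B p) (tmap B A f p)"
proof -
  obtain c where c: "c \<in> B" "p \<in> cdom c" using ex_chart[OF B] by blast
  obtain d where d: "d \<in> A" "f p \<in> cdom d" using ex_chart[OF A] by blast
  note t = tmap_chart[OF c(1) d(1) assms c(2) d(2)]
  note lin = has_derivative_linear[OF smooth_map_has_derivative[OF c(1) d(1) assms c(2) d(2)]]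
  note sB = subspace_tspace[OF B, of p] and sA = subspace_tspace[OF A, of "f p"]
  show ?thesis
    unfolding linear_on_def
  proof (intro conjI ballI allI)
    show "tmap B A f p (v + w) = tmap B A f p v + tmap B A f p w" if v: "v \<in> tspace B p" "w \<in> tspace B p" for v w
    proof (rule tspace_eqI[OF A _ _ d])
      show "tmap B A f p (v + w) \<in> tspace A (f p)" "tmap B A f p v + tmap B A f p w \<in> tspace A (f p)"
        by (intro tmap_in_tspace assms subspace_add[OF sA] subspace_add[OF sB] v)+
      show "tmap B A f p (v + w) d = (tmap B A f p v + tmap B A f p w) d"
        by (simp add: t[OF v(1)] t[OF v(2)] t[OF subspace_add[OF sB v]] linear_add[OF lin])
    qed
    show "tmap B A f p (r *\<^sub>R v) = r *\<^sub>R tmap B A f p v" if v: "v \<in> tspace B p" for r v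
    proof (rule tspace_eqI[OF A _ _ d])
      show "tmap B A f p (r *\<^sub>R v) \<in> tspace A (f p)" "r *\<^sub>R tmap B A f p v \<in> tspace A (f p)"
        by (intro tmap_in_tspace assms subspace_scale[OF sA] subspace_scale[OF sB] v)+
      show "tmap B A f p (r *\<^sub>R v) d = (r *\<^sub>R tmap B A f p v) d"
        by (simp only: tvec_scaleR_apply t[OF v] t[OF subspace_scale[OF sB v]] linear_cmul[OF lin])
    qed
  qed
qed

lemma smooth_along_components:
  "smooth_along B A f U W \<Longrightarrow> c \<in> B \<Longrightarrow> d \<in> A \<Longrightarrow>
    smooth_on (cmap c ` {q \<in> cdom c \<inter> U. f q \<in> cdom d}) (\<lambda>x. W (cinv c x) d)"
  unfolding smooth_along_def by blast

text \<open>In any other pair of charts the components are obtained with the Jacobian of a coordinate change, which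
  depends smoothly on the point.\<close>

lemma smooth_along_coord_vec:
  assumes c: "c \<in> B" "U \<subseteq> cdom c" and d: "d \<in> A" "f ` U \<subseteq> cdom d" and w: "smooth_on (cmap c ` U) w"
  shows "smooth_along B A f U (\<lambda>q. coord_vec A d (f q) (w (cmap c q)))"
  unfolding smooth_along_def
proof (intro conjI ballI)
  show "coord_vec A d (f q) (w (cmap c q)) \<in> tspace A (f q)" if "q \<in> U" for q
    using coord_vec_in_tspace[OF A d(1)] d(2) that by blast
  fix c' d' assume c': "c' \<in> B" and d': "d' \<in> A"
  let ?O = "cmap c' ` {q \<in> cdom c' \<inter> U. f q \<in> cdom d'}"
  have O: "open ?O" by (rule open_chart_preimage(2)[OF A B c' d' U smooth_map_continuous])
  have sub: "?O \<subseteq> cmap c' ` {q \<in> cdom c' \<inter> U. f q \<in> cdom d}" "?O \<subseteq> cmap c' ` (cdom c' \<inter> cdom c)"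
    using c(2) d(2) by auto
  have "smooth_on ?O (\<lambda>x. fderiv (cmap d' \<circ> cinv d) ((cmap d \<circ> f \<circ> cinv c') x) (w ((cmap c \<circ> cinv c') x)))"
  proof (rule smooth_on_linear_family[where F="\<lambda>x. fderiv (cmap d' \<circ> cinv d) ((cmap d \<circ> f \<circ> cinv c') x)"
        and w="\<lambda>x. w ((cmap c \<circ> cinv c') x)", OF O])
    have img: "(cmap d \<circ> f \<circ> cinv c') ` ?O \<subseteq> cmap d ` (cdom d \<inter> cdom d')"
      using d(2) cinv_cmap[OF B c'] by auto
    show "linear (fderiv (cmap d' \<circ> cinv d) ((cmap d \<circ> f \<circ> cinv c') x))" if "x \<in> ?O" for x
      by (rule smooth_on_linear_fderiv[OF transition_smooth[OF A d(1) d']]) (use img that in blast)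
    show "smooth_on ?O (\<lambda>x. fderiv (cmap d' \<circ> cinv d) ((cmap d \<circ> f \<circ> cinv c') x) u)" for u
      by (rule smooth_on_compose[OF O transition_open[OF A d(1) d'] img
            smooth_on_subset[OF smooth_map_chart[OF c' d(1)] sub(1)] chart_change_smooth[OF A d(1) d']])
    show "smooth_on ?O (\<lambda>x. w ((cmap c \<circ> cinv c') x))"
    proof (rule smooth_on_compose[OF O open_cmap_image[OF B c(1) U c(2)] _ smooth_on_subset[OF transition_smooth[OF B c' c(1)] sub(2)] w])
      show "(cmap c \<circ> cinv c') ` ?O \<subseteq> cmap c ` U" using cinv_cmap[OF B c'] by auto
    qed
  qed
  then show "smooth_on ?O (\<lambda>x. coord_vec A d (f (cinv c' x)) (w (cmap c (cinv c' x))) d')"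
    by (subst smooth_on_cong[OF O]) (auto simp: coord_vec_def chart_change_def d' cinv_cmap[OF B c'])
qed

end

lemma smooth_map_on_id:
  assumes A: "smooth_manifold A" shows "smooth_map_on A A U id"
  unfolding smooth_map_on_def
proof (intro conjI ballI)
  show "continuous_on U id" by (simp add: continuous_on_id)
  fix c d assume cd: "c \<in> A" "d \<in> A"
  show "smooth_on (cmap c ` {q \<in> cdom c \<inter> U. id q \<in> cdom d}) (cmap d \<circ> id \<circ> cinv c)"
    unfolding comp_id by (rule smooth_on_subset[OF transition_smooth[OF A cd]]) auto
qed

lemma coord_field_smooth:
  assumes A: "smooth_manifold A" and d: "d \<in> A"
  shows "smooth_vf A (cdom d) (\<lambda>q. coord_vec A d q u)"
proof -
  have "smooth_along A A id (cdom d) (\<lambda>q. coord_vec A d (id q) ((\<lambda>_. u) (cmap d q)))"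
    by (rule smooth_along_coord_vec[OF A A chart_open[OF A d] smooth_map_on_id[OF A] d order_refl d _ smooth_on_const]) simp
  then show ?thesis by (simp only: id_apply)
qed

lemma tmap_id:
  assumes A: "smooth_manifold A" and "v \<in> tspace A p"
  shows "tmap A A id p v = v"
proof -
  obtain d where d: "d \<in> A" "p \<in> cdom d" using ex_chart[OF A] by blast
  note id = smooth_map_on_id[OF A, of UNIV]
  have "tmap A A id p v \<in> tspace A p"
    using tmap_in_tspace[OF A A open_UNIV id UNIV_I assms(2)] by simp
  moreover have "tmap A A id p v d = v d"
    using tmap_chart[OF A A open_UNIV id d(1) d(1) UNIV_I d(2) _ assms(2)] d chart_change_refl[OF A d, of "v d"]
    by (simp add: chart_change_def)
  ultimately show ?thesis by (rule tspace_eqI[OF A _ assms(2) d])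
qed

section \<open>Covariant derivatives in charts\<close>

lemma coord_vec_components_smooth:
  assumes A: "smooth_manifold A" and d0: "d0 \<in> A" and d: "d \<in> A" and p: "p \<in> cdom d0" "p \<in> cdom d"
  shows "(((\<lambda>q. coord_vec A d0 q w d) \<circ> cinv d0) has_derivative
    fderiv (\<lambda>y. fderiv (cmap d \<circ> cinv d0) y w) (cmap d0 p)) (at (cmap d0 p))"
proof (rule has_derivative_transform_within_open[OF _ transition_open[OF A d0 d]])
  show pin: "cmap d0 p \<in> cmap d0 ` (cdom d0 \<inter> cdom d)" using p by auto
  show "((\<lambda>y. fderiv (cmap d \<circ> cinv d0) y w) has_derivative
      fderiv (\<lambda>y. fderiv (cmap d \<circ> cinv d0) y w) (cmap d0 p)) (at (cmap d0 p))"
    by (rule smooth_onD[OF chart_change_smooth[OF A d0 d] pin])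
  show "fderiv (cmap d \<circ> cinv d0) y w = ((\<lambda>q. coord_vec A d0 q w d) \<circ> cinv d0) y"
    if "y \<in> cmap d0 ` (cdom d0 \<inter> cdom d)" for y
    using that d cinv_cmap[OF A d0] by (auto simp: coord_vec_def chart_change_def)
qed

text \<open>In a second chart the coordinate fields of the first are no longer constant, and their covariant
  derivative acquires the second derivatives of the coordinate change.\<close>

lemma cov_coord_fields:
  assumes A: "smooth_manifold A" and d0: "d0 \<in> A" and d: "d \<in> A" and p: "p \<in> cdom d0" "p \<in> cdom d"
  shows "cov A \<Gamma> (\<lambda>q. coord_vec A d0 q u) (\<lambda>q. coord_vec A d0 q w) p d =
    fderiv (\<lambda>y. fderiv (cmap d \<circ> cinv d0) y w) (cmap d0 p) u +
    \<Gamma> d p (coord_vec A d0 p u d) (coord_vec A d0 p w d)"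
proof -
  note u = coord_vec_in_tspace[OF A d0 p(1), of u]
  have "tderiv A p (coord_vec A d0 p u) (\<lambda>q. coord_vec A d0 q w d) =
      fderiv (\<lambda>y. fderiv (cmap d \<circ> cinv d0) y w) (cmap d0 p) u"
    using tderiv_chart[OF A d0 p(1) u coord_vec_components_smooth[OF A d0 d p]]
    by (simp add: coord_vec_at[OF A d0 p(1)])
  then show ?thesis by (simp add: cov_def cov_along_def d p(2) tmap_id[OF A u])
qed

lemma cov_coord_fields_same:
  assumes A: "smooth_manifold A" and d: "d \<in> A" "p \<in> cdom d"
  shows "cov A \<Gamma> (\<lambda>q. coord_vec A d q u) (\<lambda>q. coord_vec A d q w) p d = \<Gamma> d p u w"
proof -
  have "fderiv (\<lambda>y. fderiv (cmap d \<circ> cinv d) y w) (cmap d p) = fderiv (\<lambda>y. w) (cmap d p)"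
  proof (rule fderiv_cong_open[OF crange_open[OF A d(1)] cmap_in_crange[OF A d(2)]])
    fix y assume y: "y \<in> crange d"
    show "fderiv (cmap d \<circ> cinv d) y w = w"
      using chart_change_refl[OF A d(1) cinv_in_cdom[OF A d(1) y], of w]
      by (simp add: chart_change_def cmap_cinv[OF A d(1) y])
  qed
  then show ?thesis
    unfolding cov_coord_fields[OF A d(1) d(1) d(2) d(2)] by (simp add: coord_vec_at[OF A d])
qed

context
  fixes A :: "('a::{t2_space,second_countable_topology}, 'e::euclidean_space) chart set"
    and B :: "('b::{t2_space,second_countable_topology}, 'f::euclidean_space) chart set"
    and f :: "'b \<Rightarrow> 'a" and U :: "'b set" and W
  assumes A: "smooth_manifold A" and B: "smooth_manifold B"
    and U: "open U" and f: "smooth_map_on B A U f" and W: "smooth_along B A f U W"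
begin

lemma along_has_derivative:
  assumes "c \<in> B" "d \<in> A" "p \<in> U" "p \<in> cdom c" "f p \<in> cdom d"
  shows "((\<lambda>x. W (cinv c x) d) has_derivative fderiv (\<lambda>x. W (cinv c x) d) (cmap c p)) (at (cmap c p))"
  by (rule smooth_onD[OF smooth_along_components[OF A B U f W assms(1,2)]]) (use assms in auto)

lemma cov_along_chart:
  assumes "c \<in> B" "d \<in> A" "p \<in> U" "p \<in> cdom c" "f p \<in> cdom d" "v \<in> tspace B p"
  shows "cov_along B A \<Gamma> f p v W d = fderiv (\<lambda>x. W (cinv c x) d) (cmap c p) (v c) +
    \<Gamma> d (f p) (tmap B A f p v d) (W p d)"
proof -
  have "((\<lambda>q. W q d) \<circ> cinv c) = (\<lambda>x. W (cinv c x) d)" by (simp add: comp_def)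
  then have "tderiv B p v (\<lambda>q. W q d) = fderiv (\<lambda>x. W (cinv c x) d) (cmap c p) (v c)"
    using along_has_derivative[OF assms(1-5)] by (intro tderiv_chart[OF B assms(1,4,6)]) simp
  then show ?thesis by (simp add: cov_along_def assms)
qed

text \<open>Comparison with the coordinate fields of one chart \<open>d\<close> whose values at \<open>p\<close> are the velocity and \<open>W p\<close>: the
  second derivatives of the coordinate changes cancel, and only the components of \<open>W\<close> are differentiated.
  The right hand side is a tangent vector, because connections map vector fields to vector fields.\<close>

lemma cov_along_eq_cov_coord:
  assumes "c \<in> B" "d \<in> A" "p \<in> U" "p \<in> cdom c" "f p \<in> cdom d" "v \<in> tspace B p"
  shows "cov_along B A \<Gamma> f p v W =
    (\<lambda>e. if e \<in> A \<and> f p \<in> cdom e then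
      cov A \<Gamma> (\<lambda>q. coord_vec A d q (tmap B A f p v d)) (\<lambda>q. coord_vec A d q (W p d)) (f p) e else 0) +
    coord_vec A d (f p) (fderiv (\<lambda>x. W (cinv c x) d) (cmap c p) (v c))"
proof (rule ext)
  fix e
  show "cov_along B A \<Gamma> f p v W e = ((\<lambda>e. if e \<in> A \<and> f p \<in> cdom e then
      cov A \<Gamma> (\<lambda>q. coord_vec A d q (tmap B A f p v d)) (\<lambda>q. coord_vec A d q (W p d)) (f p) e else 0) +
    coord_vec A d (f p) (fderiv (\<lambda>x. W (cinv c x) d) (cmap c p) (v c))) e"
  proof (cases "e \<in> A \<and> f p \<in> cdom e")
    case False
    then show ?thesis by (auto simp: cov_along_def coord_vec_def)
  next
    case True
    then have e: "e \<in> A" "f p \<in> cdom e" by auto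
    let ?x = "cmap c p" and ?i = "cmap d \<circ> f \<circ> cinv c" and ?w = "\<lambda>x. W (cinv c x) d"
    let ?G = "\<lambda>y. fderiv (cmap e \<circ> cinv d) y"
    let ?O = "cmap c ` {q \<in> cdom c \<inter> {q \<in> U. f q \<in> cdom e}. f q \<in> cdom d}"
    have Ue: "open {q \<in> U. f q \<in> cdom e}"
      using continuous_open_preimage[OF smooth_map_continuous[OF A B U f] U chart_open[OF A e(1)]]
      by (simp add: vimage_def Int_def)
    have Uc: "continuous_on {q \<in> U. f q \<in> cdom e} f"
      by (rule continuous_on_subset[OF smooth_map_continuous[OF A B U f]]) auto
    have O: "open ?O" by (rule open_chart_preimage(2)[OF A B assms(1,2) Ue Uc])
    have x: "?x \<in> ?O" using assms e by auto
    have ix: "?i ?x = cmap d (f p)" using cinv_cmap[OF B assms(1,4)] by simp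
    have img: "?i x \<in> cmap d ` (cdom d \<inter> cdom e)" if "x \<in> ?O" for x
      using that cinv_cmap[OF B assms(1)] by auto
    have Gd: "((\<lambda>x. ?G (?i x) u) has_derivative (\<lambda>h. fderiv (\<lambda>y. ?G y u) (cmap d (f p)) (fderiv ?i ?x h))) (at ?x)" for u
    proof (rule has_derivative_compose[OF smooth_map_has_derivative[OF A B U f assms(1-5)]])
      show "((\<lambda>y. ?G y u) has_derivative fderiv (\<lambda>y. ?G y u) (cmap d (f p))) (at (?i ?x))"
        unfolding ix by (rule smooth_onD[OF chart_change_smooth[OF A assms(2) e(1)]]) (use assms e in auto)
    qed
    have "((\<lambda>x. ?G (?i x) (?w x)) has_derivative
        (\<lambda>h. fderiv (\<lambda>x. ?G (?i x) (?w ?x)) ?x h + ?G (?i ?x) (fderiv ?w ?x h))) (at ?x)"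
    proof (rule has_derivative_linear_family[where F="\<lambda>x. ?G (?i x)" and w="?w", OF O x])
      show "linear (?G (?i x))" if "x \<in> ?O" for x
        by (rule smooth_on_linear_fderiv[OF transition_smooth[OF A assms(2) e(1)] img[OF that]])
      show "(\<lambda>x. ?G (?i x) u) differentiable at ?x" for u using Gd differentiable_def by blast
      show "(?w has_derivative fderiv ?w ?x) (at ?x)" by (rule along_has_derivative[OF assms(1-5)])
    qed
    moreover have "?G (?i x) (?w x) = W (cinv c x) e" if "x \<in> ?O" for x
    proof -
      obtain q where q: "q \<in> cdom c" "q \<in> U" "f q \<in> cdom d" "f q \<in> cdom e" "x = cmap c q" using \<open>x \<in> ?O\<close> by auto
      have cq: "cinv c x = q" using cinv_cmap[OF B assms(1) q(1)] q(5) by simp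
      have "W q \<in> tspace A (f q)" using W q(2) unfolding smooth_along_def by blast
      from tspace_change[OF A this assms(2) e(1) q(3,4)] show ?thesis by (simp add: cq chart_change_def)
    qed
    ultimately have "((\<lambda>x. W (cinv c x) e) has_derivative
        (\<lambda>h. fderiv (\<lambda>x. ?G (?i x) (?w ?x)) ?x h + ?G (?i ?x) (fderiv ?w ?x h))) (at ?x)"
      by (rule has_derivative_transform_within_open[OF _ O x])
    from fderiv_eq[OF this] have D: "fderiv (\<lambda>x. W (cinv c x) e) ?x (v c) =
        fderiv (\<lambda>y. ?G y (?w ?x)) (cmap d (f p)) (fderiv ?i ?x (v c)) + ?G (cmap d (f p)) (fderiv ?w ?x (v c))"
      unfolding fderiv_eq[OF Gd] ix by simp
    have wx: "?w ?x = W p d" by (simp add: cinv_cmap[OF B assms(1,4)])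
    have tm: "fderiv ?i ?x (v c) = tmap B A f p v d" by (rule tmap_chart[OF A B U f assms, symmetric])
    have Wp: "W p \<in> tspace A (f p)" using W assms(3) unfolding smooth_along_def by blast
    have c1: "coord_vec A d (f p) (tmap B A f p v d) = tmap B A f p v"
      by (rule coord_vec_of_components[OF A tmap_in_tspace[OF A B U f assms(3,6)] assms(2,5)])
    have c2: "coord_vec A d (f p) (W p d) = W p" by (rule coord_vec_of_components[OF A Wp assms(2,5)])
    have c3: "coord_vec A d (f p) z e = ?G (cmap d (f p)) z" for z
      by (simp add: coord_vec_def chart_change_def e)
    show ?thesis
      unfolding cov_along_chart[OF assms(1) e(1) assms(3,4) e(2) assms(6)] D wx tm plus_fun_apply
        if_P[OF True] cov_coord_fields[OF A assms(2) e(1) assms(5) e(2)] c1 c2 c3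
      by simp
  qed
qed

lemma cov_along_in_tspace:
  assumes "linear_connection A \<Gamma>" "p \<in> U" "v \<in> tspace B p"
  shows "cov_along B A \<Gamma> f p v W \<in> tspace A (f p)"
proof -
  obtain c where c: "c \<in> B" "p \<in> cdom c" using ex_chart[OF B] by blast
  obtain d where d: "d \<in> A" "f p \<in> cdom d" using ex_chart[OF A] by blast
  have "cov A \<Gamma> (\<lambda>q. coord_vec A d q (tmap B A f p v d)) (\<lambda>q. coord_vec A d q (W p d)) (f p) \<in> tspace A (f p)"
    (is "?C \<in> _")
    using assms(1) chart_open[OF A d(1)] coord_field_smooth[OF A d(1)] d(2)
    unfolding linear_connection_def by blast
  moreover have "(\<lambda>e. if e \<in> A \<and> f p \<in> cdom e then ?C e else 0) = ?C"
    using tspace_outside[OF A \<open>?C \<in> _\<close>] by auto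
  ultimately show ?thesis
    unfolding cov_along_eq_cov_coord[OF c(1) d(1) assms(2) c(2) d(2) assms(3)]
    using subspace_add[OF subspace_tspace[OF A]] coord_vec_in_tspace[OF A d] by simp
qed

end

section \<open>The structure equations of para Sasakian manifolds along a map\<close>

lemma linear_on_add: "linear_on T h \<Longrightarrow> v \<in> T \<Longrightarrow> w \<in> T \<Longrightarrow> h (v + w) = h v + h w"
  and linear_on_scale: "linear_on T h \<Longrightarrow> v \<in> T \<Longrightarrow> h (r *\<^sub>R v) = r *\<^sub>R h v"
  unfolding linear_on_def by blast+

lemma linear_on_zero: "linear_on T h \<Longrightarrow> subspace T \<Longrightarrow> h 0 = 0"
  using linear_on_scale[of T h 0 0] subspace_0 by force

lemma linear_on_diff:
  "linear_on T h \<Longrightarrow> subspace T \<Longrightarrow> v \<in> T \<Longrightarrow> w \<in> T \<Longrightarrow> h (v - w) = h v - h w"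
  using linear_on_add[of T h v "-1 *\<^sub>R w"] linear_on_scale[of T h w "-1"] subspace_scale[of T w "-1"] by simp

lemma linear_on_minus: "linear_on T h \<Longrightarrow> v \<in> T \<Longrightarrow> h (- v) = - h v"
  using linear_on_scale[of T h v "-1"] by simp

lemma linear_on_coord_vec:
  assumes A: "smooth_manifold A" and d: "d \<in> A" "p \<in> cdom d" and h: "linear_on (tspace A p) h"
  shows "linear (\<lambda>u. h (coord_vec A d p u))"
  by (rule linearI)
    (simp_all add: linear_add[OF linear_coord_vec[OF A d]] linear_cmul[OF linear_coord_vec[OF A d]]
      linear_on_add[OF h] linear_on_scale[OF h] coord_vec_in_tspace[OF A d])

lemma tderiv_coord_field:
  assumes A: "smooth_manifold A" and d: "d \<in> A" "p \<in> cdom d" and v: "v \<in> tspace A p"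
  shows "tderiv A p v (\<lambda>q. coord_vec A d q w d) = 0"
proof -
  have "(((\<lambda>q. coord_vec A d q w d) \<circ> cinv d) has_derivative (\<lambda>h. 0)) (at (cmap d p))"
    by (rule has_derivative_transform_within_open[OF has_derivative_const[of w] crange_open[OF A d(1)] cmap_in_crange[OF A d(2)]])
      (simp add: coord_vec_at[OF A d(1) cinv_in_cdom[OF A d(1)]])
  from tderiv_chart[OF A d v this] show ?thesis .
qed

context
  fixes A :: "('a::{t2_space,second_countable_topology}, 'e::euclidean_space) chart set" and \<phi> \<xi> \<eta> g \<epsilon> \<Gamma>
  assumes A: "smooth_manifold A" and P: "para_sasakian A \<phi> \<xi> \<eta> g \<epsilon> \<Gamma>"
begin

lemma almost_paracontact: "almost_paracontact_metric A \<phi> \<xi> \<eta> g \<epsilon>"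
  using P unfolding para_sasakian_def by (rule conjunct1)

lemma levi_civita: "levi_civita A g \<Gamma>"
  using P unfolding para_sasakian_def by (elim conjE)

lemma linear_connection: "linear_connection A \<Gamma>"
  using levi_civita unfolding levi_civita_def by (rule conjunct1)

lemma christoffel_linear:
  assumes "d \<in> A" "p \<in> cdom d" shows "linear (\<Gamma> d p u)"
proof -
  have "\<forall>c\<in>A. \<forall>p\<in>cdom c. (\<forall>u. linear (\<Gamma> c p u)) \<and> (\<forall>w. linear (\<lambda>u. \<Gamma> c p u w))"
    using linear_connection unfolding linear_connection_def by (rule conjunct1)
  from bspec[OF bspec[OF this assms(1)] assms(2)] show ?thesis by simp
qed

lemma epsilon: "\<epsilon> = 1 \<or> \<epsilon> = -1"
  and phi_linear: "linear_on (tspace A p) (\<phi> p)"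
  and phi_in: "v \<in> tspace A p \<Longrightarrow> \<phi> p v \<in> tspace A p"
  and phi_smooth: "d \<in> A \<Longrightarrow> smooth_on (crange d) (\<lambda>y. \<phi> (cinv d y) (coord_vec A d (cinv d y) u) d)"
  and xi_vf: "smooth_vf A UNIV \<xi>"
  and eta_linear: "linear_on (tspace A p) (\<eta> p)"
  and eta_xi: "\<eta> p (\<xi> p) = 1" and phi_xi: "\<phi> p (\<xi> p) = 0"
  and phi_phi: "v \<in> tspace A p \<Longrightarrow> \<phi> p (\<phi> p v) = v - \<eta> p v *\<^sub>R \<xi> p"
  and eta_phi: "v \<in> tspace A p \<Longrightarrow> \<eta> p (\<phi> p v) = 0"
  and metric_phi: "v \<in> tspace A p \<Longrightarrow> w \<in> tspace A p \<Longrightarrow>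
    g p (\<phi> p v) (\<phi> p w) = g p v w - \<epsilon> * \<eta> p v * \<eta> p w"
proof -
  from almost_paracontact have *: "\<epsilon> = 1 \<or> \<epsilon> = -1"
    "\<forall>p. linear_on (tspace A p) (\<phi> p) \<and> \<phi> p ` tspace A p \<subseteq> tspace A p"
    "\<forall>c\<in>A. \<forall>u. smooth_on (crange c) (\<lambda>x. \<phi> (cinv c x) (coord_vec A c (cinv c x) u) c)"
    "smooth_vf A UNIV \<xi>" "\<forall>p. linear_on (tspace A p) (\<eta> p)"
    "\<forall>p. \<eta> p (\<xi> p) = 1 \<and> \<phi> p (\<xi> p) = 0 \<and>
      (\<forall>v\<in>tspace A p. \<phi> p (\<phi> p v) = v - \<eta> p v *\<^sub>R \<xi> p \<and> \<eta> p (\<phi> p v) = 0) \<and>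
      (\<forall>v\<in>tspace A p. \<forall>w\<in>tspace A p. g p (\<phi> p v) (\<phi> p w) = g p v w - \<epsilon> * \<eta> p v * \<eta> p w)"
    unfolding almost_paracontact_metric_def by - (elim conjE, assumption)+
  show "\<epsilon> = 1 \<or> \<epsilon> = -1" by (rule *(1))
  show "linear_on (tspace A p) (\<phi> p)" by (rule conjunct1[OF spec[OF *(2)]])
  show "\<phi> p v \<in> tspace A p" if "v \<in> tspace A p"
    by (rule subsetD[OF conjunct2[OF spec[OF *(2)]] imageI[OF that]])
  show "smooth_on (crange d) (\<lambda>y. \<phi> (cinv d y) (coord_vec A d (cinv d y) u) d)" if "d \<in> A"
    by (rule spec[OF bspec[OF *(3) that]])
  show "smooth_vf A UNIV \<xi>" by (rule *(4))
  show "linear_on (tspace A p) (\<eta> p)" by (rule spec[OF *(5)])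
  note p = spec[OF *(6), of p]
  show "\<eta> p (\<xi> p) = 1" "\<phi> p (\<xi> p) = 0" using p by - (elim conjE, assumption)+
  show "\<phi> p (\<phi> p v) = v - \<eta> p v *\<^sub>R \<xi> p" "\<eta> p (\<phi> p v) = 0" if v: "v \<in> tspace A p"
    using p bspec[OF conjunct1[OF conjunct2[OF conjunct2[OF p]]] v] by - (elim conjE, assumption)+
  show "g p (\<phi> p v) (\<phi> p w) = g p v w - \<epsilon> * \<eta> p v * \<eta> p w" if vw: "v \<in> tspace A p" "w \<in> tspace A p"
    by (rule bspec[OF bspec[OF conjunct2[OF conjunct2[OF conjunct2[OF p]]] vw(1)] vw(2)])
qed

lemma metric: "semi_riemannian_metric A g"
  using almost_paracontact unfolding almost_paracontact_metric_def by (elim conjE)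

lemma metric_linear: "v \<in> tspace A p \<Longrightarrow> linear_on (tspace A p) (g p v)"
  and metric_sym: "v \<in> tspace A p \<Longrightarrow> w \<in> tspace A p \<Longrightarrow> g p v w = g p w v"
  and metric_nondegenerate: "v \<in> tspace A p \<Longrightarrow> (\<And>w. w \<in> tspace A p \<Longrightarrow> g p v w = 0) \<Longrightarrow> v = 0"
  and metric_smooth: "d \<in> A \<Longrightarrow> smooth_on (crange d)
       (\<lambda>y. g (cinv d y) (coord_vec A d (cinv d y) u) (coord_vec A d (cinv d y) z))"
proof -
  from metric have *: "\<forall>p. \<forall>v\<in>tspace A p. linear_on (tspace A p) (g p v)"
    "\<forall>p. \<forall>v\<in>tspace A p. \<forall>w\<in>tspace A p. g p v w = g p w v"
    "\<forall>p. \<forall>v\<in>tspace A p. (\<forall>w\<in>tspace A p. g p v w = 0) \<longrightarrow> v = 0"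
    "\<forall>c\<in>A. \<forall>u w. smooth_on (crange c)
       (\<lambda>x. g (cinv c x) (coord_vec A c (cinv c x) u) (coord_vec A c (cinv c x) w))"
    unfolding semi_riemannian_metric_def by - (elim conjE, assumption)+
  show "linear_on (tspace A p) (g p v)" if "v \<in> tspace A p" using *(1) that by simp
  show "g p v w = g p w v" if "v \<in> tspace A p" "w \<in> tspace A p" using *(2) that by blast
  show "v = 0" if "v \<in> tspace A p" "\<And>w. w \<in> tspace A p \<Longrightarrow> g p v w = 0" using *(3) that by blast
  show "smooth_on (crange d)
       (\<lambda>y. g (cinv d y) (coord_vec A d (cinv d y) u) (coord_vec A d (cinv d y) z))" if "d \<in> A"
    using *(4) that by simp
qed

lemma metric_linear_left: "w \<in> tspace A p \<Longrightarrow> linear_on (tspace A p) (\<lambda>v. g p v w)"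
proof -
  assume w: "w \<in> tspace A p"
  note s = subspace_tspace[OF A, of p]
  show ?thesis
    unfolding linear_on_def
    using metric_sym[OF _ w] linear_on_add[OF metric_linear[OF w]] linear_on_scale[OF metric_linear[OF w]]
      subspace_add[OF s] subspace_scale[OF s] by simp
qed

lemma xi_in: "\<xi> p \<in> tspace A p"
  using xi_vf unfolding smooth_along_def by simp

lemma metric_xi: "v \<in> tspace A p \<Longrightarrow> g p v (\<xi> p) = \<epsilon> * \<eta> p v"
  using metric_phi[OF _ xi_in, of v p] linear_on_zero[OF metric_linear[OF phi_in] subspace_tspace[OF A], of v p]
  by (simp add: phi_xi eta_xi)

text \<open>Coordinate fields have constant components, so their covariant derivatives are Christoffel symbols and
  the axioms become identities between tensors in a chart.\<close>

lemma christoffel_symmetric: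
  assumes d: "d \<in> A" "p \<in> cdom d" shows "\<Gamma> d p u w = \<Gamma> d p w u"
proof -
  let ?X = "\<lambda>q. coord_vec A d q u" and ?Y = "\<lambda>q. coord_vec A d q w"
  note X = coord_field_smooth[OF A d(1), of u] and Y = coord_field_smooth[OF A d(1), of w]
  have "cov A \<Gamma> ?X ?Y p - cov A \<Gamma> ?Y ?X p = lie_bracket A ?X ?Y p"
    using levi_civita chart_open[OF A d(1)] X Y d(2) unfolding levi_civita_def by blast
  then have "(cov A \<Gamma> ?X ?Y p - cov A \<Gamma> ?Y ?X p) d = lie_bracket A ?X ?Y p d" by simp
  then show ?thesis
    by (simp add: cov_coord_fields_same[OF A d] lie_bracket_def d tderiv_coord_field[OF A d] coord_vec_in_tspace[OF A d])
qed

lemma cov_coord_eq: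
  assumes d: "d \<in> A" "p \<in> cdom d"
  shows "cov A \<Gamma> (\<lambda>q. coord_vec A d q u) (\<lambda>q. coord_vec A d q w) p = coord_vec A d p (\<Gamma> d p u w)"
proof (rule tspace_eqI[OF A _ coord_vec_in_tspace[OF A d] d])
  show "cov A \<Gamma> (\<lambda>q. coord_vec A d q u) (\<lambda>q. coord_vec A d q w) p \<in> tspace A p"
    using linear_connection chart_open[OF A d(1)] coord_field_smooth[OF A d(1)] d(2)
    unfolding linear_connection_def by blast
qed (simp add: cov_coord_fields_same[OF A d] coord_vec_at[OF A d])

lemma metric_derivative_coord:
  assumes d: "d \<in> A" "p \<in> cdom d"
  defines "G \<equiv> \<lambda>y u w. g (cinv d y) (coord_vec A d (cinv d y) u) (coord_vec A d (cinv d y) w)"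
  shows "fderiv (\<lambda>y. G y w z) (cmap d p) u = G (cmap d p) (\<Gamma> d p u w) z + G (cmap d p) w (\<Gamma> d p u z)"
proof -
  have "tderiv A p (coord_vec A d p u) (\<lambda>q. g q (coord_vec A d q w) (coord_vec A d q z)) =
      g p (cov A \<Gamma> (\<lambda>q. coord_vec A d q u) (\<lambda>q. coord_vec A d q w) p) (coord_vec A d p z) +
      g p (coord_vec A d p w) (cov A \<Gamma> (\<lambda>q. coord_vec A d q u) (\<lambda>q. coord_vec A d q z) p)"
    using levi_civita chart_open[OF A d(1)] coord_field_smooth[OF A d(1)] d(2)
    unfolding levi_civita_def by blast
  moreover have "tderiv A p (coord_vec A d p u) (\<lambda>q. g q (coord_vec A d q w) (coord_vec A d q z)) =
      fderiv (\<lambda>y. G y w z) (cmap d p) u"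
  proof -
    have "((\<lambda>q. g q (coord_vec A d q w) (coord_vec A d q z)) \<circ> cinv d) = (\<lambda>y. G y w z)"
      by (simp add: G_def comp_def)
    then have "(((\<lambda>q. g q (coord_vec A d q w) (coord_vec A d q z)) \<circ> cinv d) has_derivative
        fderiv (\<lambda>y. G y w z) (cmap d p)) (at (cmap d p))"
      using smooth_onD[OF metric_smooth[OF d(1)] cmap_in_crange[OF A d(2)], of w z] by (simp add: G_def)
    from tderiv_chart[OF A d coord_vec_in_tspace[OF A d] this] show ?thesis by (simp add: coord_vec_at[OF A d])
  qed
  ultimately show ?thesis by (simp add: cov_coord_eq[OF d] G_def cinv_cmap[OF A d])
qed

lemma phi_derivative_coord:
  assumes d: "d \<in> A" "p \<in> cdom d"
  defines "X \<equiv> coord_vec A d p"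
  shows "fderiv (\<lambda>y. \<phi> (cinv d y) (coord_vec A d (cinv d y) w) d) (cmap d p) u + \<Gamma> d p u (\<phi> p (X w) d) -
      \<phi> p (X (\<Gamma> d p u w)) d =
    (- (g p (\<phi> p (X u)) (\<phi> p (X w)) *\<^sub>R \<xi> p) - (\<epsilon> * \<eta> p (X w)) *\<^sub>R \<phi> p (\<phi> p (X u))) d"
proof -
  let ?X = "\<lambda>q. coord_vec A d q u" and ?Y = "\<lambda>q. coord_vec A d q w"
  have "cov A \<Gamma> ?X (\<lambda>q. \<phi> q (?Y q)) p - \<phi> p (cov A \<Gamma> ?X ?Y p) =
          - (g p (\<phi> p (?X p)) (\<phi> p (?Y p)) *\<^sub>R \<xi> p) - (\<epsilon> * \<eta> p (?Y p)) *\<^sub>R \<phi> p (\<phi> p (?X p))"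
    using P chart_open[OF A d(1)] coord_field_smooth[OF A d(1)] d(2)
    unfolding para_sasakian_def by blast
  then have "(cov A \<Gamma> ?X (\<lambda>q. \<phi> q (?Y q)) p - \<phi> p (cov A \<Gamma> ?X ?Y p)) d =
          (- (g p (\<phi> p (?X p)) (\<phi> p (?Y p)) *\<^sub>R \<xi> p) - (\<epsilon> * \<eta> p (?Y p)) *\<^sub>R \<phi> p (\<phi> p (?X p))) d" by simp
  moreover have "cov A \<Gamma> ?X (\<lambda>q. \<phi> q (?Y q)) p d =
      fderiv (\<lambda>y. \<phi> (cinv d y) (coord_vec A d (cinv d y) w) d) (cmap d p) u + \<Gamma> d p u (\<phi> p (X w) d)"
  proof -
    have "(((\<lambda>q. \<phi> q (?Y q) d) \<circ> cinv d) has_derivative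
        fderiv (\<lambda>y. \<phi> (cinv d y) (coord_vec A d (cinv d y) w) d) (cmap d p)) (at (cmap d p))"
      using smooth_onD[OF phi_smooth[OF d(1)] cmap_in_crange[OF A d(2)], of w] by (simp add: comp_def)
    from tderiv_chart[OF A d coord_vec_in_tspace[OF A d] this] show ?thesis
      by (simp add: cov_def cov_along_def d tmap_id[OF A coord_vec_in_tspace[OF A d]] coord_vec_at[OF A d] X_def)
  qed
  ultimately show ?thesis by (simp add: cov_coord_eq[OF d] X_def)
qed

lemma phi_at_chart:
  assumes "d \<in> A" "q \<in> cdom d" "v \<in> tspace A q"
  shows "\<phi> (cinv d (cmap d q)) (coord_vec A d (cinv d (cmap d q)) (v d)) d = \<phi> q v d"
  by (simp add: cinv_cmap[OF A assms(1,2)] coord_vec_of_components[OF A assms(3,1,2)])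

lemma phi_coord_linear:
  assumes "d \<in> A" "y \<in> crange d"
  shows "linear (\<lambda>u. \<phi> (cinv d y) (coord_vec A d (cinv d y) u) d)"
proof -
  have lin: "linear (\<lambda>u. \<phi> (cinv d y) (coord_vec A d (cinv d y) u))"
    by (rule linear_on_coord_vec[OF A assms(1) cinv_in_cdom[OF A assms] phi_linear])
  show ?thesis
    by (rule linearI) (simp_all add: linear_add[OF lin] linear_cmul[OF lin] tvec_scaleR_apply)
qed

lemma metric_coord_linear:
  assumes "d \<in> A" "y \<in> crange d"
  shows "linear (\<lambda>w. g (cinv d y) (coord_vec A d (cinv d y) u) (coord_vec A d (cinv d y) w))"
    and "linear (\<lambda>u. g (cinv d y) (coord_vec A d (cinv d y) u) (coord_vec A d (cinv d y) w))"
proof -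
  note q = cinv_in_cdom[OF A assms]
  show "linear (\<lambda>w. g (cinv d y) (coord_vec A d (cinv d y) u) (coord_vec A d (cinv d y) w))"
    by (rule linear_on_coord_vec[OF A assms(1) q metric_linear[OF coord_vec_in_tspace[OF A assms(1) q]]])
  show "linear (\<lambda>u. g (cinv d y) (coord_vec A d (cinv d y) u) (coord_vec A d (cinv d y) w))"
    by (rule linear_on_coord_vec[OF A assms(1) q metric_linear_left[OF coord_vec_in_tspace[OF A assms(1) q]]])
qed

context
  fixes B :: "('b::{t2_space,second_countable_topology}, 'f::euclidean_space) chart set"
    and f :: "'b \<Rightarrow> 'a" and U :: "'b set"
  assumes B: "smooth_manifold B" and U: "open U" and f: "smooth_map_on B A U f"
begin

lemma pullback_has_derivative:
  assumes "c \<in> B" "d \<in> A" "p \<in> U" "p \<in> cdom c" "f p \<in> cdom d" "smooth_on (crange d) T"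
  shows "((\<lambda>x. T ((cmap d \<circ> f \<circ> cinv c) x)) has_derivative
    (\<lambda>h. fderiv T (cmap d (f p)) (fderiv (cmap d \<circ> f \<circ> cinv c) (cmap c p) h))) (at (cmap c p))"
proof (rule has_derivative_compose[OF smooth_map_has_derivative[OF A B U f assms(1-5)]])
  show "(T has_derivative fderiv T (cmap d (f p))) (at ((cmap d \<circ> f \<circ> cinv c) (cmap c p)))"
    using smooth_onD[OF assms(6) cmap_in_crange[OF A assms(5)]] cinv_cmap[OF B assms(1,4)] by simp
qed

lemma pullback_smooth:
  assumes "c \<in> B" "d \<in> A" "smooth_on (crange d) T"
  shows "smooth_on (cmap c ` {q \<in> cdom c \<inter> U. f q \<in> cdom d}) (\<lambda>x. T ((cmap d \<circ> f \<circ> cinv c) x))"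
proof (rule smooth_on_compose[OF _ crange_open[OF A assms(2)] _ smooth_map_chart[OF A B U f assms(1,2)] assms(3)])
  show "open (cmap c ` {q \<in> cdom c \<inter> U. f q \<in> cdom d})"
    by (rule open_chart_preimage(2)[OF A B assms(1,2) U smooth_map_continuous[OF A B U f]])
  show "(cmap d \<circ> f \<circ> cinv c) ` (cmap c ` {q \<in> cdom c \<inter> U. f q \<in> cdom d}) \<subseteq> crange d"
    using cinv_cmap[OF B assms(1)] by (auto simp: crange_def)
qed

lemma along_smooth_in: "smooth_along B A f U W \<Longrightarrow> q \<in> U \<Longrightarrow> W q \<in> tspace A (f q)"
  unfolding smooth_along_def by blast

lemma smooth_along_phi:
  assumes W: "smooth_along B A f U W"
  shows "smooth_along B A f U (\<lambda>q. \<phi> (f q) (W q))"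
  unfolding smooth_along_def
proof (intro conjI ballI)
  show "\<phi> (f q) (W q) \<in> tspace A (f q)" if "q \<in> U" for q by (intro phi_in along_smooth_in[OF W] that)
  fix c d assume c: "c \<in> B" and d: "d \<in> A"
  let ?O = "cmap c ` {q \<in> cdom c \<inter> U. f q \<in> cdom d}" and ?i = "cmap d \<circ> f \<circ> cinv c"
  let ?F = "\<lambda>y u. \<phi> (cinv d y) (coord_vec A d (cinv d y) u) d"
  have O: "open ?O" by (rule open_chart_preimage(2)[OF A B c d U smooth_map_continuous[OF A B U f]])
  have "smooth_on ?O (\<lambda>x. ?F (?i x) (W (cinv c x) d))"
  proof (rule smooth_on_linear_family[where F="\<lambda>x. ?F (?i x)" and w="\<lambda>x. W (cinv c x) d", OF O])
    show "linear (?F (?i x))" if "x \<in> ?O" for x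
      by (rule phi_coord_linear[OF d]) (use that cinv_cmap[OF B c] in \<open>auto simp: crange_def\<close>)
    show "smooth_on ?O (\<lambda>x. ?F (?i x) u)" for u by (rule pullback_smooth[OF c d phi_smooth[OF d]])
    show "smooth_on ?O (\<lambda>x. W (cinv c x) d)" by (rule smooth_along_components[OF A B U f W c d])
  qed
  moreover have "?F (?i x) (W (cinv c x) d) = \<phi> (f (cinv c x)) (W (cinv c x)) d" if "x \<in> ?O" for x
  proof -
    obtain q where q: "q \<in> cdom c" "q \<in> U" "f q \<in> cdom d" "x = cmap c q" using \<open>x \<in> ?O\<close> by auto
    then have "cinv c x = q" using cinv_cmap[OF B c q(1)] by simp
    then show ?thesis using phi_at_chart[OF d q(3) along_smooth_in[OF W q(2)]] by simp
  qed
  ultimately show "smooth_on ?O (\<lambda>x. \<phi> (f (cinv c x)) (W (cinv c x)) d)"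
    using smooth_on_cong[OF O, of "\<lambda>x. ?F (?i x) (W (cinv c x) d)" "\<lambda>x. \<phi> (f (cinv c x)) (W (cinv c x)) d"] by simp
qed

text \<open>The defining identity of para Sasakian manifolds is tensorial, so it carries over to fields along a map:
  in a chart, the identity for coordinate fields is supplemented by the derivative of the components of
  \<open>W\<close>, which \<open>\<phi>\<close> commutes with by linearity.\<close>

lemma cov_along_phi:
  assumes W: "smooth_along B A f U W" and p: "p \<in> U" and v: "v \<in> tspace B p"
  defines "X \<equiv> tmap B A f p v"
  shows "cov_along B A \<Gamma> f p v (\<lambda>q. \<phi> (f q) (W q)) = \<phi> (f p) (cov_along B A \<Gamma> f p v W)
    - g (f p) (\<phi> (f p) X) (\<phi> (f p) (W p)) *\<^sub>R \<xi> (f p) - (\<epsilon> * \<eta> (f p) (W p)) *\<^sub>R \<phi> (f p) (\<phi> (f p) X)"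
proof -
  obtain c where c: "c \<in> B" "p \<in> cdom c" using ex_chart[OF B] by blast
  obtain d where d: "d \<in> A" "f p \<in> cdom d" using ex_chart[OF A] by blast
  note s = subspace_tspace[OF A, of "f p"]
  have X: "X \<in> tspace A (f p)" unfolding X_def by (rule tmap_in_tspace[OF A B U f p v])
  have Wp: "W p \<in> tspace A (f p)" by (rule along_smooth_in[OF W p])
  have cW: "cov_along B A \<Gamma> f p v W \<in> tspace A (f p)"
    by (rule cov_along_in_tspace[OF A B U f W linear_connection p v])
  have cP: "cov_along B A \<Gamma> f p v (\<lambda>q. \<phi> (f q) (W q)) \<in> tspace A (f p)"
    by (rule cov_along_in_tspace[OF A B U f smooth_along_phi[OF W] linear_connection p v])
  let ?x = "cmap c p" and ?i = "cmap d \<circ> f \<circ> cinv c" and ?w = "\<lambda>x. W (cinv c x) d"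
  let ?F = "\<lambda>y u. \<phi> (cinv d y) (coord_vec A d (cinv d y) u) d"
  let ?O = "cmap c ` {q \<in> cdom c \<inter> U. f q \<in> cdom d}"
  have O: "open ?O" by (rule open_chart_preimage(2)[OF A B c(1) d(1) U smooth_map_continuous[OF A B U f]])
  have x: "?x \<in> ?O" using c d p by auto
  have cx: "cinv c ?x = p" by (rule cinv_cmap[OF B c])
  note pd = pullback_has_derivative[OF c(1) d(1) p c(2) d(2)]
  note wd = along_has_derivative[OF A B U f W c(1) d(1) p c(2) d(2)]
  have "((\<lambda>x. ?F (?i x) (?w x)) has_derivative
      (\<lambda>h. fderiv (\<lambda>x. ?F (?i x) (?w ?x)) ?x h + ?F (?i ?x) (fderiv ?w ?x h))) (at ?x)"
  proof (rule has_derivative_linear_family[where F="\<lambda>x. ?F (?i x)" and w="?w", OF O x])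
    show "linear (?F (?i x))" if "x \<in> ?O" for x
      by (rule phi_coord_linear[OF d(1)]) (use that cinv_cmap[OF B c(1)] in \<open>auto simp: crange_def\<close>)
    show "(\<lambda>x. ?F (?i x) u) differentiable at ?x" for u
      using pd[OF phi_smooth[OF d(1), of u]] differentiable_def by blast
    show "(?w has_derivative fderiv ?w ?x) (at ?x)" by (rule wd)
  qed
  moreover have "?F (?i x) (?w x) = \<phi> (f (cinv c x)) (W (cinv c x)) d" if "x \<in> ?O" for x
  proof -
    obtain q where q: "q \<in> cdom c" "q \<in> U" "f q \<in> cdom d" "x = cmap c q" using \<open>x \<in> ?O\<close> by auto
    then have "cinv c x = q" using cinv_cmap[OF B c(1) q(1)] by simp
    then show ?thesis using phi_at_chart[OF d(1) q(3) along_smooth_in[OF W q(2)]] by simp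
  qed
  ultimately have "((\<lambda>x. \<phi> (f (cinv c x)) (W (cinv c x)) d) has_derivative
      (\<lambda>h. fderiv (\<lambda>x. ?F (?i x) (?w ?x)) ?x h + ?F (?i ?x) (fderiv ?w ?x h))) (at ?x)"
    by (rule has_derivative_transform_within_open[OF _ O x])
  from fderiv_eq[OF this] have D: "fderiv (\<lambda>x. \<phi> (f (cinv c x)) (W (cinv c x)) d) ?x (v c) =
      fderiv (\<lambda>y. ?F y (W p d)) (cmap d (f p)) (X d) + \<phi> (f p) (coord_vec A d (f p) (fderiv ?w ?x (v c))) d"
    unfolding fderiv_eq[OF pd[OF phi_smooth[OF d(1)]]] X_def tmap_chart[OF A B U f c(1) d(1) p c(2) d(2) v]
    by (simp add: cx cinv_cmap[OF A d])
  note cv = coord_vec_of_components[OF A _ d]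
  have "coord_vec A d (f p) (fderiv ?w ?x (v c) + \<Gamma> d (f p) (X d) (W p d)) = cov_along B A \<Gamma> f p v W"
    using cv[OF cW] unfolding cov_along_chart[OF A B U f W c(1) d(1) p c(2) d(2) v] X_def .
  then have "\<phi> (f p) (cov_along B A \<Gamma> f p v W) = \<phi> (f p) (coord_vec A d (f p) (fderiv ?w ?x (v c)) +
      coord_vec A d (f p) (\<Gamma> d (f p) (X d) (W p d)))"
    unfolding linear_add[OF linear_coord_vec[OF A d]] by simp
  also have "\<dots> = \<phi> (f p) (coord_vec A d (f p) (fderiv ?w ?x (v c))) +
      \<phi> (f p) (coord_vec A d (f p) (\<Gamma> d (f p) (X d) (W p d)))"
    by (rule linear_on_add[OF phi_linear coord_vec_in_tspace[OF A d] coord_vec_in_tspace[OF A d]])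
  finally have F: "\<phi> (f p) (cov_along B A \<Gamma> f p v W) d = \<phi> (f p) (coord_vec A d (f p) (fderiv ?w ?x (v c))) d +
      \<phi> (f p) (coord_vec A d (f p) (\<Gamma> d (f p) (X d) (W p d))) d" by simp
  show ?thesis
  proof (rule tspace_eqI[OF A cP _ d])
    show "\<phi> (f p) (cov_along B A \<Gamma> f p v W) - g (f p) (\<phi> (f p) X) (\<phi> (f p) (W p)) *\<^sub>R \<xi> (f p)
      - (\<epsilon> * \<eta> (f p) (W p)) *\<^sub>R \<phi> (f p) (\<phi> (f p) X) \<in> tspace A (f p)"
      by (intro subspace_diff[OF s] subspace_scale[OF s] phi_in cW X xi_in)
    show "cov_along B A \<Gamma> f p v (\<lambda>q. \<phi> (f q) (W q)) d = (\<phi> (f p) (cov_along B A \<Gamma> f p v W)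
      - g (f p) (\<phi> (f p) X) (\<phi> (f p) (W p)) *\<^sub>R \<xi> (f p) - (\<epsilon> * \<eta> (f p) (W p)) *\<^sub>R \<phi> (f p) (\<phi> (f p) X)) d"
      using phi_derivative_coord[OF d, of "W p d" "X d"]
      unfolding cov_along_chart[OF A B U f smooth_along_phi[OF W] c(1) d(1) p c(2) d(2) v] D cv[OF X] cv[OF Wp]
        X_def[symmetric] minus_apply F
      by (simp add: F algebra_simps)
  qed
qed

text \<open>Metric compatibility for vector fields along a map. The product \<open>g W Z\<close> depends on the point through the
  metric and through both fields, and the derivative of the metric coefficients is supplied by
  \<open>metric_derivative_coord\<close>.\<close>

context
  fixes W Z c d
  assumes W: "smooth_along B A f U W" and Z: "smooth_along B A f U Z" and c: "c \<in> B" and d: "d \<in> A"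
begin

lemma metric_along_chart:
  assumes "x \<in> cmap c ` {q \<in> cdom c \<inter> U. f q \<in> cdom d}"
  shows "g (cinv d ((cmap d \<circ> f \<circ> cinv c) x)) (coord_vec A d (cinv d ((cmap d \<circ> f \<circ> cinv c) x)) (W (cinv c x) d))
      (coord_vec A d (cinv d ((cmap d \<circ> f \<circ> cinv c) x)) (Z (cinv c x) d)) =
    g (f (cinv c x)) (W (cinv c x)) (Z (cinv c x))"
proof -
  obtain q where q: "q \<in> cdom c" "q \<in> U" "f q \<in> cdom d" "x = cmap c q" using assms by auto
  then have "cinv c x = q" using cinv_cmap[OF B c q(1)] by simp
  then show ?thesis
    by (simp add: cinv_cmap[OF A d q(3)] coord_vec_of_components[OF A along_smooth_in[OF W q(2)] d q(3)]
        coord_vec_of_components[OF A along_smooth_in[OF Z q(2)] d q(3)])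
qed

lemma metric_along_derivative:
  assumes p: "p \<in> U" "p \<in> cdom c" "f p \<in> cdom d" and v: "v \<in> tspace B p"
  shows "fderiv (\<lambda>x. g (f (cinv c x)) (W (cinv c x)) (Z (cinv c x))) (cmap c p) (v c) =
    g (f p) (cov_along B A \<Gamma> f p v W) (Z p) + g (f p) (W p) (cov_along B A \<Gamma> f p v Z)"
proof -
  let ?O = "cmap c ` {q \<in> cdom c \<inter> U. f q \<in> cdom d}" and ?i = "cmap d \<circ> f \<circ> cinv c" and ?x = "cmap c p"
  let ?G = "\<lambda>y u w. g (cinv d y) (coord_vec A d (cinv d y) u) (coord_vec A d (cinv d y) w)"
  let ?w = "\<lambda>x. W (cinv c x) d" and ?z = "\<lambda>x. Z (cinv c x) d"
  let ?X = "coord_vec A d (f p)"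
  have O: "open ?O" by (rule open_chart_preimage(2)[OF A B c d U smooth_map_continuous[OF A B U f]])
  have x: "?x \<in> ?O" using p by auto
  have cx: "cinv c ?x = p" by (rule cinv_cmap[OF B c p(2)])
  have i: "?i x \<in> crange d" if "x \<in> ?O" for x using that cinv_cmap[OF B c] by (auto simp: crange_def)
  note pd = pullback_has_derivative[OF c d p(1) p(2) p(3) metric_smooth[OF d]]
  have pdd: "(\<lambda>x. ?G (?i x) u w) differentiable (at ?x)" for u w using pd differentiable_def by blast
  have dz: "((\<lambda>x. ?G (?i x) u (?z x)) has_derivative
      (\<lambda>h. fderiv (\<lambda>x. ?G (?i x) u (?z ?x)) ?x h + ?G (?i ?x) u (fderiv ?z ?x h))) (at ?x)" for u
    by (rule has_derivative_linear_family[where F="\<lambda>x. ?G (?i x) u" and w="?z",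
          OF O x metric_coord_linear(1)[OF d i] pdd along_has_derivative[OF A B U f Z c d p]])
  then have dzd: "(\<lambda>x. ?G (?i x) u (?z x)) differentiable (at ?x)" for u using differentiable_def by blast
  have "((\<lambda>x. ?G (?i x) (?w x) (?z x)) has_derivative
      (\<lambda>h. fderiv (\<lambda>x. ?G (?i x) (?w ?x) (?z x)) ?x h + ?G (?i ?x) (fderiv ?w ?x h) (?z ?x))) (at ?x)"
    by (rule has_derivative_linear_family[where F="\<lambda>x u. ?G (?i x) u (?z x)" and w="?w",
          OF O x metric_coord_linear(2)[OF d i] dzd along_has_derivative[OF A B U f W c d p]])
  then have "((\<lambda>x. g (f (cinv c x)) (W (cinv c x)) (Z (cinv c x))) has_derivative
      (\<lambda>h. fderiv (\<lambda>x. ?G (?i x) (?w ?x) (?z x)) ?x h + ?G (?i ?x) (fderiv ?w ?x h) (?z ?x))) (at ?x)"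
    by (rule has_derivative_transform_within_open[OF _ O x metric_along_chart])
  from fderiv_eq[OF this] have e1: "fderiv (\<lambda>x. g (f (cinv c x)) (W (cinv c x)) (Z (cinv c x))) ?x (v c) =
      fderiv (\<lambda>y. ?G y (W p d) (Z p d)) (cmap d (f p)) (tmap B A f p v d)
      + g (f p) (?X (W p d)) (?X (fderiv ?z ?x (v c))) + g (f p) (?X (fderiv ?w ?x (v c))) (?X (Z p d))"
    unfolding fderiv_eq[OF dz] fderiv_eq[OF pd] tmap_chart[OF A B U f c d p v]
    by (simp add: cx cinv_cmap[OF A d p(3)])
  have e2: "fderiv (\<lambda>y. ?G y (W p d) (Z p d)) (cmap d (f p)) (tmap B A f p v d) =
      g (f p) (?X (\<Gamma> d (f p) (tmap B A f p v d) (W p d))) (?X (Z p d)) +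
      g (f p) (?X (W p d)) (?X (\<Gamma> d (f p) (tmap B A f p v d) (Z p d)))"
    using metric_derivative_coord[OF d p(3), of "W p d" "Z p d" "tmap B A f p v d"]
    by (simp add: cinv_cmap[OF A d p(3)])
  have cov: "cov_along B A \<Gamma> f p v Y =
      ?X (fderiv (\<lambda>x. Y (cinv c x) d) ?x (v c)) + ?X (\<Gamma> d (f p) (tmap B A f p v d) (Y p d))"
    if Y: "smooth_along B A f U Y" for Y
    unfolding linear_add[OF linear_coord_vec[OF A d p(3)], symmetric] cov_along_chart[OF A B U f Y c d p v, symmetric]
    by (rule coord_vec_of_components[OF A cov_along_in_tspace[OF A B U f Y linear_connection p(1) v] d p(3), symmetric])
  note Wp = along_smooth_in[OF W p(1)] and Zp = along_smooth_in[OF Z p(1)] and in_X = coord_vec_in_tspace[OF A d p(3)]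
  have XW: "?X (W p d) = W p" and XZ: "?X (Z p d) = Z p"
    by (rule coord_vec_of_components[OF A Wp d p(3)] coord_vec_of_components[OF A Zp d p(3)])+
  have "g (f p) (cov_along B A \<Gamma> f p v W) (Z p) = g (f p) (?X (fderiv ?w ?x (v c))) (Z p) +
      g (f p) (?X (\<Gamma> d (f p) (tmap B A f p v d) (W p d))) (Z p)"
    unfolding cov[OF W] by (rule linear_on_add[OF metric_linear_left[OF Zp] in_X in_X])
  moreover have "g (f p) (W p) (cov_along B A \<Gamma> f p v Z) = g (f p) (W p) (?X (fderiv ?z ?x (v c))) +
      g (f p) (W p) (?X (\<Gamma> d (f p) (tmap B A f p v d) (Z p d)))"
    unfolding cov[OF Z] by (rule linear_on_add[OF metric_linear[OF Wp] in_X in_X])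
  ultimately show ?thesis using e1 e2 unfolding XW XZ by linarith
qed

end

lemma smooth_along_xi: "smooth_along B A f U (\<lambda>q. \<xi> (f q))"
  unfolding smooth_along_def
proof (intro conjI ballI xi_in)
  fix c d assume c: "c \<in> B" and d: "d \<in> A"
  let ?O = "cmap c ` {q \<in> cdom c \<inter> U. f q \<in> cdom d}" and ?i = "cmap d \<circ> f \<circ> cinv c"
  have O: "open ?O" by (rule open_chart_preimage(2)[OF A B c d U smooth_map_continuous[OF A B U f]])
  have "smooth_on (cmap d ` {q \<in> cdom d \<inter> UNIV. id q \<in> cdom d}) (\<lambda>y. \<xi> (cinv d y) d)"
    using xi_vf d unfolding smooth_along_def by blast
  then have "smooth_on (crange d) (\<lambda>y. \<xi> (cinv d y) d)" by (simp add: crange_def)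
  note sm = pullback_smooth[OF c d this]
  have eq: "\<xi> (cinv d (?i x)) d = \<xi> (f (cinv c x)) d" if "x \<in> ?O" for x
    using that cinv_cmap[OF B c] cinv_cmap[OF A d] by auto
  show "smooth_on ?O (\<lambda>x. \<xi> (f (cinv c x)) d)"
    by (rule smooth_on_cong[OF O, THEN iffD1, OF _ sm]) (rule eq)
qed

text \<open>Applying \<open>cov_along_phi\<close> to \<open>\<phi> \<xi> = 0\<close> determines the covariant derivative of \<open>\<xi>\<close> up to a multiple of
  \<open>\<xi>\<close>, which vanishes because \<open>\<xi>\<close> has constant length.\<close>

lemma cov_along_xi:
  assumes p: "p \<in> U" and v: "v \<in> tspace B p"
  shows "cov_along B A \<Gamma> f p v (\<lambda>q. \<xi> (f q)) = \<epsilon> *\<^sub>R \<phi> (f p) (tmap B A f p v)"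
proof -
  obtain c where c: "c \<in> B" "p \<in> cdom c" using ex_chart[OF B] by blast
  obtain d where d: "d \<in> A" "f p \<in> cdom d" using ex_chart[OF A] by blast
  let ?C = "cov_along B A \<Gamma> f p v (\<lambda>q. \<xi> (f q))" and ?X = "tmap B A f p v"
  note s = subspace_tspace[OF A, of "f p"]
  have X: "?X \<in> tspace A (f p)" by (rule tmap_in_tspace[OF A B U f p v])
  have C: "?C \<in> tspace A (f p)" by (rule cov_along_in_tspace[OF A B U f smooth_along_xi linear_connection p v])
  have z: "cov_along B A \<Gamma> f p v (\<lambda>q. \<phi> (f q) (\<xi> (f q))) = 0"
  proof (rule tspace_eqI[OF A _ subspace_0[OF s] d])
    show "cov_along B A \<Gamma> f p v (\<lambda>q. \<phi> (f q) (\<xi> (f q))) \<in> tspace A (f p)"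
      by (rule cov_along_in_tspace[OF A B U f smooth_along_phi[OF smooth_along_xi] linear_connection p v])
    note linear_0[OF christoffel_linear[OF d, of "?X d"]]
    then show "cov_along B A \<Gamma> f p v (\<lambda>q. \<phi> (f q) (\<xi> (f q))) d = 0 d"
      using cov_along_chart[OF A B U f smooth_along_phi[OF smooth_along_xi] c(1) d(1) p c(2) d(2) v, of \<Gamma>]
      unfolding phi_xi by simp
  qed
  have "g (f p) (\<phi> (f p) ?X) (\<phi> (f p) (\<xi> (f p))) = 0"
    using linear_on_zero[OF metric_linear[OF phi_in[OF X]] s] by (simp add: phi_xi)
  then have 1: "\<phi> (f p) ?C = \<epsilon> *\<^sub>R \<phi> (f p) (\<phi> (f p) ?X)"
    using cov_along_phi[OF smooth_along_xi p v] unfolding z by (simp add: eta_xi)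
  have "\<phi> (f p) (\<phi> (f p) ?C) = \<epsilon> *\<^sub>R \<phi> (f p) (\<phi> (f p) (\<phi> (f p) ?X))"
    unfolding 1 by (rule linear_on_scale[OF phi_linear]) (intro phi_in X)
  then have 2: "?C - \<eta> (f p) ?C *\<^sub>R \<xi> (f p) = \<epsilon> *\<^sub>R \<phi> (f p) ?X"
    by (simp add: phi_phi[OF C] phi_phi[OF phi_in[OF X]] eta_phi[OF X])
  have "fderiv (\<lambda>x. g (f (cinv c x)) (\<xi> (f (cinv c x))) (\<xi> (f (cinv c x)))) (cmap c p) (v c) =
      g (f p) ?C (\<xi> (f p)) + g (f p) (\<xi> (f p)) ?C"
    by (rule metric_along_derivative[OF smooth_along_xi smooth_along_xi c(1) d(1) p c(2) d(2) v])
  moreover have "(\<lambda>x. g (f (cinv c x)) (\<xi> (f (cinv c x))) (\<xi> (f (cinv c x)))) = (\<lambda>x. \<epsilon>)"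
    by (simp add: metric_xi[OF xi_in] eta_xi)
  ultimately have "\<epsilon> * \<eta> (f p) ?C = 0"
    using metric_sym[OF xi_in C] metric_xi[OF C] by simp
  then have "\<eta> (f p) ?C = 0" using epsilon by auto
  with 2 show ?thesis by simp
qed

end

end

section \<open>Lightlike hypersurfaces\<close>

lemma span_pair: "v \<in> span {a, b} \<longleftrightarrow> (\<exists>\<alpha> \<beta>. v = \<alpha> *\<^sub>R a + \<beta> *\<^sub>R b)"
proof
  assume "v \<in> span {a, b}"
  then obtain \<alpha> \<beta> where "v - \<alpha> *\<^sub>R a = \<beta> *\<^sub>R b" unfolding span_insert[of a] span_singleton by blast
  then have "v = \<alpha> *\<^sub>R a + \<beta> *\<^sub>R b" by (simp add: diff_eq_eq add.commute)
  then show "\<exists>\<alpha> \<beta>. v = \<alpha> *\<^sub>R a + \<beta> *\<^sub>R b" by blast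
next
  assume "\<exists>\<alpha> \<beta>. v = \<alpha> *\<^sub>R a + \<beta> *\<^sub>R b"
  then show "v \<in> span {a, b}" by (auto intro!: span_add span_scale intro: span_base)
qed

lemma hyperplane_complement:
  fixes D :: "'f::euclidean_space \<Rightarrow> 'e::euclidean_space"
  assumes "linear D" "inj D" "DIM('f) + 1 = DIM('e)" "N \<notin> range D"
  shows "\<exists>t k. u = D t + k *\<^sub>R N"
proof -
  have s: "subspace (range D)" using linear_subspace_image[OF assms(1) subspace_UNIV] .
  then have sp: "span (range D) = range D" by (rule span_eq_iff[THEN iffD2])
  have "dim (range D) = DIM('f)"
    using eucl.dim_image_eq[OF assms(1), of UNIV] assms(2) by (simp add: dim_UNIV)
  moreover have "N \<notin> span (range D)" unfolding sp by (rule assms(4))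
  ultimately have "dim (insert N (range D)) = DIM('e)" using assms(3) by (simp add: dim_insert)
  then have "u \<in> span (insert N (range D))" using dim_eq_full by blast
  then obtain k where "u - k *\<^sub>R N \<in> range D" unfolding span_breakdown_eq sp by blast
  then obtain t where "u - k *\<^sub>R N = D t" by blast
  then show ?thesis by (metis diff_add_cancel)
qed

context
  fixes A :: "('a::{t2_space,second_countable_topology}, 'e::euclidean_space) chart set"
    and B :: "('b::{t2_space,second_countable_topology}, 'f::euclidean_space) chart set"
    and \<iota> :: "'b \<Rightarrow> 'a" and \<phi> \<xi> \<eta> g \<epsilon> \<Gamma> S
  assumes A: "smooth_manifold A" and P: "para_sasakian A \<phi> \<xi> \<eta> g \<epsilon> \<Gamma>"
    and L: "lightlike_hypersurface B A \<iota> g" and Sc: "screen_distribution B A \<iota> g S"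
begin

lemma hyp_manifold: "smooth_manifold B" and codim: "DIM('f) + 1 = DIM('e)"
  and smooth_iota: "smooth_map_on B A UNIV \<iota>" and tmap_inj: "inj_on (tmap B A \<iota> p) (tspace B p)"
  and radical_nontrivial: "radical B A \<iota> g p \<noteq> {0}"
  using L unfolding lightlike_hypersurface_def immersion_def by simp_all

lemma smooth_iota_on: "smooth_map_on B A U \<iota>"
  unfolding smooth_map_on_def
proof (intro conjI ballI)
  show "continuous_on U \<iota>"
    by (rule continuous_on_subset[OF smooth_map_continuous[OF A hyp_manifold open_UNIV smooth_iota]]) simp
  fix c d assume "c \<in> B" "d \<in> A"
  then show "smooth_on (cmap c ` {q \<in> cdom c \<inter> U. \<iota> q \<in> cdom d}) (cmap d \<circ> \<iota> \<circ> cinv c)"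
    by (rule smooth_on_subset[OF smooth_map_chart[OF A hyp_manifold open_UNIV smooth_iota]]) auto
qed

lemma tmap_in: "v \<in> tspace B p \<Longrightarrow> tmap B A \<iota> p v \<in> tspace A (\<iota> p)"
  by (rule tmap_in_tspace[OF A hyp_manifold open_UNIV smooth_iota UNIV_I])

lemma tmap_linear: "linear_on (tspace B p) (tmap B A \<iota> p)"
  by (rule linear_on_tmap[OF A hyp_manifold open_UNIV smooth_iota UNIV_I])

lemma tmap_components:
  "c \<in> B \<Longrightarrow> d \<in> A \<Longrightarrow> p \<in> cdom c \<Longrightarrow> \<iota> p \<in> cdom d \<Longrightarrow> v \<in> tspace B p \<Longrightarrow>
    tmap B A \<iota> p v d = fderiv (cmap d \<circ> \<iota> \<circ> cinv c) (cmap c p) (v c)"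
  by (rule tmap_chart[OF A hyp_manifold open_UNIV smooth_iota _ _ UNIV_I])

lemma hyp_tspace_sub: "hyp_tspace B A \<iota> p \<subseteq> tspace A (\<iota> p)"
  unfolding hyp_tspace_def using tmap_in by blast

lemma subspace_hyp_tspace: "subspace (hyp_tspace B A \<iota> p)"
  unfolding subspace_def hyp_tspace_def
proof (intro conjI ballI allI)
  note s = subspace_tspace[OF hyp_manifold, of p] and lin = tmap_linear[of p]
  show "0 \<in> tmap B A \<iota> p ` tspace B p"
    using linear_on_zero[OF lin s] subspace_0[OF s] by (metis image_eqI)
  show "v + w \<in> tmap B A \<iota> p ` tspace B p"
    if vw: "v \<in> tmap B A \<iota> p ` tspace B p" "w \<in> tmap B A \<iota> p ` tspace B p" for v w
  proof -
    obtain v' w' where v': "v' \<in> tspace B p" "w' \<in> tspace B p" "v = tmap B A \<iota> p v'" "w = tmap B A \<iota> p w'"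
      using vw by blast
    have "tmap B A \<iota> p (v' + w') = v + w" unfolding v'(3,4) by (rule linear_on_add[OF lin v'(1,2)])
    from this[symmetric] show ?thesis by (rule image_eqI[OF _ subspace_add[OF s v'(1,2)]])
  qed
  show "r *\<^sub>R v \<in> tmap B A \<iota> p ` tspace B p" if v: "v \<in> tmap B A \<iota> p ` tspace B p" for r v
  proof -
    obtain v' where v': "v' \<in> tspace B p" "v = tmap B A \<iota> p v'" using v by blast
    have "tmap B A \<iota> p (r *\<^sub>R v') = r *\<^sub>R v" unfolding v'(2) by (rule linear_on_scale[OF lin v'(1)])
    from this[symmetric] show ?thesis by (rule image_eqI[OF _ subspace_scale[OF s v'(1)]])
  qed
qed

lemma to_intrinsic:
  assumes "w \<in> hyp_tspace B A \<iota> p"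
  shows "to_intrinsic B A \<iota> p w \<in> tspace B p" "tmap B A \<iota> p (to_intrinsic B A \<iota> p w) = w"
  using the_inv_into_into[OF tmap_inj _ order_refl] f_the_inv_into_f[OF tmap_inj] assms
  unfolding to_intrinsic_def hyp_tspace_def by blast+

text \<open>Tangency to the hypersurface can be tested on components in one chart of the ambient space, which turns
  dimension counts into statements about Euclidean spaces.\<close>

lemma component_image_hyp_tspace:
  assumes c: "c \<in> B" "p \<in> cdom c" and d: "d \<in> A" "\<iota> p \<in> cdom d"
  defines "D \<equiv> fderiv (cmap d \<circ> \<iota> \<circ> cinv c) (cmap c p)"
  shows "linear D" "inj D" "v \<in> tspace A (\<iota> p) \<Longrightarrow> v d \<in> range D \<longleftrightarrow> v \<in> hyp_tspace B A \<iota> p"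
proof -
  show lin: "linear D"
    unfolding D_def
    by (rule has_derivative_linear[OF smooth_map_has_derivative[OF A hyp_manifold open_UNIV smooth_iota c(1) d(1) UNIV_I c(2) d(2)]])
  have D: "tmap B A \<iota> p (coord_vec B c p h) d = D h" for h
    unfolding D_def tmap_components[OF c(1) d(1) c(2) d(2) coord_vec_in_tspace[OF hyp_manifold c]] coord_vec_at[OF hyp_manifold c] ..
  note cB = coord_vec_in_tspace[OF hyp_manifold c] and sA = subspace_tspace[OF A, of "\<iota> p"] and sB = subspace_tspace[OF hyp_manifold, of p]
  show "inj D"
    unfolding linear_injective_0[OF lin]
  proof (intro allI impI)
    fix h assume "D h = 0"
    then have "tmap B A \<iota> p (coord_vec B c p h) d = 0 d" by (simp add: D)
    then have "tmap B A \<iota> p (coord_vec B c p h) = 0"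
      by (rule tspace_eqI[OF A tmap_in[OF cB] subspace_0[OF sA] d])
    also have "\<dots> = tmap B A \<iota> p 0" by (rule linear_on_zero[OF tmap_linear sB, symmetric])
    finally have "coord_vec B c p h = 0" by (rule inj_onD[OF tmap_inj _ cB subspace_0[OF sB]])
    then have "coord_vec B c p h c = 0 c" by simp
    then show "h = 0" by (simp add: coord_vec_at[OF hyp_manifold c])
  qed
  show "v d \<in> range D \<longleftrightarrow> v \<in> hyp_tspace B A \<iota> p" if v: "v \<in> tspace A (\<iota> p)"
  proof
    assume "v d \<in> range D"
    then obtain h where "v d = D h" by blast
    then have "v = tmap B A \<iota> p (coord_vec B c p h)"
      by (intro tspace_eqI[OF A v tmap_in[OF cB] d]) (simp add: D)
    then show "v \<in> hyp_tspace B A \<iota> p" unfolding hyp_tspace_def using cB by blast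
  next
    assume "v \<in> hyp_tspace B A \<iota> p"
    then obtain v' where "v' \<in> tspace B p" "v = tmap B A \<iota> p v'" unfolding hyp_tspace_def by blast
    then show "v d \<in> range D" using tmap_components[OF c(1) d(1) c(2) d(2)] unfolding D_def by blast
  qed
qed

lemma transversal_decomposition:
  assumes N: "N \<in> tspace A (\<iota> p)" "N \<notin> hyp_tspace B A \<iota> p" and v: "v \<in> tspace A (\<iota> p)"
  shows "\<exists>t\<in>hyp_tspace B A \<iota> p. \<exists>k. v = t + k *\<^sub>R N"
proof -
  obtain c where c: "c \<in> B" "p \<in> cdom c" using ex_chart[OF hyp_manifold] by blast
  obtain d where d: "d \<in> A" "\<iota> p \<in> cdom d" using ex_chart[OF A] by blast
  let ?D = "fderiv (cmap d \<circ> \<iota> \<circ> cinv c) (cmap c p)"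
  note comp = component_image_hyp_tspace[OF c d] and s = subspace_tspace[OF A, of "\<iota> p"]
  have "N d \<notin> range ?D" using comp(3)[OF N(1)] N(2) by blast
  from hyperplane_complement[OF comp(1,2) codim this, of "v d"]
  obtain h k where hk: "v d = ?D h + k *\<^sub>R N d" by blast
  have t: "v - k *\<^sub>R N \<in> tspace A (\<iota> p)" by (intro subspace_diff[OF s] subspace_scale[OF s] v N)
  have "(v - k *\<^sub>R N) d = ?D h" using hk by (simp add: tvec_scaleR_apply)
  then have "v - k *\<^sub>R N \<in> hyp_tspace B A \<iota> p" using comp(3)[OF t] by blast
  then show ?thesis by (intro bexI[of _ "v - k *\<^sub>R N"] exI[of _ k]) simp_all
qed

lemma radical_sub: "e \<in> radical B A \<iota> g p \<Longrightarrow> e \<in> hyp_tspace B A \<iota> p"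
  and radical_orthogonal: "e \<in> radical B A \<iota> g p \<Longrightarrow> t \<in> hyp_tspace B A \<iota> p \<Longrightarrow> g (\<iota> p) e t = 0"
  unfolding radical_def by blast+

lemma screen_radical_Int: "S p \<inter> radical B A \<iota> g p = {0}"
  and screen_radical_sum: "{s + r | s r. s \<in> S p \<and> r \<in> radical B A \<iota> g p} = hyp_tspace B A \<iota> p"
proof -
  note 1 = spec[OF conjunct2[OF Sc[unfolded screen_distribution_def]], of p]
  show "S p \<inter> radical B A \<iota> g p = {0}" by (rule conjunct1[OF 1])
  show "{s + r | s r. s \<in> S p \<and> r \<in> radical B A \<iota> g p} = hyp_tspace B A \<iota> p" by (rule conjunct2[OF 1])
qed

lemma screen_decomposition:
  assumes "t \<in> hyp_tspace B A \<iota> p"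
  obtains s r where "s \<in> S p" "r \<in> radical B A \<iota> g p" "t = s + r"
proof -
  have "t \<in> {s + r | s r. s \<in> S p \<and> r \<in> radical B A \<iota> g p}" unfolding screen_radical_sum by (rule assms)
  then show thesis by (elim CollectE exE conjE) (rule that)
qed

lemma screen_sub: "S p \<subseteq> hyp_tspace B A \<iota> p"
proof
  fix s assume s: "s \<in> S p"
  have "0 \<in> radical B A \<iota> g p" using screen_radical_Int[of p] by blast
  then have "s + 0 \<in> {s + r | s r. s \<in> S p \<and> r \<in> radical B A \<iota> g p}" using s by blast
  then show "s \<in> hyp_tspace B A \<iota> p" unfolding screen_radical_sum by simp
qed

lemma screen_radical: "v \<in> S p \<Longrightarrow> v \<in> radical B A \<iota> g p \<Longrightarrow> v = 0"
  using screen_radical_Int[of p] by blast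

lemmas g_right = metric_linear[OF A P]
lemmas g_left = metric_linear_left[OF A P]

lemma transversal_not_tangent:
  assumes "e \<in> radical B A \<iota> g p" "transversal_for A \<iota> g S p e N"
  shows "N \<in> tspace A (\<iota> p)" "N \<notin> hyp_tspace B A \<iota> p"
  using assms radical_orthogonal[OF assms(1), of N] unfolding transversal_for_def by auto

text \<open>The difference of the two sides is orthogonal to the hypersurface and to \<open>N\<close>, hence to everything.\<close>

lemma radical_rank_one:
  assumes E: "E \<in> radical B A \<iota> g p" and N: "transversal_for A \<iota> g S p E N" and e: "e \<in> radical B A \<iota> g p"
  shows "e = g (\<iota> p) e N *\<^sub>R E"
proof -
  note s = subspace_tspace[OF A, of "\<iota> p"]
  note Nt = transversal_not_tangent[OF E N]
  have in_t: "E \<in> tspace A (\<iota> p)" "e \<in> tspace A (\<iota> p)" using radical_sub[OF E] radical_sub[OF e] hyp_tspace_sub by blast+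
  define w where "w = e - g (\<iota> p) e N *\<^sub>R E"
  have w: "w \<in> tspace A (\<iota> p)" unfolding w_def by (intro subspace_diff[OF s] subspace_scale[OF s] in_t)
  have gw: "g (\<iota> p) w v = g (\<iota> p) e v - g (\<iota> p) e N * g (\<iota> p) E v" if v: "v \<in> tspace A (\<iota> p)" for v
    unfolding w_def
    by (simp add: linear_on_diff[OF g_left[OF v] s in_t(2) subspace_scale[OF s in_t(1)]] linear_on_scale[OF g_left[OF v] in_t(1)])
  have "w = 0"
  proof (rule metric_nondegenerate[OF A P w])
    fix v assume v: "v \<in> tspace A (\<iota> p)"
    obtain t k where t: "t \<in> hyp_tspace B A \<iota> p" "v = t + k *\<^sub>R N" using transversal_decomposition[OF Nt v] by blast
    have tt: "t \<in> tspace A (\<iota> p)" using t(1) hyp_tspace_sub by blast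
    have "g (\<iota> p) w t = 0" by (simp add: gw[OF tt] radical_orthogonal[OF E t(1)] radical_orthogonal[OF e t(1)])
    moreover have "g (\<iota> p) w N = 0" using N unfolding transversal_for_def by (simp add: gw[OF Nt(1)])
    ultimately show "g (\<iota> p) w v = 0"
      unfolding t(2)
      by (simp add: linear_on_add[OF g_right[OF w] tt subspace_scale[OF s Nt(1)]] linear_on_scale[OF g_right[OF w] Nt(1)])
  qed
  then show ?thesis by (simp add: w_def)
qed

text \<open>By orthogonality to the screen, \<open>w\<close> differs from a multiple of \<open>N\<close> by a radical vector, which vanishes since
  both are null.\<close>

lemma transversal_unique:
  assumes E: "E \<in> radical B A \<iota> g p" and N: "transversal_for A \<iota> g S p E N"
    and e: "e \<in> radical B A \<iota> g p" and w: "transversal_for A \<iota> g S p e w"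
  shows "w \<in> span {N}"
proof -
  note s = subspace_tspace[OF A, of "\<iota> p"]
  note Nt = transversal_not_tangent[OF E N] and wt = transversal_not_tangent[OF e w]
  have Et: "E \<in> tspace A (\<iota> p)" using radical_sub[OF E] hyp_tspace_sub by blast
  have ES: "g (\<iota> p) E v = 0" if "v \<in> hyp_tspace B A \<iota> p" for v by (rule radical_orthogonal[OF E that])
  have NN: "g (\<iota> p) N N = 0" "g (\<iota> p) E N = 1" "\<And>v. v \<in> S p \<Longrightarrow> g (\<iota> p) N v = 0"
    and ww: "g (\<iota> p) w w = 0" "g (\<iota> p) e w = 1" "\<And>v. v \<in> S p \<Longrightarrow> g (\<iota> p) w v = 0"
    using N w unfolding transversal_for_def by blast+
  obtain t k where t: "t \<in> hyp_tspace B A \<iota> p" and wk: "w = t + k *\<^sub>R N"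
    using transversal_decomposition[OF Nt wt(1)] by blast
  obtain s' r where sr: "s' \<in> S p" "r \<in> radical B A \<iota> g p" "t = s' + r" using screen_decomposition[OF t] .
  have s't: "s' \<in> hyp_tspace B A \<iota> p" "s' \<in> tspace A (\<iota> p)" using sr(1) screen_sub hyp_tspace_sub by blast+
  have rt: "r \<in> tspace A (\<iota> p)" using radical_sub[OF sr(2)] hyp_tspace_sub by blast
  note gk = subspace_scale[OF s Nt(1), of k]
  have gw: "g (\<iota> p) w v = g (\<iota> p) s' v + g (\<iota> p) r v + k * g (\<iota> p) N v" if v: "v \<in> tspace A (\<iota> p)" for v
    unfolding wk sr(3)
    by (simp add: linear_on_add[OF g_left[OF v] subspace_add[OF s s't(2) rt] gk] linear_on_add[OF g_left[OF v] s't(2) rt]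
        linear_on_scale[OF g_left[OF v] Nt(1)])
  \<comment> \<open>The screen component is orthogonal to the screen and to the radical, so it lies in both.\<close>
  have s'0: "s' = 0"
  proof (rule screen_radical[OF sr(1)], unfold radical_def, intro CollectI conjI ballI)
    show "s' \<in> hyp_tspace B A \<iota> p" by (rule s't(1))
    fix v assume v: "v \<in> hyp_tspace B A \<iota> p"
    obtain s2 r2 where v2: "s2 \<in> S p" "r2 \<in> radical B A \<iota> g p" "v = s2 + r2" using screen_decomposition[OF v] .
    have v2t: "s2 \<in> hyp_tspace B A \<iota> p" "s2 \<in> tspace A (\<iota> p)" "r2 \<in> tspace A (\<iota> p)"
      using v2(1) screen_sub radical_sub[OF v2(2)] hyp_tspace_sub by blast+
    have "g (\<iota> p) s' s2 = 0"
      using gw[OF v2t(2)] ww(3)[OF v2(1)] NN(3)[OF v2(1)] radical_orthogonal[OF sr(2) v2t(1)] by simp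
    moreover have "g (\<iota> p) s' r2 = 0"
      using radical_orthogonal[OF v2(2) s't(1)] metric_sym[OF A P s't(2) v2t(3)] by simp
    ultimately show "g (\<iota> p) s' v = 0" unfolding v2(3) by (simp add: linear_on_add[OF g_right[OF s't(2)] v2t(2,3)])
  qed
  have rE: "r = g (\<iota> p) r N *\<^sub>R E" by (rule radical_rank_one[OF E N sr(2)])
  have eE: "e = g (\<iota> p) e N *\<^sub>R E" by (rule radical_rank_one[OF E N e])
  have wE: "w = g (\<iota> p) r N *\<^sub>R E + k *\<^sub>R N" using wk sr(3) s'0 rE by simp
  have gEw: "g (\<iota> p) E w = k"
    unfolding wE
    by (simp add: linear_on_add[OF g_right[OF Et] subspace_scale[OF s Et] gk] linear_on_scale[OF g_right[OF Et] Et]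
        linear_on_scale[OF g_right[OF Et] Nt(1)] ES[OF radical_sub[OF E]] NN(2))
  have "k \<noteq> 0"
  proof
    assume "k = 0"
    then have "g (\<iota> p) e w = 0"
      by (subst eE) (simp add: linear_on_scale[OF g_left[OF wt(1)] Et] gEw)
    then show False using ww(2) by simp
  qed
  moreover have "g (\<iota> p) w w = 2 * k * g (\<iota> p) r N"
  proof -
    have gNw: "g (\<iota> p) N w = g (\<iota> p) r N"
      unfolding wE
      by (simp add: linear_on_add[OF g_right[OF Nt(1)] subspace_scale[OF s Et] gk] linear_on_scale[OF g_right[OF Nt(1)] Et]
        linear_on_scale[OF g_right[OF Nt(1)] Nt(1)] NN(1,2) metric_sym[OF A P Nt(1) Et])
    have "g (\<iota> p) r w = g (\<iota> p) r N * k"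
      by (subst rE) (simp add: linear_on_scale[OF g_left[OF wt(1)] Et] gEw)
    then show ?thesis using gw[OF wt(1)] s'0 linear_on_zero[OF g_left[OF wt(1)] s] gNw by simp
  qed
  ultimately have "g (\<iota> p) r N = 0" using ww(1) by simp
  then have "w = k *\<^sub>R N" using wE by simp
  then show ?thesis unfolding span_singleton by (rule range_eqI)
qed

lemma ltr_eq:
  assumes E: "E \<in> radical B A \<iota> g p" "E \<noteq> 0" and N: "transversal_for A \<iota> g S p E N"
  shows "ltr B A \<iota> g S p = span {N}"
  unfolding ltr_def
proof (rule span_eq[THEN iffD2], intro conjI)
  show "{w. \<exists>e\<in>radical B A \<iota> g p. e \<noteq> 0 \<and> transversal_for A \<iota> g S p e w} \<subseteq> span {N}"
    using transversal_unique[OF E(1) N] by blast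
  show "{N} \<subseteq> span {w. \<exists>e\<in>radical B A \<iota> g p. e \<noteq> 0 \<and> transversal_for A \<iota> g S p e w}"
    using E N by (auto intro: span_base)
qed

context
  assumes xi_S: "\<forall>p. \<xi> (\<iota> p) \<in> S p" and SSI: "screen_semi_invariant B A \<iota> \<phi> g S"
begin

lemma xi_tangent: "\<xi> (\<iota> p) \<in> hyp_tspace B A \<iota> p"
  using xi_S screen_sub by blast

context
  fixes p E N
  assumes E: "E \<in> radical B A \<iota> g p" "E \<noteq> 0" and N: "transversal_for A \<iota> g S p E N"
begin

lemma N_in: "N \<in> tspace A (\<iota> p)" and N_not_tangent: "N \<notin> hyp_tspace B A \<iota> p"
  using transversal_not_tangent[OF E(1) N] by blast+

lemma phi_N_tangent: "\<phi> (\<iota> p) N \<in> hyp_tspace B A \<iota> p"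
proof -
  have "N \<in> ltr B A \<iota> g S p" unfolding ltr_eq[OF E N] by (rule span_base) simp
  then show ?thesis using SSI screen_sub unfolding screen_semi_invariant_def by blast
qed

lemma g_N_xi: "g (\<iota> p) N (\<xi> (\<iota> p)) = 0"
  using N xi_S unfolding transversal_for_def by blast

lemma eta_N: "\<eta> (\<iota> p) N = 0"
  using g_N_xi metric_xi[OF A P N_in] epsilon[OF A P] by auto

lemma phi_phi_N: "\<phi> (\<iota> p) (\<phi> (\<iota> p) N) = N"
  by (simp add: phi_phi[OF A P N_in] eta_N)

lemma span_phi_ltr_xi: "span (\<phi> (\<iota> p) ` ltr B A \<iota> g S p \<union> {\<xi> (\<iota> p)}) = span {\<xi> (\<iota> p), \<phi> (\<iota> p) N}"
proof (rule span_eq[THEN iffD2], intro conjI)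
  show "\<phi> (\<iota> p) ` ltr B A \<iota> g S p \<union> {\<xi> (\<iota> p)} \<subseteq> span {\<xi> (\<iota> p), \<phi> (\<iota> p) N}"
    unfolding ltr_eq[OF E N] span_singleton
    by (auto simp: linear_on_scale[OF phi_linear[OF A P] N_in] intro!: span_scale intro: span_base)
  have "N \<in> ltr B A \<iota> g S p" unfolding ltr_eq[OF E N] by (rule span_base) simp
  then show "{\<xi> (\<iota> p), \<phi> (\<iota> p) N} \<subseteq> span (\<phi> (\<iota> p) ` ltr B A \<iota> g S p \<union> {\<xi> (\<iota> p)})"
    by (auto intro: span_base)
qed

lemma eta_combination:
  "\<eta> (\<iota> p) (a *\<^sub>R \<xi> (\<iota> p) + b *\<^sub>R \<phi> (\<iota> p) N) = a"
proof -
  note s = subspace_tspace[OF A, of "\<iota> p"] and lin = eta_linear[OF A P, of "\<iota> p"]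
  note in_t = xi_in[OF A P, of "\<iota> p"] phi_in[OF A P N_in]
  show ?thesis
    unfolding linear_on_add[OF lin subspace_scale[OF s in_t(1)] subspace_scale[OF s in_t(2)]]
      linear_on_scale[OF lin in_t(1)] linear_on_scale[OF lin in_t(2)] eta_xi[OF A P] eta_phi[OF A P N_in]
    by simp
qed

lemma xi_phi_N_independent:
  assumes "a *\<^sub>R \<xi> (\<iota> p) + b *\<^sub>R \<phi> (\<iota> p) N = 0"
  shows "a = 0 \<and> b = 0"
proof -
  note s = subspace_tspace[OF A, of "\<iota> p"]
  have a: "a = 0"
    using eta_combination[of a b] linear_on_zero[OF eta_linear[OF A P] s] unfolding assms by simp
  have "b *\<^sub>R \<phi> (\<iota> p) N = 0" using assms a by simp
  then have "\<phi> (\<iota> p) (b *\<^sub>R \<phi> (\<iota> p) N) = 0" by (simp only: linear_on_zero[OF phi_linear[OF A P] s])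
  then have "b *\<^sub>R \<phi> (\<iota> p) (\<phi> (\<iota> p) N) = 0"
    unfolding linear_on_scale[OF phi_linear[OF A P] phi_in[OF A P N_in]] .
  moreover have "N \<noteq> 0" using N_not_tangent subspace_0[OF subspace_hyp_tspace] by blast
  ultimately show ?thesis using a by (simp add: phi_phi_N)
qed

text \<open>This makes the shape operator well defined.\<close>

lemma tangential_part_unique:
  assumes "a \<in> hyp_tspace B A \<iota> p" "a' \<in> hyp_tspace B A \<iota> p" "a + k *\<^sub>R N = a' + k' *\<^sub>R N"
  shows "a = a' \<and> k = k'"
proof -
  have "(k' - k) *\<^sub>R N = a - a'"
    unfolding scaleR_diff_left using assms(3) by (simp add: algebra_simps)
  then have "(k' - k) *\<^sub>R N \<in> hyp_tspace B A \<iota> p" using subspace_diff[OF subspace_hyp_tspace assms(1,2)] by simp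
  then have "inverse (k' - k) *\<^sub>R (k' - k) *\<^sub>R N \<in> hyp_tspace B A \<iota> p"
    by (rule subspace_scale[OF subspace_hyp_tspace])
  moreover have "inverse (k' - k) *\<^sub>R (k' - k) *\<^sub>R N = N" if "k' - k \<noteq> 0"
    by (simp only: scaleR_scaleR left_inverse[OF that] scaleR_one)
  ultimately have "k' - k = 0" using N_not_tangent by (metis (no_types))
  then show ?thesis using assms(3) by simp
qed

text \<open>The algebra behind the theorem. With \<open>n = \<nabla>\<^sub>\<xi> N = - A\<^sub>N \<xi> + \<tau> N\<close> the bracket of \<open>\<xi>\<close> and \<open>\<phi> N\<close> is
  \<open>\<phi> n - \<epsilon> N\<close>. If it lies in the span of \<open>\<xi>\<close> and \<open>\<phi> N\<close>, then it is a multiple of \<open>\<phi> N\<close>, as \<open>\<eta>\<close> annihilates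
  it; applying \<open>\<phi>\<close> turns this into \<open>A\<^sub>N \<xi> + \<epsilon> \<phi> N\<close> being a multiple of \<open>N\<close>, and it is tangent.\<close>

lemma bracket_in_distribution_iff:
  assumes n: "n \<in> tspace A (\<iota> p)" and gn: "g (\<iota> p) n (\<xi> (\<iota> p)) = 0"
  defines "a \<equiv> (THE a. a \<in> hyp_tspace B A \<iota> p \<and> (\<exists>\<tau>. n = - a + \<tau> *\<^sub>R N))"
  shows "\<phi> (\<iota> p) n - \<epsilon> *\<^sub>R N \<in> span {\<xi> (\<iota> p), \<phi> (\<iota> p) N} \<longleftrightarrow> a + \<epsilon> *\<^sub>R \<phi> (\<iota> p) N = 0"
proof -
  let ?\<phi> = "\<phi> (\<iota> p)"
  note s = subspace_tspace[OF A, of "\<iota> p"] and sT = subspace_hyp_tspace[of p]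
  note pl = phi_linear[OF A P, of "\<iota> p"] and el = eta_linear[OF A P, of "\<iota> p"]
  obtain t \<tau> where t: "t \<in> hyp_tspace B A \<iota> p" "n = t + \<tau> *\<^sub>R N"
    using transversal_decomposition[OF N_in N_not_tangent n] by blast
  have "a = - t"
    unfolding a_def
  proof (rule the_equality)
    show "- t \<in> hyp_tspace B A \<iota> p \<and> (\<exists>\<tau>. n = - (- t) + \<tau> *\<^sub>R N)"
      using subspace_neg[OF sT t(1)] t(2) by auto
    fix b assume b: "b \<in> hyp_tspace B A \<iota> p \<and> (\<exists>\<tau>. n = - b + \<tau> *\<^sub>R N)"
    then obtain \<tau>' where "t + \<tau> *\<^sub>R N = - b + \<tau>' *\<^sub>R N" using t(2) by auto
    then have "t = - b" using tangential_part_unique[OF t(1) subspace_neg[OF sT]] b by blast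
    then show "b = - t" by simp
  qed
  then have a: "a \<in> hyp_tspace B A \<iota> p" "n = - a + \<tau> *\<^sub>R N"
    using t subspace_neg[OF sT t(1)] by simp_all
  have at: "a \<in> tspace A (\<iota> p)" using a(1) hyp_tspace_sub by blast
  note at' = subspace_neg[OF s at] and Nt = subspace_scale[OF s N_in]
  note fN = phi_in[OF A P N_in] and fa = phi_in[OF A P at]
  have fn: "?\<phi> n = - ?\<phi> a + \<tau> *\<^sub>R ?\<phi> N"
    unfolding a(2) linear_on_add[OF pl at' Nt] linear_on_minus[OF pl at] linear_on_scale[OF pl N_in] ..
  have "\<epsilon> * \<eta> (\<iota> p) n = 0" using gn metric_xi[OF A P n] by simp
  then have "\<eta> (\<iota> p) n = 0" using epsilon[OF A P] by auto
  then have eta_a: "\<eta> (\<iota> p) a = 0"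
    unfolding a(2) linear_on_add[OF el at' Nt] linear_on_minus[OF el at] linear_on_scale[OF el N_in] eta_N by simp
  have ffa: "?\<phi> (?\<phi> a) = a" by (simp add: phi_phi[OF A P at] eta_a)
  show ?thesis
  proof
    assume "?\<phi> n - \<epsilon> *\<^sub>R N \<in> span {\<xi> (\<iota> p), ?\<phi> N}"
    then obtain \<beta> \<alpha> where ab: "?\<phi> n - \<epsilon> *\<^sub>R N = \<beta> *\<^sub>R \<xi> (\<iota> p) + \<alpha> *\<^sub>R ?\<phi> N" unfolding span_pair by blast
    have "\<eta> (\<iota> p) (?\<phi> n - \<epsilon> *\<^sub>R N) = 0"
      unfolding linear_on_diff[OF el s phi_in[OF A P n] Nt] linear_on_scale[OF el N_in] eta_N eta_phi[OF A P n] by simp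
    then have "\<beta> = 0" unfolding ab eta_combination .
    then have "?\<phi> a + \<epsilon> *\<^sub>R N = (\<tau> - \<alpha>) *\<^sub>R ?\<phi> N" using ab fn by (simp add: algebra_simps)
    then have "?\<phi> (?\<phi> a + \<epsilon> *\<^sub>R N) = ?\<phi> ((\<tau> - \<alpha>) *\<^sub>R ?\<phi> N)" by simp
    then have "a + \<epsilon> *\<^sub>R ?\<phi> N = (\<tau> - \<alpha>) *\<^sub>R N"
      unfolding linear_on_add[OF pl fa Nt] linear_on_scale[OF pl N_in] linear_on_scale[OF pl fN] ffa phi_phi_N .
    then have "(a + \<epsilon> *\<^sub>R ?\<phi> N) + 0 *\<^sub>R N = 0 + (\<tau> - \<alpha>) *\<^sub>R N" by simp
    from tangential_part_unique[OF subspace_add[OF sT a(1) subspace_scale[OF sT phi_N_tangent]] subspace_0[OF sT] this]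
    show "a + \<epsilon> *\<^sub>R ?\<phi> N = 0" by blast
  next
    assume "a + \<epsilon> *\<^sub>R ?\<phi> N = 0"
    then have "?\<phi> (a + \<epsilon> *\<^sub>R ?\<phi> N) = 0" using linear_on_zero[OF pl s] by simp
    then have "?\<phi> a + \<epsilon> *\<^sub>R N = 0"
      unfolding linear_on_add[OF pl at subspace_scale[OF s fN]] linear_on_scale[OF pl fN] phi_phi_N .
    then have "?\<phi> n - \<epsilon> *\<^sub>R N = 0 *\<^sub>R \<xi> (\<iota> p) + \<tau> *\<^sub>R ?\<phi> N" unfolding fn by (simp add: algebra_simps)
    then show "?\<phi> n - \<epsilon> *\<^sub>R N \<in> span {\<xi> (\<iota> p), ?\<phi> N}" unfolding span_pair by blast
  qed
qed

end

text \<open>In a chart of the hypersurface, \<open>\<xi>\<close> and \<open>\<phi> N\<close> become smooth fields \<open>X\<close> and \<open>Y\<close> spanning the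
  distribution. The differential of the immersion maps their bracket to \<open>\<nabla>\<^sub>\<xi> (\<phi> N) - \<nabla>\<^bsub>\<phi> N\<^esub> \<xi>\<close>, which is
  \<open>\<phi> (\<nabla>\<^sub>\<xi> N) - \<epsilon> N\<close> by the structure equations.\<close>

lemma distribution_frame:
  assumes pair: "null_pair B A \<iota> g S U E N" and p0: "p0 \<in> U" and c: "c \<in> B" "p0 \<in> cdom c"
  shows "\<exists>T X Y. open T \<and> cmap c p0 \<in> T \<and> T \<subseteq> cmap c ` (cdom c \<inter> U) \<and> smooth_on T X \<and> smooth_on T Y \<and>
    (\<forall>x\<in>T. (\<forall>a b. a *\<^sub>R X x + b *\<^sub>R Y x = 0 \<longrightarrow> a = 0 \<and> b = 0) \<and>
      (\<forall>v\<in>tspace B (cinv c x). v \<in> Dprime_xi B A \<iota> \<phi> \<xi> g S (cinv c x) \<longleftrightarrow> v c \<in> span {X x, Y x}) \<and>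
      (fderiv Y x (X x) - fderiv X x (Y x) \<in> span {X x, Y x} \<longleftrightarrow>
        shape_operator B A \<Gamma> \<iota> N (cinv c x) (to_intrinsic B A \<iota> (cinv c x) (\<xi> (\<iota> (cinv c x))))
          + \<epsilon> *\<^sub>R \<phi> (\<iota> (cinv c x)) (N (cinv c x)) = 0))"
proof -
  have U: "open U" and smN: "smooth_along B A \<iota> U N"
    and null: "\<And>p. p \<in> U \<Longrightarrow> E p \<in> radical B A \<iota> g p" "\<And>p. p \<in> U \<Longrightarrow> E p \<noteq> 0"
      "\<And>p. p \<in> U \<Longrightarrow> transversal_for A \<iota> g S p (E p) (N p)"
    using pair unfolding null_pair_def by blast+
  note f = smooth_iota_on[of U]
  obtain d where d: "d \<in> A" "\<iota> p0 \<in> cdom d" using ex_chart[OF A] by blast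
  let ?O = "cmap c ` {q \<in> cdom c \<inter> U. \<iota> q \<in> cdom d}" and ?i = "cmap d \<circ> \<iota> \<circ> cinv c"
  have O: "open ?O" by (rule open_chart_preimage(2)[OF A hyp_manifold c(1) d(1) U smooth_map_continuous[OF A hyp_manifold U f]])
  have x0: "cmap c p0 \<in> ?O" using p0 c d by blast
  have smi: "smooth_on ?O ?i" by (rule smooth_map_chart[OF A hyp_manifold U f c(1) d(1)])
  have q: "cinv c x \<in> U" "cinv c x \<in> cdom c" "\<iota> (cinv c x) \<in> cdom d" "cmap c (cinv c x) = x" if "x \<in> ?O" for x
    using that cinv_cmap[OF hyp_manifold c(1)] by auto
  have lin: "\<forall>x\<in>?O. linear (fderiv ?i x)" "\<forall>u. smooth_on ?O (\<lambda>x. fderiv ?i x u)"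
    using smooth_on_linear_fderiv[OF smi] smooth_on_fderiv[OF smi] by blast+
  have "inj (fderiv ?i (cmap c p0))" by (rule component_image_hyp_tspace(2)[OF c d])
  from smooth_on_linear_solution[OF O x0 lin this] obtain T where
    T: "open T" "cmap c p0 \<in> T" "T \<subseteq> ?O" "\<forall>y\<in>T. inj (fderiv ?i y)"
    and sol: "\<forall>V v w. open V \<longrightarrow> V \<subseteq> T \<longrightarrow> smooth_on V w \<longrightarrow> (\<forall>y\<in>V. fderiv ?i y (v y) = w y) \<longrightarrow> smooth_on V v"
    by blast
  define X where "X x = to_intrinsic B A \<iota> (cinv c x) (\<xi> (\<iota> (cinv c x))) c" for x
  define Y where "Y x = to_intrinsic B A \<iota> (cinv c x) (\<phi> (\<iota> (cinv c x)) (N (cinv c x))) c" for x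
  have pN: "\<phi> (\<iota> p) (N p) \<in> hyp_tspace B A \<iota> p" if "p \<in> U" for p
    by (rule phi_N_tangent[OF null(1)[OF that] null(2)[OF that] null(3)[OF that]])
  have comp: "fderiv ?i x (v c) = tmap B A \<iota> (cinv c x) v d" if "x \<in> ?O" "v \<in> tspace B (cinv c x)" for x v
    using tmap_components[OF c(1) d(1) q(2)[OF that(1)] q(3)[OF that(1)] that(2)] q(4)[OF that(1)] by simp
  have iX: "fderiv ?i x (X x) = \<xi> (\<iota> (cinv c x)) d" if "x \<in> ?O" for x
    unfolding X_def comp[OF that to_intrinsic(1)[OF xi_tangent]] to_intrinsic(2)[OF xi_tangent] ..
  have iY: "fderiv ?i x (Y x) = \<phi> (\<iota> (cinv c x)) (N (cinv c x)) d" if "x \<in> ?O" for x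
    unfolding Y_def comp[OF that to_intrinsic(1)[OF pN[OF q(1)[OF that]]]] to_intrinsic(2)[OF pN[OF q(1)[OF that]]] ..
  note smphi = smooth_along_phi[OF A P hyp_manifold U f smN] and smxi = smooth_along_xi[OF A P hyp_manifold U f]
  note sm = smooth_on_subset[OF _ T(3)]
  have smX: "smooth_on T X"
    by (rule sol[rule_format, OF T(1) order_refl sm[OF smooth_along_components[OF A hyp_manifold U f smxi c(1) d(1)]]])
      (rule iX, rule subsetD[OF T(3)])
  have smY: "smooth_on T Y"
    by (rule sol[rule_format, OF T(1) order_refl sm[OF smooth_along_components[OF A hyp_manifold U f smphi c(1) d(1)]]])
      (rule iY, rule subsetD[OF T(3)])
  have main: "(\<forall>a b. a *\<^sub>R X x + b *\<^sub>R Y x = 0 \<longrightarrow> a = 0 \<and> b = 0) \<and>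
      (\<forall>v\<in>tspace B (cinv c x). v \<in> Dprime_xi B A \<iota> \<phi> \<xi> g S (cinv c x) \<longleftrightarrow> v c \<in> span {X x, Y x}) \<and>
      (fderiv Y x (X x) - fderiv X x (Y x) \<in> span {X x, Y x} \<longleftrightarrow>
        shape_operator B A \<Gamma> \<iota> N (cinv c x) (to_intrinsic B A \<iota> (cinv c x) (\<xi> (\<iota> (cinv c x))))
          + \<epsilon> *\<^sub>R \<phi> (\<iota> (cinv c x)) (N (cinv c x)) = 0)" if x: "x \<in> T" for x
  proof -
    let ?q = "cinv c x"
    let ?D = "fderiv ?i x" and ?\<xi> = "\<xi> (\<iota> ?q)" and ?N = "N ?q" and ?\<phi> = "\<phi> (\<iota> ?q)"
    have xO: "x \<in> ?O" using x T(3) by blast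
    note qx = q[OF xO]
    note nq = null(1)[OF qx(1)] null(2)[OF qx(1)] null(3)[OF qx(1)]
    have linD: "linear ?D" and iD: "inj ?D" using lin(1) T(4) x xO by blast+
    have in_t: "?\<xi> \<in> tspace A (\<iota> ?q)" "?\<phi> ?N \<in> tspace A (\<iota> ?q)" "?N \<in> tspace A (\<iota> ?q)"
      using xi_in[OF A P] N_in[OF nq] phi_in[OF A P N_in[OF nq]] by blast+
    note s = subspace_tspace[OF A, of "\<iota> ?q"]
    have Dcomb: "?D (a *\<^sub>R X x + b *\<^sub>R Y x) = (a *\<^sub>R ?\<xi> + b *\<^sub>R ?\<phi> ?N) d" for a b
      unfolding linear_add[OF linD] linear_cmul[OF linD] iX[OF xO] iY[OF xO] plus_fun_apply tvec_scaleR_apply ..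
    have comb_in: "a *\<^sub>R ?\<xi> + b *\<^sub>R ?\<phi> ?N \<in> tspace A (\<iota> ?q)" for a b
      by (intro subspace_add[OF s] subspace_scale[OF s] in_t)
    have span: "u \<in> span {X x, Y x} \<longleftrightarrow> w \<in> span {?\<xi>, ?\<phi> ?N}"
      if w: "w \<in> tspace A (\<iota> ?q)" "?D u = w d" for u w
    proof -
      have "u = a *\<^sub>R X x + b *\<^sub>R Y x \<longleftrightarrow> w = a *\<^sub>R ?\<xi> + b *\<^sub>R ?\<phi> ?N" for a b
      proof
        assume "u = a *\<^sub>R X x + b *\<^sub>R Y x"
        then have "w d = (a *\<^sub>R ?\<xi> + b *\<^sub>R ?\<phi> ?N) d" using Dcomb w(2) by simp
        then show "w = a *\<^sub>R ?\<xi> + b *\<^sub>R ?\<phi> ?N" by (rule tspace_eqI[OF A w(1) comb_in d(1) qx(3)])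
      next
        assume "w = a *\<^sub>R ?\<xi> + b *\<^sub>R ?\<phi> ?N"
        then have "?D u = ?D (a *\<^sub>R X x + b *\<^sub>R Y x)" using Dcomb w(2) by simp
        then show "u = a *\<^sub>R X x + b *\<^sub>R Y x" by (rule injD[OF iD])
      qed
      then show ?thesis unfolding span_pair by simp
    qed
    have indep: "a = 0 \<and> b = 0" if "a *\<^sub>R X x + b *\<^sub>R Y x = 0" for a b
    proof -
      have "(a *\<^sub>R ?\<xi> + b *\<^sub>R ?\<phi> ?N) d = 0 d"
        unfolding Dcomb[symmetric] that linear_0[OF linD] by simp
      then have "a *\<^sub>R ?\<xi> + b *\<^sub>R ?\<phi> ?N = 0"
        by (rule tspace_eqI[OF A comb_in subspace_0[OF s] d(1) qx(3)])
      then show ?thesis by (rule xi_phi_N_independent[OF nq])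
    qed
    have dist: "v \<in> Dprime_xi B A \<iota> \<phi> \<xi> g S ?q \<longleftrightarrow> v c \<in> span {X x, Y x}" if v: "v \<in> tspace B ?q" for v
      unfolding span[OF tmap_in[OF v] comp[OF xO v]] Dprime_xi_def span_phi_ltr_xi[OF nq] using v by simp
    let ?X = "to_intrinsic B A \<iota> ?q ?\<xi>" and ?Y = "to_intrinsic B A \<iota> ?q (?\<phi> ?N)"
    have X: "?X \<in> tspace B ?q" "tmap B A \<iota> ?q ?X = ?\<xi>" using to_intrinsic[OF xi_tangent] by blast+
    have Y: "?Y \<in> tspace B ?q" "tmap B A \<iota> ?q ?Y = ?\<phi> ?N" using to_intrinsic[OF pN[OF qx(1)]] by blast+
    define n where "n = cov_along B A \<Gamma> \<iota> ?q ?X N"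
    have n: "n \<in> tspace A (\<iota> ?q)"
      unfolding n_def by (rule cov_along_in_tspace[OF A hyp_manifold U f smN linear_connection[OF A P] qx(1) X(1)])
    have cov1: "cov_along B A \<Gamma> \<iota> ?q ?X (\<lambda>q. \<phi> (\<iota> q) (N q)) = ?\<phi> n"
    proof -
      have "g (\<iota> ?q) (?\<phi> ?\<xi>) (?\<phi> ?N) = 0"
        unfolding phi_xi[OF A P] by (rule linear_on_zero[OF g_left[OF in_t(2)] s])
      moreover have "?\<phi> (?\<phi> ?\<xi>) = 0" unfolding phi_xi[OF A P] by (rule linear_on_zero[OF phi_linear[OF A P] s])
      ultimately show ?thesis
        unfolding n_def cov_along_phi[OF A P hyp_manifold U f smN qx(1) X(1)] X(2) by simp
    qed
    have cov2: "cov_along B A \<Gamma> \<iota> ?q ?Y (\<lambda>q. \<xi> (\<iota> q)) = \<epsilon> *\<^sub>R ?N"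
      unfolding cov_along_xi[OF A P hyp_manifold U f qx(1) Y(1)] Y(2) phi_phi_N[OF nq] ..
    have "?D (fderiv Y x (X x) - fderiv X x (Y x)) =
        fderiv (\<lambda>x. \<phi> (\<iota> (cinv c x)) (N (cinv c x)) d) x (X x) - fderiv (\<lambda>x. \<xi> (\<iota> (cinv c x)) d) x (Y x)"
      by (rule related_fields_bracket[OF T(1) sm[OF smi] smX smY x]) (rule iX iY, rule subsetD[OF T(3)], assumption)+
    also have "\<dots> = (cov_along B A \<Gamma> \<iota> ?q ?X (\<lambda>q. \<phi> (\<iota> q) (N q)) - cov_along B A \<Gamma> \<iota> ?q ?Y (\<lambda>q. \<xi> (\<iota> q))) d"
    proof -
      have "cov_along B A \<Gamma> \<iota> ?q ?X (\<lambda>q. \<phi> (\<iota> q) (N q)) d =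
          fderiv (\<lambda>x. \<phi> (\<iota> (cinv c x)) (N (cinv c x)) d) x (X x) + \<Gamma> d (\<iota> ?q) (?\<xi> d) (?\<phi> ?N d)"
        using cov_along_chart[OF A hyp_manifold U f smphi c(1) d(1) qx(1,2,3) X(1)] unfolding qx(4) X(2) X_def .
      moreover have "cov_along B A \<Gamma> \<iota> ?q ?Y (\<lambda>q. \<xi> (\<iota> q)) d =
          fderiv (\<lambda>x. \<xi> (\<iota> (cinv c x)) d) x (Y x) + \<Gamma> d (\<iota> ?q) (?\<phi> ?N d) (?\<xi> d)"
        using cov_along_chart[OF A hyp_manifold U f smxi c(1) d(1) qx(1,2,3) Y(1)] unfolding qx(4) Y(2) Y_def .
      ultimately show ?thesis
        using christoffel_symmetric[OF A P d(1) qx(3), of "?\<xi> d" "?\<phi> ?N d"] by simp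
    qed
    also have "\<dots> = (?\<phi> n - \<epsilon> *\<^sub>R ?N) d" unfolding cov1 cov2 ..
    finally have br: "?D (fderiv Y x (X x) - fderiv X x (Y x)) = (?\<phi> n - \<epsilon> *\<^sub>R ?N) d" .
    have br_in: "?\<phi> n - \<epsilon> *\<^sub>R ?N \<in> tspace A (\<iota> ?q)"
      by (intro subspace_diff[OF s] subspace_scale[OF s] phi_in[OF A P] n in_t)
    have gn: "g (\<iota> ?q) n ?\<xi> = 0"
    proof -
      have "fderiv (\<lambda>x. g (\<iota> (cinv c x)) (N (cinv c x)) (\<xi> (\<iota> (cinv c x)))) (cmap c ?q) (?X c) =
          g (\<iota> ?q) n ?\<xi> + g (\<iota> ?q) ?N (cov_along B A \<Gamma> \<iota> ?q ?X (\<lambda>q. \<xi> (\<iota> q)))"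
        unfolding n_def by (rule metric_along_derivative[OF A P hyp_manifold U f smN smxi c(1) d(1) qx(1,2,3) X(1)])
      moreover have "cov_along B A \<Gamma> \<iota> ?q ?X (\<lambda>q. \<xi> (\<iota> q)) = 0"
        unfolding cov_along_xi[OF A P hyp_manifold U f qx(1) X(1)] X(2) phi_xi[OF A P] by simp
      moreover have "g (\<iota> ?q) ?N 0 = 0" by (rule linear_on_zero[OF g_right[OF in_t(3)] s])
      moreover have "fderiv (\<lambda>x. g (\<iota> (cinv c x)) (N (cinv c x)) (\<xi> (\<iota> (cinv c x)))) (cmap c ?q) = (\<lambda>_. 0)"
      proof -
        have "fderiv (\<lambda>x. g (\<iota> (cinv c x)) (N (cinv c x)) (\<xi> (\<iota> (cinv c x)))) x = fderiv (\<lambda>x. 0) x"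
          by (rule fderiv_cong_open[OF O xO])
            (rule g_N_xi[OF null(1) null(2) null(3)]; rule q(1); assumption)
        then show ?thesis using qx(4) by simp
      qed
      ultimately show ?thesis by simp
    qed
    have "fderiv Y x (X x) - fderiv X x (Y x) \<in> span {X x, Y x} \<longleftrightarrow> ?\<phi> n - \<epsilon> *\<^sub>R ?N \<in> span {?\<xi>, ?\<phi> ?N}"
      by (rule span[OF br_in br])
    also have "\<dots> \<longleftrightarrow> shape_operator B A \<Gamma> \<iota> N ?q ?X + \<epsilon> *\<^sub>R ?\<phi> ?N = 0"
      unfolding shape_operator_def n_def[symmetric] by (rule bracket_in_distribution_iff[OF nq n gn])
    finally show ?thesis using indep dist by blast
  qed
  have "T \<subseteq> cmap c ` (cdom c \<inter> U)" using T(3) by blast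
  with T(1,2) smX smY main show ?thesis by blast
qed

end

end

section \<open>Existence of null pairs\<close>

text \<open>If \<open>c j\<close> were nonzero, \<open>k - 1\<close> of the vectors would span the same space. In this form linear independence
  is extracted from the dimension in the definition of a smooth subbundle.\<close>

lemma independent_of_full_dimension:
  fixes f :: "nat \<Rightarrow> 'v::real_vector"
  assumes "dim (span (f ` {..<k})) = k" "(\<Sum>i<k. c i *\<^sub>R f i) = 0" "j < k"
  shows "c j = 0"
proof (rule ccontr)
  assume cj: "c j \<noteq> 0"
  let ?R = "f ` ({..<k} - {j})"
  have "(\<Sum>i<k. c i *\<^sub>R f i) = c j *\<^sub>R f j + (\<Sum>i\<in>{..<k} - {j}. c i *\<^sub>R f i)"
    using assms(3) by (intro sum.remove) auto
  then have "c j *\<^sub>R f j = - (\<Sum>i\<in>{..<k} - {j}. c i *\<^sub>R f i)" using assms(2) by (simp add: eq_neg_iff_add_eq_0)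
  also have "\<dots> \<in> span ?R" by (intro span_neg span_sum span_scale span_base) auto
  finally have "inverse (c j) *\<^sub>R c j *\<^sub>R f j \<in> span ?R" by (rule span_scale)
  then have fj: "f j \<in> span ?R" using cj by simp
  have "f ` {..<k} \<subseteq> span ?R"
  proof
    fix v assume "v \<in> f ` {..<k}"
    then obtain i where i: "i < k" "v = f i" by auto
    show "v \<in> span ?R" using fj i by (cases "i = j") (auto intro: span_base)
  qed
  then have "span (f ` {..<k}) \<subseteq> span ?R" by (intro span_minimal) auto
  then have "dim (span (f ` {..<k})) \<le> card ?R" by (intro dim_le_card) auto
  also have "\<dots> \<le> card ({..<k} - {j})" by (rule card_image_le) simp
  also have "\<dots> < k" using assms(3) by simp
  finally show False using assms(1) by simp
qed

text \<open>The equations for the products with the single fields \<open>V i\<close> are combined, with the vectors \<open>V i x0\<close> as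
  coefficients, into one square linear system; as these vectors are independent, the single equations can
  be recovered from it.\<close>

lemma smooth_dual_field:
  fixes G :: "'x::euclidean_space \<Rightarrow> 'y::euclidean_space \<Rightarrow> 'y \<Rightarrow> real" and V :: "'i \<Rightarrow> 'x \<Rightarrow> 'y"
  assumes O: "open O'" "x0 \<in> O'" and I: "finite I"
    and lin: "\<And>x v. x \<in> O' \<Longrightarrow> linear (G x v)" "\<And>x w. x \<in> O' \<Longrightarrow> linear (\<lambda>v. G x v w)"
    and smG: "\<And>v w. smooth_on O' (\<lambda>x. G x v w)" and smV: "\<And>i. i \<in> I \<Longrightarrow> smooth_on O' (V i)"
    and indep: "\<And>c i. (\<Sum>i\<in>I. c i *\<^sub>R V i x0) = 0 \<Longrightarrow> i \<in> I \<Longrightarrow> c i = 0"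
    and nondeg: "\<And>v. (\<And>i. i \<in> I \<Longrightarrow> G x0 v (V i x0) = 0) \<Longrightarrow> v = 0"
  shows "\<exists>T v. open T \<and> x0 \<in> T \<and> T \<subseteq> O' \<and> smooth_on T v \<and> (\<forall>x\<in>T. \<forall>i\<in>I. G x (v x) (V i x) = c i) \<and>
    (\<forall>x\<in>T. \<forall>u. (\<forall>i\<in>I. G x u (V i x) = 0) \<longrightarrow> u = 0)"
proof -
  define A where "A x v = (\<Sum>i\<in>I. G x v (V i x) *\<^sub>R V i x0)" for x v
  have linA: "\<forall>x\<in>O'. linear (A x)"
    unfolding A_def[abs_def]
  proof (intro ballI linear_compose_sum)
    show "linear (\<lambda>v. G x v (V i x) *\<^sub>R V i x0)" if "x \<in> O'" for x i
      using linear_compose[OF lin(2)[OF that] bounded_linear.linear[OF bounded_linear_scaleR_left]] by (simp add: o_def)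
  qed
  have smA: "\<forall>u. smooth_on O' (\<lambda>x. A x u)"
    unfolding A_def
  proof (intro allI smooth_on_sum O smooth_on_scaleR smooth_on_const)
    show "smooth_on O' (\<lambda>x. G x u (V i x))" if "i \<in> I" for u i
      by (rule smooth_on_linear_family[where F="\<lambda>x. G x u" and w="V i", OF O(1) lin(1) smG smV[OF that]])
  qed
  have coef: "c i = c' i" if "(\<Sum>i\<in>I. c i *\<^sub>R V i x0) = (\<Sum>i\<in>I. c' i *\<^sub>R V i x0)" "i \<in> I" for c c' i
  proof -
    have "(\<Sum>i\<in>I. (c i - c' i) *\<^sub>R V i x0) = 0" using that(1) by (simp add: scaleR_diff_left sum_subtractf)
    from indep[of "\<lambda>i. c i - c' i", OF this that(2)] show ?thesis by simp
  qed
  have "inj (A x0)"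
    unfolding linear_injective_0[OF bspec[OF linA O(2)]]
  proof (intro allI impI nondeg)
    fix v i assume v: "A x0 v = 0" and i: "i \<in> I"
    show "G x0 v (V i x0) = 0" by (rule indep[OF v[unfolded A_def] i])
  qed
  from smooth_on_linear_solution[OF O linA smA this] obtain T where
    T: "open T" "x0 \<in> T" "T \<subseteq> O'" "\<forall>y\<in>T. inj (A y)"
    and sol: "\<forall>U v w. open U \<longrightarrow> U \<subseteq> T \<longrightarrow> smooth_on U w \<longrightarrow> (\<forall>y\<in>U. A y (v y) = w y) \<longrightarrow> smooth_on U v"
    by blast
  define v where "v x = inv (A x) (\<Sum>i\<in>I. c i *\<^sub>R V i x0)" for x
  have v: "A x (v x) = (\<Sum>i\<in>I. c i *\<^sub>R V i x0)" if x: "x \<in> T" for x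
  proof -
    have "linear (A x)" "inj (A x)" using linA T(3,4) x by blast+
    then have "surj (A x)" by (rule linear_injective_imp_surjective) (rule refl)
    then show ?thesis unfolding v_def by (rule surj_f_inv_f)
  qed
  have "smooth_on T v"
    by (rule sol[rule_format, OF T(1) order_refl smooth_on_const]) (rule v)
  moreover have "G x (v x) (V i x) = c i" if "x \<in> T" "i \<in> I" for x i
    by (rule coef[OF v[OF that(1), unfolded A_def] that(2)])
  moreover have "u = 0" if x: "x \<in> T" and u: "\<forall>i\<in>I. G x u (V i x) = 0" for x u
  proof -
    have lx: "linear (A x)" "inj (A x)" using linA T(3,4) x by blast+
    have "A x u = 0" unfolding A_def using u by simp
    then show ?thesis using lx(2) unfolding linear_injective_0[OF lx(1)] by blast
  qed
  ultimately show ?thesis using T(1-3) by blast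
qed

context
  fixes A :: "('a::{t2_space,second_countable_topology}, 'e::euclidean_space) chart set"
    and B :: "('b::{t2_space,second_countable_topology}, 'f::euclidean_space) chart set"
    and \<iota> :: "'b \<Rightarrow> 'a" and \<phi> \<xi> \<eta> g \<epsilon> \<Gamma> S
  assumes A: "smooth_manifold A" and P: "para_sasakian A \<phi> \<xi> \<eta> g \<epsilon> \<Gamma>"
    and L: "lightlike_hypersurface B A \<iota> g" and Sc: "screen_distribution B A \<iota> g S"
begin

lemma orthogonal_to_all:
  assumes w: "w \<in> tspace A (\<iota> p)" and "\<And>t. t \<in> hyp_tspace B A \<iota> p \<Longrightarrow> g (\<iota> p) w t = 0"
    and v: "v \<in> tspace A (\<iota> p)" "v \<notin> hyp_tspace B A \<iota> p" "g (\<iota> p) w v = 0"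
  shows "w = 0"
proof (rule metric_nondegenerate[OF A P w])
  note s = subspace_tspace[OF A, of "\<iota> p"]
  fix z assume "z \<in> tspace A (\<iota> p)"
  from transversal_decomposition[OF A P L Sc v(1,2) this]
  obtain t k where t: "t \<in> hyp_tspace B A \<iota> p" "z = t + k *\<^sub>R v" by blast
  have tt: "t \<in> tspace A (\<iota> p)" using t(1) hyp_tspace_sub[OF A P L Sc] by blast
  show "g (\<iota> p) w z = 0"
    unfolding t(2) linear_on_add[OF metric_linear[OF A P w] tt subspace_scale[OF s v(1)]]
      linear_on_scale[OF metric_linear[OF A P w] v(1)] assms(2)[OF t(1)] v(3) by simp
qed

lemma radical_scale:
  assumes "e \<in> radical B A \<iota> g p" shows "r *\<^sub>R e \<in> radical B A \<iota> g p"
  unfolding radical_def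
proof (intro CollectI conjI ballI)
  note e = radical_sub[OF A P L Sc assms]
  show "r *\<^sub>R e \<in> hyp_tspace B A \<iota> p" by (rule subspace_scale[OF subspace_hyp_tspace[OF A P L Sc] e])
  fix w assume w: "w \<in> hyp_tspace B A \<iota> p"
  have "w \<in> tspace A (\<iota> p)" "e \<in> tspace A (\<iota> p)" using w e hyp_tspace_sub[OF A P L Sc] by blast+
  then show "g (\<iota> p) (r *\<^sub>R e) w = 0"
    using linear_on_scale[OF metric_linear_left[OF A P]] radical_orthogonal[OF A P L Sc assms w] by simp
qed

lemma ex_radical: obtains e where "e \<in> radical B A \<iota> g p" "e \<noteq> 0"
proof -
  have "0 \<in> radical B A \<iota> g p" using screen_radical_Int[OF A P L Sc, of p] by blast
  with radical_nontrivial[OF A P L Sc, of p] have "\<exists>e. e \<in> radical B A \<iota> g p \<and> e \<noteq> 0" by blast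
  with that show thesis by blast
qed

lemma ex_dual_vector:
  assumes "e \<in> tspace A q" "e \<noteq> 0"
  obtains v where "v \<in> tspace A q" "g q e v = 1"
proof -
  obtain w where w: "w \<in> tspace A q" "g q e w \<noteq> 0"
    using metric_nondegenerate[OF A P assms(1)] assms(2) by blast
  show thesis
  proof (rule that)
    show "inverse (g q e w) *\<^sub>R w \<in> tspace A q" by (rule subspace_scale[OF subspace_tspace[OF A] w(1)])
    show "g q e (inverse (g q e w) *\<^sub>R w) = 1"
      unfolding linear_on_scale[OF metric_linear[OF A P assms(1)] w(1)] using w(2) by simp
  qed
qed

lemma metric_span_zero:
  assumes w: "w \<in> tspace A q" and K: "K \<subseteq> tspace A q" "\<And>v. v \<in> K \<Longrightarrow> g q w v = 0" and v: "v \<in> span K"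
  shows "g q w v = 0"
proof -
  note s = subspace_tspace[OF A, of q] and lin = metric_linear[OF A P w]
  have "span K \<subseteq> {v \<in> tspace A q. g q w v = 0}"
  proof (rule span_minimal)
    show "K \<subseteq> {v \<in> tspace A q. g q w v = 0}" using K by blast
    show "subspace {v \<in> tspace A q. g q w v = 0}"
      unfolding subspace_def
      using subspace_0[OF s] subspace_add[OF s] subspace_scale[OF s] linear_on_zero[OF lin s]
        linear_on_add[OF lin] linear_on_scale[OF lin] by simp
  qed
  then show ?thesis using v by blast
qed

text \<open>\<open>E\<close> is the field orthogonal to the hypersurface, normalized by a transversal coordinate vector; a field
  orthogonal to the screen whose product with \<open>E\<close> is \<open>1\<close> becomes null after subtracting a multiple of \<open>E\<close>.\<close>

lemma null_pair_exists: "\<exists>U E N. null_pair B A \<iota> g S U E N \<and> p0 \<in> U"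
proof -
  note mB = hyp_manifold[OF A P L Sc]
  obtain c where c: "c \<in> B" "p0 \<in> cdom c" using ex_chart[OF mB] by blast
  obtain d where d: "d \<in> A" "\<iota> p0 \<in> cdom d" using ex_chart[OF A] by blast
  have "smooth_subbundle B A \<iota> S" using Sc unfolding screen_distribution_def by (rule conjunct1)
  from spec[OF this[unfolded smooth_subbundle_def], of p0]
  obtain U1 k F where U1: "open U1" "p0 \<in> U1" and F: "\<And>i. i < k \<Longrightarrow> smooth_along B A \<iota> U1 (F i)"
    and SF: "\<And>q. q \<in> U1 \<Longrightarrow> S q = span ((\<lambda>i. F i q) ` {..<k})" "\<And>q. q \<in> U1 \<Longrightarrow> dim (S q) = k"
    by blast
  note f = smooth_iota_on[OF A P L Sc, of U1]
  let ?O = "cmap c ` {q \<in> cdom c \<inter> U1. \<iota> q \<in> cdom d}" and ?i = "cmap d \<circ> \<iota> \<circ> cinv c"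
  have O: "open ?O"
    by (rule open_chart_preimage(2)[OF A mB c(1) d(1) U1(1) smooth_map_continuous[OF A mB U1(1) f]])
  have x0: "cmap c p0 \<in> ?O" using U1 c d by blast
  have smi: "smooth_on ?O ?i" by (rule smooth_map_chart[OF A mB U1(1) f c(1) d(1)])
  have q: "cinv c x \<in> U1" "cinv c x \<in> cdom c" "\<iota> (cinv c x) \<in> cdom d" "cmap c (cinv c x) = x"
    "?i x \<in> crange d" "cinv d (?i x) = \<iota> (cinv c x)" if "x \<in> ?O" for x
    using that cinv_cmap[OF mB c(1)] cinv_cmap[OF A d(1)] by (auto simp: crange_def)
  have cx0: "cinv c (cmap c p0) = p0" by (rule cinv_cmap[OF mB c])
  define X where "X x = coord_vec A d (\<iota> (cinv c x))" for x
  define G where "G x u w = g (\<iota> (cinv c x)) (X x u) (X x w)" for x u w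
  have X_in: "X x u \<in> tspace A (\<iota> (cinv c x))" if "x \<in> ?O" for x u
    unfolding X_def by (rule coord_vec_in_tspace[OF A d(1) q(3)[OF that]])
  have X_of: "X x (v d) = v" if "x \<in> ?O" "v \<in> tspace A (\<iota> (cinv c x))" for x v
    unfolding X_def by (rule coord_vec_of_components[OF A that(2) d(1) q(3)[OF that(1)]])
  have X_lin: "linear (X x)" if "x \<in> ?O" for x
    unfolding X_def by (rule linear_coord_vec[OF A d(1) q(3)[OF that]])
  have X_inj: "u = 0" if "x \<in> ?O" "X x u = 0" for x u
  proof -
    have "X x u d = u" unfolding X_def by (rule coord_vec_at[OF A d(1) q(3)[OF that(1)]])
    then show ?thesis using that(2) by simp
  qed
  have linG: "linear (G x v)" "linear (\<lambda>v. G x v w)" if "x \<in> ?O" for x v w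
    using metric_coord_linear[OF A P d(1) q(5)[OF that]] unfolding G_def[abs_def] X_def q(6)[OF that] by blast+
  have smG: "smooth_on ?O (\<lambda>x. G x v w)" for v w
    by (rule smooth_on_cong[OF O, THEN iffD1, OF _ pullback_smooth[OF A P mB U1(1) f c(1) d(1) metric_smooth[OF A P d(1), of v w]]])
      (simp only: G_def X_def q(6))
  let ?D = "\<lambda>x. fderiv ?i x"
  have XD: "X x (?D x h) = tmap B A \<iota> (cinv c x) (coord_vec B c (cinv c x) h)" if x: "x \<in> ?O" for x h
  proof -
    note cv = coord_vec_in_tspace[OF mB c(1) q(2)[OF x], of h]
    have "?D x h = tmap B A \<iota> (cinv c x) (coord_vec B c (cinv c x) h) d"
      unfolding tmap_components[OF A P L Sc c(1) d(1) q(2)[OF x] q(3)[OF x] cv] q(4)[OF x] coord_vec_at[OF mB c(1) q(2)[OF x]] ..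
    then show ?thesis using X_of[OF x tmap_in[OF A P L Sc cv]] by simp
  qed
  have XD_in: "X x (?D x h) \<in> hyp_tspace B A \<iota> (cinv c x)" if x: "x \<in> ?O" for x h
    unfolding XD[OF x] hyp_tspace_def by (rule imageI[OF coord_vec_in_tspace[OF mB c(1) q(2)[OF x]]])
  have D_lin: "linear (?D x)" if "x \<in> ?O" for x by (rule smooth_on_linear_fderiv[OF smi that])
  have orth: "g (\<iota> (cinv c x)) w t = 0"
    if x: "x \<in> ?O" and w: "w \<in> tspace A (\<iota> (cinv c x))" and t: "t \<in> hyp_tspace B A \<iota> (cinv c x)"
      and b: "\<And>b. b \<in> Basis \<Longrightarrow> g (\<iota> (cinv c x)) w (X x (?D x b)) = 0" for x w t
  proof -
    obtain v where v: "v \<in> tspace B (cinv c x)" "t = tmap B A \<iota> (cinv c x) v"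
      using t unfolding hyp_tspace_def by blast
    have "t = X x (?D x (v c))"
      unfolding XD[OF x] v(2) coord_vec_of_components[OF mB v(1) c(1) q(2)[OF x]] ..
    also have "\<dots> = (\<Sum>b\<in>Basis. (v c \<bullet> b) *\<^sub>R X x (?D x b))"
      using linear_basis_expand[OF linear_compose[OF D_lin[OF x] X_lin[OF x]], of "v c"] by simp
    also have "\<dots> \<in> span ((\<lambda>b. X x (?D x b)) ` Basis)" by (intro span_sum span_scale span_base) auto
    finally show ?thesis by (rule metric_span_zero[OF w, rotated 2]) (use X_in[OF x] b in auto)
  qed
  \<comment> \<open>A coordinate vector transversal to the hypersurface at \<open>p0\<close>.\<close>
  obtain e0 where e0: "e0 \<in> radical B A \<iota> g p0" "e0 \<noteq> 0" by (rule ex_radical)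
  have e0t: "e0 \<in> tspace A (\<iota> p0)" using radical_sub[OF A P L Sc e0(1)] hyp_tspace_sub[OF A P L Sc] by blast
  obtain v0 where v0: "v0 \<in> tspace A (\<iota> p0)" "g (\<iota> p0) e0 v0 = 1" by (rule ex_dual_vector[OF e0t e0(2)])
  have v0_T: "v0 \<notin> hyp_tspace B A \<iota> p0" using radical_orthogonal[OF A P L Sc e0(1), of v0] v0(2) by auto
  have Xv0: "X (cmap c p0) (v0 d) = v0" using X_of[OF x0] v0(1) by (simp add: cx0)
  \<comment> \<open>The section \<open>E\<close> is orthogonal to all coordinate vectors \<open>?D x b\<close> of the hypersurface. That it is
    tangent follows because the radical is known to be nonzero, and any radical vector is a multiple of it.\<close>
  define VE where "VE j x = (case j of None \<Rightarrow> v0 d | Some b \<Rightarrow> ?D x b)" for j x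
  let ?IE = "insert None (Some ` (Basis :: 'f set))"
  have sum_IE: "(\<Sum>j\<in>?IE. a j *\<^sub>R VE j x) = a None *\<^sub>R v0 d + (\<Sum>b\<in>Basis. a (Some b) *\<^sub>R ?D x b)" for a x
    by (simp add: VE_def sum.reindex)
  have "\<exists>T v. open T \<and> cmap c p0 \<in> T \<and> T \<subseteq> ?O \<and> smooth_on T v \<and>
    (\<forall>x\<in>T. \<forall>j\<in>?IE. G x (v x) (VE j x) = (if j = None then 1 else 0)) \<and>
    (\<forall>x\<in>T. \<forall>u. (\<forall>j\<in>?IE. G x u (VE j x) = 0) \<longrightarrow> u = 0)"
  proof (rule smooth_dual_field[OF O x0 _ linG smG])
    show "smooth_on ?O (VE j)" for j
    proof (cases j)
      case None
      then have "VE j = (\<lambda>x. v0 d)" by (simp add: VE_def[abs_def])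
      then show ?thesis by (simp only: smooth_on_const)
    next
      case (Some b)
      then have "VE j = (\<lambda>x. ?D x b)" by (simp add: VE_def[abs_def])
      then show ?thesis by (simp only: smooth_on_fderiv[OF smi])
    qed
  next
    fix a j assume 0: "(\<Sum>j\<in>?IE. a j *\<^sub>R VE j (cmap c p0)) = 0" and j: "j \<in> ?IE"
    define h where "h = (\<Sum>b\<in>Basis. a (Some b) *\<^sub>R b)"
    have "a None *\<^sub>R v0 d + ?D (cmap c p0) h = 0"
      using 0 unfolding sum_IE h_def linear_sum[OF D_lin[OF x0]] linear_cmul[OF D_lin[OF x0]] .
    then have "X (cmap c p0) (a None *\<^sub>R v0 d + ?D (cmap c p0) h) = 0" by (simp only: linear_0[OF X_lin[OF x0]])
    then have eq: "a None *\<^sub>R v0 + X (cmap c p0) (?D (cmap c p0) h) = 0"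
      unfolding linear_add[OF X_lin[OF x0]] linear_cmul[OF X_lin[OF x0]] Xv0 .
    have t: "X (cmap c p0) (?D (cmap c p0) h) \<in> hyp_tspace B A \<iota> p0" using XD_in[OF x0] by (simp only: cx0)
    have tt: "X (cmap c p0) (?D (cmap c p0) h) \<in> tspace A (\<iota> p0)" using t hyp_tspace_sub[OF A P L Sc] by blast
    note se = subspace_scale[OF subspace_tspace[OF A] v0(1)] and lin = metric_linear[OF A P e0t]
    have "g (\<iota> p0) e0 (a None *\<^sub>R v0 + X (cmap c p0) (?D (cmap c p0) h)) = a None"
      unfolding linear_on_add[OF lin se tt] linear_on_scale[OF lin v0(1)] v0(2) radical_orthogonal[OF A P L Sc e0(1) t] by simp
    then have aN: "a None = 0" unfolding eq by (simp add: linear_on_zero[OF lin subspace_tspace[OF A]])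
    then have "?D (cmap c p0) h = 0" using eq by (intro X_inj[OF x0]) simp
    then have "h = 0"
      using component_image_hyp_tspace(2)[OF A P L Sc c d] unfolding linear_injective_0[OF D_lin[OF x0]] by blast
    then have hb: "h \<bullet> b = 0" for b by simp
    have "a (Some b) = 0" if "b \<in> Basis" for b
      using inner_sum_left_Basis[OF that, of "\<lambda>b. a (Some b)"] hb[of b] unfolding h_def by (rule trans[OF sym])
    then show "a j = 0" using j aN by auto
  next
    fix u assume u: "\<And>j. j \<in> ?IE \<Longrightarrow> G (cmap c p0) u (VE j (cmap c p0)) = 0"
    note Xu = X_in[OF x0, of u, unfolded cx0]
    have "X (cmap c p0) u = 0"
    proof (rule orthogonal_to_all[OF Xu _ v0(1) v0_T])
      show "g (\<iota> p0) (X (cmap c p0) u) v0 = 0"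
        using u[of None] unfolding G_def VE_def by (simp add: Xv0 cx0)
      show "g (\<iota> p0) (X (cmap c p0) u) t = 0" if t: "t \<in> hyp_tspace B A \<iota> p0" for t
      proof (rule orth[OF x0, unfolded cx0, OF Xu t])
        show "g (\<iota> p0) (X (cmap c p0) u) (X (cmap c p0) (?D (cmap c p0) b)) = 0" if "b \<in> Basis" for b
          using u[of "Some b"] that unfolding G_def VE_def by (simp add: cx0)
      qed
    qed
    then show "u = 0" by (rule X_inj[OF x0])
  qed auto
  then obtain T1 e where T1: "open T1" "cmap c p0 \<in> T1" "T1 \<subseteq> ?O" and sme: "smooth_on T1 e"
    and e: "\<forall>x\<in>T1. \<forall>j\<in>?IE. G x (e x) (VE j x) = (if j = None then 1 else 0)"
    and e_uniq: "\<forall>x\<in>T1. \<forall>u. (\<forall>j\<in>?IE. G x u (VE j x) = 0) \<longrightarrow> u = 0"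
    by blast
  have eV: "G x (e x) (v0 d) = 1" if "x \<in> T1" for x
    using e that by (auto simp: VE_def dest: bspec[of _ _ None])
  have e_multiple: "r = G x (r d) (v0 d) *\<^sub>R X x (e x)" if x: "x \<in> T1" and r: "r \<in> radical B A \<iota> g (cinv c x)" for x r
  proof -
    have xO: "x \<in> ?O" using x T1(3) by blast
    have rt: "r \<in> tspace A (\<iota> (cinv c x))" using radical_sub[OF A P L Sc r] hyp_tspace_sub[OF A P L Sc] by blast
    define k where "k = G x (r d) (v0 d)"
    have "r d - k *\<^sub>R e x = 0"
    proof (rule e_uniq[rule_format, OF x])
      fix j assume j: "j \<in> ?IE"
      have Gj: "G x (r d - k *\<^sub>R e x) (VE j x) = G x (r d) (VE j x) - k * G x (e x) (VE j x)"
        unfolding linear_diff[OF linG(2)[OF xO]] linear_cmul[OF linG(2)[OF xO]] by simp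
      show "G x (r d - k *\<^sub>R e x) (VE j x) = 0"
      proof (cases j)
        case None
        then show ?thesis unfolding Gj using eV[OF x] by (simp add: VE_def k_def)
      next
        case (Some b)
        have "G x (r d) (VE j x) = 0"
          unfolding G_def X_of[OF xO rt] using radical_orthogonal[OF A P L Sc r XD_in[OF xO]] Some by (simp add: VE_def)
        moreover have "G x (e x) (VE j x) = 0" using e x j Some by auto
        ultimately show ?thesis unfolding Gj by simp
      qed
    qed
    then have "X x (r d) = X x (k *\<^sub>R e x)" by simp
    then show ?thesis unfolding X_of[OF xO rt] linear_cmul[OF X_lin[OF xO]] k_def .
  qed
  have e_radical: "X x (e x) \<in> radical B A \<iota> g (cinv c x)" "X x (e x) \<noteq> 0" if x: "x \<in> T1" for x
  proof -
    obtain r where r: "r \<in> radical B A \<iota> g (cinv c x)" "r \<noteq> 0" by (rule ex_radical)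
    define k where "k = G x (r d) (v0 d)"
    have rk: "r = k *\<^sub>R X x (e x)" unfolding k_def by (rule e_multiple[OF x r(1)])
    then have "k \<noteq> 0" using r(2) by auto
    then have "X x (e x) = inverse k *\<^sub>R r" unfolding rk by simp
    then show "X x (e x) \<in> radical B A \<iota> g (cinv c x)" using radical_scale[OF r(1)] by simp
    show "X x (e x) \<noteq> 0" using rk r(2) by auto
  qed
  \<comment> \<open>A field \<open>v\<close> orthogonal to the screen with \<open>g v E = 1\<close>, for the basis consisting of the screen frame, of
    \<open>E\<close> (index \<open>k\<close>) and of the transversal vector (index \<open>k + 1\<close>).\<close>
  define VN where "VN j x = (if j < k then F j (cinv c x) d else if j = k then e x else v0 d)" for j x
  let ?IN = "{..<Suc (Suc k)}"
  have sum_IN: "(\<Sum>j\<in>?IN. a j *\<^sub>R VN j x) = (\<Sum>j<k. a j *\<^sub>R F j (cinv c x) d) + a k *\<^sub>R e x + a (Suc k) *\<^sub>R v0 d" for a x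
    by (simp add: VN_def)
  note smT1 = smooth_on_subset[OF _ T1(3)]
  have F_in: "F j (cinv c x) \<in> tspace A (\<iota> (cinv c x))" "F j (cinv c x) \<in> S (cinv c x)" if "x \<in> ?O" "j < k" for j x
  proof -
    show "F j (cinv c x) \<in> tspace A (\<iota> (cinv c x))"
      by (rule along_smooth_in[OF A P mB U1(1) f F[OF that(2)] q(1)[OF that(1)]])
    show "F j (cinv c x) \<in> S (cinv c x)"
      unfolding SF(1)[OF q(1)[OF that(1)]] by (rule span_base, rule imageI) (simp add: that(2))
  qed
  have "\<exists>T v. open T \<and> cmap c p0 \<in> T \<and> T \<subseteq> T1 \<and> smooth_on T v \<and>
    (\<forall>x\<in>T. \<forall>j\<in>?IN. G x (v x) (VN j x) = (if j = k then 1 else 0)) \<and>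
    (\<forall>x\<in>T. \<forall>u. (\<forall>j\<in>?IN. G x u (VN j x) = 0) \<longrightarrow> u = 0)"
  proof (rule smooth_dual_field[where G=G and V=VN and I="?IN", OF T1(1,2)])
    show "linear (G x v)" if "x \<in> T1" for x v by (rule linG(1)[OF subsetD[OF T1(3) that]])
    show "linear (\<lambda>v. G x v w)" if "x \<in> T1" for x w by (rule linG(2)[OF subsetD[OF T1(3) that]])
    show "smooth_on T1 (\<lambda>x. G x v w)" for v w by (rule smT1[OF smG])
    show "smooth_on T1 (VN j)" for j
    proof (cases "j < k")
      case True
      then have "VN j = (\<lambda>x. F j (cinv c x) d)" by (simp add: VN_def[abs_def])
      then show ?thesis by (simp only: smT1[OF smooth_along_components[OF A mB U1(1) f F[OF True] c(1) d(1)]])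
    next
      case False
      then show ?thesis using sme by (cases "j = k") (simp_all add: VN_def[abs_def] smooth_on_const)
    qed
  next
    fix a j assume 0: "(\<Sum>j\<in>?IN. a j *\<^sub>R VN j (cmap c p0)) = 0" and j: "j \<in> ?IN"
    let ?x = "cmap c p0"
    define s where "s = (\<Sum>j<k. a j *\<^sub>R F j p0)"
    have sX: "X ?x (\<Sum>j<k. a j *\<^sub>R F j p0 d) = s"
      unfolding s_def linear_sum[OF X_lin[OF x0]] linear_cmul[OF X_lin[OF x0]]
      using X_of[OF x0] F_in(1)[OF x0] by (simp add: cx0)
    have sS: "s \<in> S p0" unfolding s_def SF(1)[OF U1(2)] by (intro span_sum span_scale span_base) auto
    have sT: "s \<in> hyp_tspace B A \<iota> p0" using sS screen_sub[OF A P L Sc] by blast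
    have st: "s \<in> tspace A (\<iota> p0)" using sT hyp_tspace_sub[OF A P L Sc] by blast
    let ?e = "X ?x (e ?x)"
    have eR: "?e \<in> radical B A \<iota> g p0" "?e \<noteq> 0" using e_radical[OF T1(2)] by (simp_all add: cx0)
    have eT: "?e \<in> hyp_tspace B A \<iota> p0" by (rule radical_sub[OF A P L Sc eR(1)])
    have et: "?e \<in> tspace A (\<iota> p0)" using eT hyp_tspace_sub[OF A P L Sc] by blast
    have "X ?x ((\<Sum>j<k. a j *\<^sub>R F j p0 d) + a k *\<^sub>R e ?x + a (Suc k) *\<^sub>R v0 d) = 0"
      using 0 unfolding sum_IN cx0 by (simp only: linear_0[OF X_lin[OF x0]])
    then have eq: "s + a k *\<^sub>R ?e + a (Suc k) *\<^sub>R v0 = 0"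
      unfolding linear_add[OF X_lin[OF x0]] linear_cmul[OF X_lin[OF x0]] Xv0 sX .
    note ss = subspace_tspace[OF A, of "\<iota> p0"] and lin = metric_linear[OF A P et]
    have "g (\<iota> p0) ?e v0 = 1" using eV[OF T1(2)] unfolding G_def Xv0 by (simp add: cx0)
    then have "g (\<iota> p0) ?e (s + a k *\<^sub>R ?e + a (Suc k) *\<^sub>R v0) = a (Suc k)"
      unfolding linear_on_add[OF lin subspace_add[OF ss st subspace_scale[OF ss et]] subspace_scale[OF ss v0(1)]]
        linear_on_add[OF lin st subspace_scale[OF ss et]] linear_on_scale[OF lin et] linear_on_scale[OF lin v0(1)]
        radical_orthogonal[OF A P L Sc eR(1) sT] radical_orthogonal[OF A P L Sc eR(1) eT] by simp
    then have a2: "a (Suc k) = 0" unfolding eq by (simp add: linear_on_zero[OF lin ss])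
    then have s_eq: "s = (- a k) *\<^sub>R ?e" using eq by (simp add: eq_neg_iff_add_eq_0)
    have s0: "s = 0" by (rule screen_radical[OF A P L Sc sS]) (unfold s_eq, rule radical_scale[OF eR(1)])
    then have a1: "a k = 0" using s_eq eR(2) by simp
    have "a i = 0" if "i < k" for i
      by (rule independent_of_full_dimension[OF _ s0[unfolded s_def] that])
        (use SF[OF U1(2)] in simp)
    then show "a j = 0" using j a1 a2 by (auto simp: less_Suc_eq)
  next
    fix u assume u: "\<And>j. j \<in> ?IN \<Longrightarrow> G (cmap c p0) u (VN j (cmap c p0)) = 0"
    note Xu = X_in[OF x0, of u, unfolded cx0]
    let ?x = "cmap c p0"
    have FS: "g (\<iota> p0) (X ?x u) s = 0" if s: "s \<in> S p0" for s
    proof (rule metric_span_zero[OF Xu _ _ s[unfolded SF(1)[OF U1(2)]]])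
      show "(\<lambda>i. F i p0) ` {..<k} \<subseteq> tspace A (\<iota> p0)" using F_in(1)[OF x0] by (auto simp: cx0)
      fix v assume "v \<in> (\<lambda>i. F i p0) ` {..<k}"
      then obtain j where j: "j < k" "v = F j p0" by auto
      then show "g (\<iota> p0) (X ?x u) v = 0"
        using u[of j] X_of[OF x0 F_in(1)[OF x0 j(1)]] unfolding G_def VN_def by (simp add: cx0)
    qed
    have "X ?x u = 0"
    proof (rule orthogonal_to_all[OF Xu _ v0(1) v0_T])
      show "g (\<iota> p0) (X ?x u) v0 = 0"
        using u[of "Suc k"] unfolding G_def VN_def by (simp add: Xv0 cx0)
      fix t assume "t \<in> hyp_tspace B A \<iota> p0"
      then obtain s r where sr: "s \<in> S p0" "r \<in> radical B A \<iota> g p0" "t = s + r" by (rule screen_decomposition[OF A P L Sc])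
      have eR: "X ?x (e ?x) \<in> radical B A \<iota> g p0" using e_radical(1)[OF T1(2)] by (simp add: cx0)
      have st: "s \<in> tspace A (\<iota> p0)" "r \<in> tspace A (\<iota> p0)" "X ?x (e ?x) \<in> tspace A (\<iota> p0)"
        using sr(1) screen_sub[OF A P L Sc] radical_sub[OF A P L Sc sr(2)] radical_sub[OF A P L Sc eR] hyp_tspace_sub[OF A P L Sc] by blast+
      define a where "a = G ?x (r d) (v0 d)"
      have r: "r = a *\<^sub>R X ?x (e ?x)" unfolding a_def by (rule e_multiple[OF T1(2)]) (simp add: cx0 sr(2))
      have "g (\<iota> p0) (X ?x u) (X ?x (e ?x)) = 0" using u[of k] unfolding G_def VN_def by (simp add: cx0)
      then have "g (\<iota> p0) (X ?x u) r = 0"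
        by (subst r) (simp add: linear_on_scale[OF metric_linear[OF A P Xu] st(3)])
      then show "g (\<iota> p0) (X ?x u) t = 0"
        unfolding sr(3) linear_on_add[OF metric_linear[OF A P Xu] st(1,2)] using FS[OF sr(1)] by simp
    qed
    then show "u = 0" by (rule X_inj[OF x0])
  qed auto
  then obtain T v where T: "open T" "cmap c p0 \<in> T" "T \<subseteq> T1" and smv: "smooth_on T v"
    and v: "\<forall>x\<in>T. \<forall>j\<in>?IN. G x (v x) (VN j x) = (if j = k then 1 else 0)" by blast
  have TO: "T \<subseteq> ?O" using T(3) T1(3) by blast
  \<comment> \<open>\<open>g (v - r E) (v - r E) = g v v - 2 r\<close>, since \<open>E\<close> is null and \<open>g v E = 1\<close>.\<close>
  define w where "w x = v x - (G x (v x) (v x) / 2) *\<^sub>R e x" for x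
  note smT = smooth_on_subset[OF _ TO]
  have smeT: "smooth_on T e" by (rule smooth_on_subset[OF sme T(3)])
  have smw: "smooth_on T w"
  proof -
    have lT: "linear (G x u)" "linear (\<lambda>u. G x u z)" if "x \<in> T" for x u z
      by (rule linG(1)[OF subsetD[OF TO that]], rule linG(2)[OF subsetD[OF TO that]])
    have Gv: "smooth_on T (\<lambda>x. G x u (v x))" for u
      by (rule smooth_on_linear_family[where F="\<lambda>x. G x u" and w=v, OF T(1) lT(1) smT[OF smG] smv])
    have "smooth_on T (\<lambda>x. G x (v x) (v x))"
      by (rule smooth_on_linear_family[where F="\<lambda>x u. G x u (v x)" and w=v, OF T(1) lT(2) Gv smv])
    then have "smooth_on T (\<lambda>x. (1/2) * G x (v x) (v x))" by (intro smooth_on_mult T(1) smooth_on_const)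
    then have "smooth_on T (\<lambda>x. v x - ((1/2) * G x (v x) (v x)) *\<^sub>R e x)"
      by (intro smooth_on_diff smooth_on_scaleR T(1) smv smeT)
    then show ?thesis by (simp add: w_def[abs_def])
  qed
  define U where "U = cdom c \<inter> cmap c -` T"
  have cU: "cmap c ` U = T" using TO by (auto simp: U_def)
  have Uc: "U \<subseteq> cdom c" by (simp add: U_def)
  have Ud: "\<iota> ` U \<subseteq> cdom d"
  proof
    fix y assume "y \<in> \<iota> ` U"
    then obtain p where p: "p \<in> U" "y = \<iota> p" by blast
    then have "cmap c p \<in> ?O" using TO by (auto simp: U_def)
    from q(3)[OF this] show "y \<in> cdom d" using p cinv_cmap[OF mB c(1)] Uc by auto
  qed
  have Uo: "open U"
    unfolding U_def
    using chart_homeomorphism[OF mB c(1)] chart_open[OF mB c(1)] T(1)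
    by (intro continuous_open_preimage) (auto simp: homeomorphism_def)
  note fU = smooth_iota_on[OF A P L Sc, of U]
  have smooth: "smooth_along B A \<iota> U (\<lambda>q. coord_vec A d (\<iota> q) (h (cmap c q)))" if "smooth_on T h" for h
    by (rule smooth_along_coord_vec[OF A mB Uo fU c(1) Uc d(1) Ud]) (simp add: cU that)
  have "null_pair B A \<iota> g S U (\<lambda>q. coord_vec A d (\<iota> q) (e (cmap c q))) (\<lambda>q. coord_vec A d (\<iota> q) (w (cmap c q)))"
    unfolding null_pair_def
  proof (intro conjI ballI Uo smooth smeT smw)
    fix p assume p: "p \<in> U"
    let ?x = "cmap c p"
    have xT: "?x \<in> T" using p by (simp add: U_def)
    then have xO: "?x \<in> ?O" and xT1: "?x \<in> T1" using TO T(3) by blast+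
    have cx: "cinv c ?x = p" using cinv_cmap[OF mB c(1)] p Uc by blast
    have X_p: "coord_vec A d (\<iota> p) = X ?x" by (simp add: X_def cx)
    have gG: "g (\<iota> p) (X ?x a) (X ?x b) = G ?x a b" for a b by (simp add: G_def cx)
    note eR = e_radical[OF xT1, unfolded cx]
    show "coord_vec A d (\<iota> p) (e ?x) \<in> radical B A \<iota> g p" "coord_vec A d (\<iota> p) (e ?x) \<noteq> 0"
      unfolding X_p by (rule eR)+
    have eT: "X ?x (e ?x) \<in> hyp_tspace B A \<iota> p" by (rule radical_sub[OF A P L Sc eR(1)])
    have Gw: "G ?x (w ?x) z = G ?x (v ?x) z - (G ?x (v ?x) (v ?x) / 2) * G ?x (e ?x) z" for z
      unfolding w_def linear_diff[OF linG(2)[OF xO]] linear_cmul[OF linG(2)[OF xO]] by simp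
    have Gw': "G ?x z (w ?x) = G ?x z (v ?x) - (G ?x (v ?x) (v ?x) / 2) * G ?x z (e ?x)" for z
      unfolding w_def linear_diff[OF linG(1)[OF xO]] linear_cmul[OF linG(1)[OF xO]] by simp
    have Gve: "G ?x (v ?x) (e ?x) = 1" using v xT by (auto simp: VN_def dest!: bspec[of _ _ k])
    have Gev: "G ?x (e ?x) (v ?x) = 1"
      using Gve metric_sym[OF A P X_in[OF xO, unfolded cx] X_in[OF xO, unfolded cx]] unfolding gG[symmetric] by simp
    have Gee: "G ?x (e ?x) (e ?x) = 0" unfolding gG[symmetric] by (rule radical_orthogonal[OF A P L Sc eR(1) eT])
    show "transversal_for A \<iota> g S p (coord_vec A d (\<iota> p) (e ?x)) (coord_vec A d (\<iota> p) (w ?x))"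
      unfolding transversal_for_def X_p gG
    proof (intro conjI ballI)
      show "X ?x (w ?x) \<in> tspace A (\<iota> p)" by (rule X_in[OF xO, unfolded cx])
      show "G ?x (w ?x) (w ?x) = 0" unfolding Gw Gw' Gve Gev Gee by simp
      show "G ?x (e ?x) (w ?x) = 1" unfolding Gw' Gev Gee by simp
      fix s assume s: "s \<in> S p"
      have pU1: "p \<in> U1" using q(1)[OF xO] cx by simp
      show "g (\<iota> p) (X ?x (w ?x)) s = 0"
      proof (rule metric_span_zero[OF X_in[OF xO, unfolded cx] _ _ s[unfolded SF(1)[OF pU1]]])
        show "(\<lambda>i. F i p) ` {..<k} \<subseteq> tspace A (\<iota> p)" using F_in(1)[OF xO] by (auto simp: cx)
        fix z assume "z \<in> (\<lambda>i. F i p) ` {..<k}"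
        then obtain j where j: "j < k" "z = F j p" by auto
        have z: "z = X ?x (z d)" using X_of[OF xO F_in(1)[OF xO j(1)]] j(2) by (simp add: cx)
        have "G ?x (v ?x) (z d) = 0" using v xT j by (auto simp: VN_def cx dest!: bspec[of _ _ j])
        moreover have "z \<in> hyp_tspace B A \<iota> p" using F_in(2)[OF xO j(1)] j(2) screen_sub[OF A P L Sc] by (auto simp: cx)
        then have "G ?x (e ?x) (z d) = 0" unfolding gG[symmetric] z[symmetric] by (rule radical_orthogonal[OF A P L Sc eR(1)])
        ultimately have "G ?x (w ?x) (z d) = 0" unfolding Gw by simp
        then show "g (\<iota> p) (X ?x (w ?x)) z = 0" unfolding gG[symmetric] z[symmetric] .
      qed
    qed
  qed
  moreover have "p0 \<in> U" using c(2) T(2) by (simp add: U_def)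
  ultimately show ?thesis by blast
qed

end

section \<open>Parametrized integral surfaces\<close>

lemma cinv_std: "cinv (UNIV, id) = id"
  by (simp add: cinv_def)

lemma smooth_manifold_std: "smooth_manifold (std_atlas :: ('k::euclidean_space, 'k) chart set)"
  unfolding smooth_manifold_def std_atlas_def
proof (intro conjI ballI)
  fix c d :: "('k, 'k) chart" assume "c \<in> {(UNIV, id)}" and "d \<in> {(UNIV, id)}"
  then have cd: "c = (UNIV, id)" "d = (UNIV, id)" by simp_all
  show "open (cdom c)" "open (crange c)" unfolding cd crange_def by simp_all
  show "homeomorphism (cdom c) (crange c) (cmap c) (cinv c)"
    unfolding cd cinv_std crange_def homeomorphism_def by (simp add: continuous_on_id)
  have "smooth_on UNIV (\<lambda>x::'k. x)" by (rule smooth_on_ident) simp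
  then show "smooth_on (cmap c ` (cdom c \<inter> cdom d)) (cmap d \<circ> cinv c)"
    unfolding cd cinv_std by (simp add: id_def comp_def)
qed simp

text \<open>Tangent vectors are determined by their components in one chart, so that being an immersion and being
  tangent to a distribution become properties of the derivative there.\<close>

context
  fixes B :: "('b::{t2_space,second_countable_topology}, 'f::euclidean_space) chart set"
    and j :: "'k::euclidean_space \<Rightarrow> 'b" and W :: "'k set"
  assumes B: "smooth_manifold B" and W: "open W" and j: "smooth_map_on std_atlas B W j"
begin

lemma parametrization_chart:
  assumes w: "w \<in> W" and c: "c \<in> B" "j w \<in> cdom c"
  shows "inj_on (tmap std_atlas B j w) (tspace std_atlas w) \<longleftrightarrow> inj (fderiv (cmap c \<circ> j) w)" (is ?inj)
    and "tmap std_atlas B j w ` tspace std_atlas w = {v \<in> tspace B (j w). v c \<in> range (fderiv (cmap c \<circ> j) w)}"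
      (is ?image)
proof -
  let ?c = "(UNIV, id) :: ('k, 'k) chart"
  note M = smooth_manifold_std[where 'k='k]
  have c0: "?c \<in> std_atlas" "w \<in> cdom ?c" by (simp_all add: std_atlas_def)
  note cv = coord_vec_in_tspace[OF M c0] and cv_at = coord_vec_at[OF M c0]
  have t: "tmap std_atlas B j w v c = fderiv (cmap c \<circ> j) w (v ?c)" if "v \<in> tspace std_atlas w" for v
    using tmap_chart[OF B M W j c0(1) c(1) w c0(2) c(2) that] by (simp add: cinv_std)
  note t_in = tmap_in_tspace[OF B M W j w]
  show ?inj
  proof
    assume inj: "inj_on (tmap std_atlas B j w) (tspace std_atlas w)"
    show "inj (fderiv (cmap c \<circ> j) w)"
    proof (rule injI)
      fix h h' assume "fderiv (cmap c \<circ> j) w h = fderiv (cmap c \<circ> j) w h'"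
      then have "tmap std_atlas B j w (coord_vec std_atlas ?c w h) c = tmap std_atlas B j w (coord_vec std_atlas ?c w h') c"
        by (simp add: t[OF cv] cv_at)
      then have "tmap std_atlas B j w (coord_vec std_atlas ?c w h) = tmap std_atlas B j w (coord_vec std_atlas ?c w h')"
        by (rule tspace_eqI[OF B t_in[OF cv] t_in[OF cv] c])
      then have "coord_vec std_atlas ?c w h = coord_vec std_atlas ?c w h'" by (rule inj_onD[OF inj _ cv cv])
      then have "coord_vec std_atlas ?c w h ?c = coord_vec std_atlas ?c w h' ?c" by simp
      then show "h = h'" by (simp only: cv_at)
    qed
  next
    assume inj: "inj (fderiv (cmap c \<circ> j) w)"
    show "inj_on (tmap std_atlas B j w) (tspace std_atlas w)"
    proof (rule inj_onI)
      fix v v' assume v: "v \<in> tspace std_atlas w" "v' \<in> tspace std_atlas w"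
        and eq: "tmap std_atlas B j w v = tmap std_atlas B j w v'"
      have "fderiv (cmap c \<circ> j) w (v ?c) = fderiv (cmap c \<circ> j) w (v' ?c)"
        unfolding t[OF v(1), symmetric] t[OF v(2), symmetric] eq ..
      then have "v ?c = v' ?c" by (rule injD[OF inj])
      then show "v = v'" by (rule tspace_eqI[OF M v c0])
    qed
  qed
  show ?image
  proof (intro equalityI subsetI)
    fix v assume "v \<in> tmap std_atlas B j w ` tspace std_atlas w"
    then obtain v' where v': "v' \<in> tspace std_atlas w" "v = tmap std_atlas B j w v'" by blast
    show "v \<in> {v \<in> tspace B (j w). v c \<in> range (fderiv (cmap c \<circ> j) w)}"
      unfolding v'(2) mem_Collect_eq t[OF v'(1)] using t_in[OF v'(1)] by blast
  next
    fix v assume "v \<in> {v \<in> tspace B (j w). v c \<in> range (fderiv (cmap c \<circ> j) w)}"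
    then obtain h where v: "v \<in> tspace B (j w)" and h: "v c = fderiv (cmap c \<circ> j) w h" by blast
    have "v = tmap std_atlas B j w (coord_vec std_atlas ?c w h)"
      by (rule tspace_eqI[OF B v t_in[OF cv] c]) (simp only: t[OF cv] cv_at h)
    then show "v \<in> tmap std_atlas B j w ` tspace std_atlas w" by (rule image_eqI[OF _ cv])
  qed
qed

lemma parametrization_smooth:
  assumes "c \<in> B" shows "smooth_on {w \<in> W. j w \<in> cdom c} (cmap c \<circ> j)"
proof -
  have "(UNIV, id) \<in> (std_atlas :: ('k, 'k) chart set)" by (simp add: std_atlas_def)
  from smooth_map_chart[OF B smooth_manifold_std W j this assms] show ?thesis by (simp add: cinv_std)
qed

end

lemma smooth_map_on_stdI:
  fixes B :: "('b::{t2_space,second_countable_topology}, 'f::euclidean_space) chart set"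
    and J :: "'k::euclidean_space \<Rightarrow> 'f"
  assumes B: "smooth_manifold B" and c: "c \<in> B" and W: "open W" and J: "smooth_on W J" "J ` W \<subseteq> crange c"
  shows "smooth_map_on std_atlas B W (cinv c \<circ> J)"
  unfolding smooth_map_on_def
proof (intro conjI ballI)
  have cc: "continuous_on (crange c) (cinv c)" using chart_homeomorphism[OF B c] by (simp add: homeomorphism_def)
  show cont: "continuous_on W (cinv c \<circ> J)"
    by (rule continuous_on_compose[OF smooth_on_continuous[OF J(1)] continuous_on_subset[OF cc J(2)]])
  fix c0 :: "('k, 'k) chart" and e assume "c0 \<in> std_atlas" and e: "e \<in> B"
  then have c0: "c0 = (UNIV, id)" by (simp add: std_atlas_def)
  let ?O = "{q \<in> W. cinv c (J q) \<in> cdom e}"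
  have "open (W \<inter> (cinv c \<circ> J) -` cdom e)" by (rule continuous_open_preimage[OF cont W chart_open[OF B e]])
  moreover have "W \<inter> (cinv c \<circ> J) -` cdom e = ?O" by auto
  ultimately have O: "open ?O" by simp
  have "J ` ?O \<subseteq> cmap c ` (cdom c \<inter> cdom e)"
  proof
    fix y assume "y \<in> J ` ?O"
    then obtain q where q: "q \<in> W" "cinv c (J q) \<in> cdom e" "y = J q" by blast
    then have y: "y \<in> crange c" using J(2) by blast
    show "y \<in> cmap c ` (cdom c \<inter> cdom e)"
      by (rule image_eqI[of y _ "cinv c y"]) (use cmap_cinv[OF B c y] cinv_in_cdom[OF B c y] q in auto)
  qed
  from smooth_on_compose[OF O transition_open[OF B c e] this smooth_on_subset[OF J(1)] transition_smooth[OF B c e]]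
  have "smooth_on ?O (\<lambda>x. (cmap e \<circ> cinv c) (J x))" by blast
  then show "smooth_on (cmap c0 ` {q \<in> cdom c0 \<inter> W. (cinv c \<circ> J) q \<in> cdom e}) (cmap e \<circ> (cinv c \<circ> J) \<circ> cinv c0)"
    unfolding c0 cinv_std by (simp add: comp_def)
qed

text \<open>The components in a chart identify the integral surfaces of the distribution with those of the plane
  field spanned by \<open>X\<close> and \<open>Y\<close>, to which the two halves of the theorem of Frobenius apply.\<close>

lemma integrable_imp_bracket_in_span:
  fixes B :: "('b::{t2_space,second_countable_topology}, 'f::euclidean_space) chart set"
  assumes B: "smooth_manifold B" and int: "integrable_distribution TYPE('k::euclidean_space) B \<Delta>"
    and c: "c \<in> B" "p \<in> cdom c" and T: "open T" "cmap c p \<in> T" "T \<subseteq> crange c"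
    and sm: "smooth_on T X" "smooth_on T Y"
    and \<Delta>: "\<And>x. x \<in> T \<Longrightarrow> \<Delta> (cinv c x) = {v \<in> tspace B (cinv c x). v c \<in> span {X x, Y x}}"
  shows "fderiv Y (cmap c p) (X (cmap c p)) - fderiv X (cmap c p) (Y (cmap c p)) \<in> span {X (cmap c p), Y (cmap c p)}"
proof -
  from int[unfolded integrable_distribution_def, THEN spec, of p]
  obtain W and j :: "'k \<Rightarrow> 'b" where W: "open W" "p \<in> j ` W" and j: "smooth_map_on std_atlas B W j"
    and tan: "\<forall>x\<in>W. inj_on (tmap std_atlas B j x) (tspace std_atlas x) \<and>
               tmap std_atlas B j x ` tspace std_atlas x = \<Delta> (j x)"
    by (elim exE conjE)
  obtain w0 where w0: "w0 \<in> W" "j w0 = p" using W(2) by blast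
  let ?V = "cdom c \<inter> cmap c -` T"
  let ?W = "W \<inter> j -` ?V"
  have "continuous_on (cdom c) (cmap c)" using chart_homeomorphism[OF B c(1)] by (simp add: homeomorphism_def)
  from continuous_open_preimage[OF this chart_open[OF B c(1)] T(1)] have "open ?V" .
  from continuous_open_preimage[OF smooth_map_continuous[OF B smooth_manifold_std W(1) j] W(1) this]
  have oW: "open ?W" .
  have smJ: "smooth_on ?W (cmap c \<circ> j)"
    by (rule smooth_on_subset[OF parametrization_smooth[OF B W(1) j c(1)]]) blast
  have img: "(cmap c \<circ> j) ` ?W \<subseteq> T" by auto
  have w0': "w0 \<in> ?W" using w0 c(2) T(2) by auto
  have R: "range (fderiv (cmap c \<circ> j) w) = span {X ((cmap c \<circ> j) w), Y ((cmap c \<circ> j) w)}"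
    and I: "inj (fderiv (cmap c \<circ> j) w)" if w: "w \<in> ?W" for w
  proof -
    let ?x = "(cmap c \<circ> j) w"
    have wW: "w \<in> W" and jc: "j w \<in> cdom c" and xT: "?x \<in> T" using w by auto
    have cx: "cinv c ?x = j w" using cinv_cmap[OF B c(1) jc] by simp
    note pc = parametrization_chart[OF B W(1) j wW c(1) jc]
    have t: "inj_on (tmap std_atlas B j w) (tspace std_atlas w)"
      "tmap std_atlas B j w ` tspace std_atlas w = \<Delta> (j w)" using tan wW by blast+
    show "inj (fderiv (cmap c \<circ> j) w)" by (rule pc(1)[THEN iffD1, OF t(1)])
    have eq: "{v \<in> tspace B (j w). v c \<in> range (fderiv (cmap c \<circ> j) w)} = {v \<in> tspace B (j w). v c \<in> span {X ?x, Y ?x}}"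
      using pc(2) t(2) \<Delta>[OF xT, unfolded cx] by simp
    have "u \<in> range (fderiv (cmap c \<circ> j) w) \<longleftrightarrow> u \<in> span {X ?x, Y ?x}" for u
    proof -
      let ?u = "coord_vec B c (j w) u"
      have u: "?u \<in> tspace B (j w)" "?u c = u"
        by (rule coord_vec_in_tspace[OF B c(1) jc], rule coord_vec_at[OF B c(1) jc])
      have "?u \<in> {v \<in> tspace B (j w). v c \<in> range (fderiv (cmap c \<circ> j) w)} \<longleftrightarrow>
          ?u \<in> {v \<in> tspace B (j w). v c \<in> span {X ?x, Y ?x}}" unfolding eq ..
      then show ?thesis unfolding mem_Collect_eq u(2) using u(1) by blast
    qed
    then show "range (fderiv (cmap c \<circ> j) w) = span {X ?x, Y ?x}" by blast
  qed
  have "fderiv Y ((cmap c \<circ> j) w0) (X ((cmap c \<circ> j) w0)) - fderiv X ((cmap c \<circ> j) w0) (Y ((cmap c \<circ> j) w0))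
      \<in> range (fderiv (cmap c \<circ> j) w0)"
  proof (rule bracket_tangent_to_integral_map[OF oW smJ w0' I[OF w0'] T(1) img sm(1) _ sm(2)])
    show "X ((cmap c \<circ> j) w) \<in> range (fderiv (cmap c \<circ> j) w)" "Y ((cmap c \<circ> j) w) \<in> range (fderiv (cmap c \<circ> j) w)"
      if "w \<in> ?W" for w unfolding R[OF that] by (rule span_base, simp)+
  qed
  then show ?thesis unfolding R[OF w0'] by (simp add: w0(2))
qed

lemma bracket_in_span_imp_integral_surface:
  fixes B :: "('b::{t2_space,second_countable_topology}, 'f::euclidean_space) chart set"
  assumes B: "smooth_manifold B" and c: "c \<in> B" "p \<in> cdom c" and T: "open T" "cmap c p \<in> T" "T \<subseteq> crange c"
    and sm: "smooth_on T X" "smooth_on T Y"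
    and indep: "\<And>a b. a *\<^sub>R X (cmap c p) + b *\<^sub>R Y (cmap c p) = 0 \<Longrightarrow> a = 0 \<and> b = 0"
    and inv: "\<And>x. x \<in> T \<Longrightarrow> fderiv Y x (X x) - fderiv X x (Y x) \<in> span {X x, Y x}"
    and \<Delta>: "\<And>x. x \<in> T \<Longrightarrow> \<Delta> (cinv c x) = {v \<in> tspace B (cinv c x). v c \<in> span {X x, Y x}}"
  shows "\<exists>W. \<exists>j :: real \<times> real \<Rightarrow> 'b. open W \<and> p \<in> j ` W \<and> inj_on j W \<and> smooth_map_on std_atlas B W j \<and>
       (\<forall>x\<in>W. inj_on (tmap std_atlas B j x) (tspace std_atlas x) \<and>
               tmap std_atlas B j x ` tspace std_atlas x = \<Delta> (j x))"
proof (rule frobenius_rank_two[OF T(1,2) sm indep inv])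
  fix W :: "(real \<times> real) set" and J
  assume W: "open W" "(0, 0) \<in> W" and J0: "J (0, 0) = cmap c p" and J: "smooth_on W J" "J ` W \<subseteq> T" "inj_on J W"
    and dJ: "\<And>z. z \<in> W \<Longrightarrow> inj (fderiv J z)" "\<And>z. z \<in> W \<Longrightarrow> range (fderiv J z) = span {X (J z), Y (J z)}"
  let ?j = "cinv c \<circ> J"
  have JT: "J z \<in> T" "J z \<in> crange c" if "z \<in> W" for z using J(2) T(3) that by blast+
  have sj: "smooth_map_on std_atlas B W ?j"
    by (rule smooth_map_on_stdI[OF B c(1) W(1) J(1)]) (use JT(2) in blast)
  have cj: "(cmap c \<circ> ?j) z = J z" if "z \<in> W" for z using cmap_cinv[OF B c(1) JT(2)[OF that]] by simp
  show ?thesis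
  proof (intro exI[of _ W] exI[of _ ?j] conjI ballI W(1) sj)
    show "p \<in> ?j ` W" by (rule image_eqI[OF _ W(2)]) (simp add: J0 cinv_cmap[OF B c])
    show "inj_on ?j W"
    proof (rule inj_onI)
      fix z z' assume z: "z \<in> W" "z' \<in> W" and "?j z = ?j z'"
      then have "(cmap c \<circ> ?j) z = (cmap c \<circ> ?j) z'" by simp
      then show "z = z'" unfolding cj[OF z(1)] cj[OF z(2)] by (rule inj_onD[OF J(3) _ z])
    qed
    fix z assume z: "z \<in> W"
    have jc: "?j z \<in> cdom c" using cinv_in_cdom[OF B c(1) JT(2)[OF z]] by simp
    have d: "fderiv (cmap c \<circ> ?j) z = fderiv J z" by (rule fderiv_cong_open[OF W(1) z cj])
    note pc = parametrization_chart[OF B W(1) sj z c(1) jc, unfolded d]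
    show "inj_on (tmap std_atlas B ?j z) (tspace std_atlas z)" by (rule pc(1)[THEN iffD2, OF dJ(1)[OF z]])
    have "\<Delta> (?j z) = {v \<in> tspace B (?j z). v c \<in> span {X (J z), Y (J z)}}" using \<Delta>[OF JT(1)[OF z]] by simp
    then show "tmap std_atlas B ?j z ` tspace std_atlas z = \<Delta> (?j z)" unfolding pc(2) dJ(2)[OF z] by simp
  qed
qed

section \<open>Integrability of the distribution spanned by \<open>\<phi> N\<close> and \<open>\<xi>\<close>\<close>

theorem theorem6p7:
  fixes n :: nat
    and A :: "('a::{t2_space,second_countable_topology}, 'e::euclidean_space) chart set"
    and B :: "('b::{t2_space,second_countable_topology}, 'f::euclidean_space) chart set"
    and \<phi> :: "'a \<Rightarrow> ('a, 'e) tvec \<Rightarrow> ('a, 'e) tvec"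
    and \<xi> :: "'a \<Rightarrow> ('a, 'e) tvec"
    and \<eta> :: "'a \<Rightarrow> ('a, 'e) tvec \<Rightarrow> real"
    and g :: "'a \<Rightarrow> ('a, 'e) tvec \<Rightarrow> ('a, 'e) tvec \<Rightarrow> real"
    and \<epsilon> :: real
    and \<Gamma> :: "('a, 'e) christoffel"
    and \<iota> :: "'b \<Rightarrow> 'a"
    and S :: "'b \<Rightarrow> ('a, 'e) tvec set"
  assumes "smooth_manifold A" and "DIM('e) = n + 2"
    and "para_sasakian A \<phi> \<xi> \<eta> g \<epsilon> \<Gamma>"
    and "lightlike_hypersurface B A \<iota> g"
    and "screen_distribution B A \<iota> g S"
    and "\<forall>p. \<xi> (\<iota> p) \<in> S p"
    and "screen_semi_invariant B A \<iota> \<phi> g S"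
  shows "integrable_distribution TYPE(real \<times> real) B (Dprime_xi B A \<iota> \<phi> \<xi> g S) \<longleftrightarrow>
    (\<forall>U E N. null_pair B A \<iota> g S U E N \<longrightarrow>
      (\<forall>p\<in>U. shape_operator B A \<Gamma> \<iota> N p (to_intrinsic B A \<iota> p (\<xi> (\<iota> p))) + \<epsilon> *\<^sub>R \<phi> (\<iota> p) (N p) = 0))"
proof -
  note hyp = assms(1,3,4,5)
  note mB = hyp_manifold[OF hyp]
  note frame = distribution_frame[OF hyp assms(6,7)]
  let ?\<Delta> = "Dprime_xi B A \<iota> \<phi> \<xi> g S"
  let ?cond = "\<lambda>N p. shape_operator B A \<Gamma> \<iota> N p (to_intrinsic B A \<iota> p (\<xi> (\<iota> p))) + \<epsilon> *\<^sub>R \<phi> (\<iota> p) (N p) = 0"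
  have frame: "\<exists>T X Y. open T \<and> cmap c p \<in> T \<and> T \<subseteq> cmap c ` (cdom c \<inter> U) \<and> smooth_on T X \<and> smooth_on T Y \<and>
      (\<forall>x\<in>T. (\<forall>a b. a *\<^sub>R X x + b *\<^sub>R Y x = 0 \<longrightarrow> a = 0 \<and> b = 0) \<and>
        ?\<Delta> (cinv c x) = {v \<in> tspace B (cinv c x). v c \<in> span {X x, Y x}} \<and>
        (fderiv Y x (X x) - fderiv X x (Y x) \<in> span {X x, Y x} \<longleftrightarrow> ?cond N (cinv c x)))"
    if "null_pair B A \<iota> g S U E N" "p \<in> U" "c \<in> B" "p \<in> cdom c" for U E N p c
  proof -
    have sub: "?\<Delta> q \<subseteq> tspace B q" for q by (auto simp: Dprime_xi_def)
    from frame[OF that] obtain T X Y where 1: "open T" "cmap c p \<in> T" "T \<subseteq> cmap c ` (cdom c \<inter> U)" "smooth_on T X" "smooth_on T Y"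
      and 2: "\<forall>x\<in>T. (\<forall>a b. a *\<^sub>R X x + b *\<^sub>R Y x = 0 \<longrightarrow> a = 0 \<and> b = 0) \<and>
      (\<forall>v\<in>tspace B (cinv c x). v \<in> ?\<Delta> (cinv c x) \<longleftrightarrow> v c \<in> span {X x, Y x}) \<and>
      (fderiv Y x (X x) - fderiv X x (Y x) \<in> span {X x, Y x} \<longleftrightarrow> ?cond N (cinv c x))"
      by (elim exE conjE)
    have "?\<Delta> (cinv c x) = {v \<in> tspace B (cinv c x). v c \<in> span {X x, Y x}}" if "x \<in> T" for x
      using conjunct1[OF conjunct2[OF bspec[OF 2 that]]] sub[of "cinv c x"] by blast
    with 1 2 show ?thesis by (intro exI[of _ T] exI[of _ X] exI[of _ Y]) simp
  qed
  show ?thesis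
  proof (intro iffI allI impI ballI)
    fix U E N p
    assume int: "integrable_distribution TYPE(real \<times> real) B ?\<Delta>" and pair: "null_pair B A \<iota> g S U E N" and p: "p \<in> U"
    obtain c where c: "c \<in> B" "p \<in> cdom c" using ex_chart[OF mB] by blast
    from frame[OF pair p c] obtain T X Y where T: "open T" "cmap c p \<in> T" "T \<subseteq> cmap c ` (cdom c \<inter> U)"
      and sm: "smooth_on T X" "smooth_on T Y"
      and F: "\<forall>x\<in>T. (\<forall>a b. a *\<^sub>R X x + b *\<^sub>R Y x = 0 \<longrightarrow> a = 0 \<and> b = 0) \<and>
        ?\<Delta> (cinv c x) = {v \<in> tspace B (cinv c x). v c \<in> span {X x, Y x}} \<and>
        (fderiv Y x (X x) - fderiv X x (Y x) \<in> span {X x, Y x} \<longleftrightarrow> ?cond N (cinv c x))"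
      by (elim exE conjE)
    have "T \<subseteq> crange c" using T(3) by (auto simp: crange_def)
    from integrable_imp_bracket_in_span[OF mB int c T(1,2) this sm conjunct1[OF conjunct2[OF bspec[OF F]]]]
    have "fderiv Y (cmap c p) (X (cmap c p)) - fderiv X (cmap c p) (Y (cmap c p)) \<in> span {X (cmap c p), Y (cmap c p)}"
      by blast
    with conjunct2[OF conjunct2[OF bspec[OF F T(2)]]] show "?cond N p" by (simp only: cinv_cmap[OF mB c])
  next
    assume cond: "\<forall>U E N. null_pair B A \<iota> g S U E N \<longrightarrow> (\<forall>p\<in>U. ?cond N p)"
    show "integrable_distribution TYPE(real \<times> real) B ?\<Delta>"
      unfolding integrable_distribution_def
    proof
      fix p
      obtain U E N where pair: "null_pair B A \<iota> g S U E N" and p: "p \<in> U" using null_pair_exists[OF hyp] by blast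
      obtain c where c: "c \<in> B" "p \<in> cdom c" using ex_chart[OF mB] by blast
      from frame[OF pair p c] obtain T X Y where T: "open T" "cmap c p \<in> T" "T \<subseteq> cmap c ` (cdom c \<inter> U)"
        and sm: "smooth_on T X" "smooth_on T Y"
        and F: "\<forall>x\<in>T. (\<forall>a b. a *\<^sub>R X x + b *\<^sub>R Y x = 0 \<longrightarrow> a = 0 \<and> b = 0) \<and>
          ?\<Delta> (cinv c x) = {v \<in> tspace B (cinv c x). v c \<in> span {X x, Y x}} \<and>
          (fderiv Y x (X x) - fderiv X x (Y x) \<in> span {X x, Y x} \<longleftrightarrow> ?cond N (cinv c x))"
        by (elim exE conjE)
      have Tc: "T \<subseteq> crange c" using T(3) by (auto simp: crange_def)
      show "\<exists>W. \<exists>j :: real \<times> real \<Rightarrow> 'b. open W \<and> p \<in> j ` W \<and> inj_on j W \<and> smooth_map_on std_atlas B W j \<and>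
         (\<forall>x\<in>W. inj_on (tmap std_atlas B j x) (tspace std_atlas x) \<and>
                 tmap std_atlas B j x ` tspace std_atlas x = ?\<Delta> (j x))"
      proof (rule bracket_in_span_imp_integral_surface[OF mB c T(1,2) Tc sm])
        show "a = 0 \<and> b = 0" if "a *\<^sub>R X (cmap c p) + b *\<^sub>R Y (cmap c p) = 0" for a b
          using conjunct1[OF bspec[OF F T(2)]] that by blast
        fix x assume x: "x \<in> T"
        show "?\<Delta> (cinv c x) = {v \<in> tspace B (cinv c x). v c \<in> span {X x, Y x}}"
          by (rule conjunct1[OF conjunct2[OF bspec[OF F x]]])
        have "cinv c x \<in> U" using T(3) x cinv_cmap[OF mB c(1)] by auto
        then have "?cond N (cinv c x)" using cond pair by blast
        then show "fderiv Y x (X x) - fderiv X x (Y x) \<in> span {X x, Y x}"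
          by (rule iffD2[OF conjunct2[OF conjunct2[OF bspec[OF F x]]]])
      qed
    qed
  qed
qed

end
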